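(* Let $d,n\in\mathbb{N}$ (positive integers). Define $\Phi_{d,n}\colon\mathbb{X}_{d,n}^0\to\mathbb{P}_{d,n}^0$ by $[X]\mapsto I-M_{b_X}M_{b_X}^*$ (this does not depend on the choices made in constructing $b_X$). Then $\Phi_{d,n}$ is continuous, $\Psi_{d,n}\circ\Phi_{d,n}=\mathrm{Id}_{\mathbb{X}_{d,n}^0}$, and $\Phi_{d,n}\circ\Psi_{d,n}|_{\mathbb{P}_{d,n}^0}=\mathrm{Id}_{\mathbb{P}_{d,n}^0}$.
   Context: $\mathbb{B}_d$ is the open unit ball of $\mathbb{C}^d$. The Drury-Arveson space $H^2_d$ is the reproducing kernel Hilbert space of holomorphic functions on $\mathbb{B}_d$ with kernel $k(z,w)=\frac{1}{1-\langle z,w\rangle}$; $k_\lambda=k(\cdot,\lambda)$. $\mathcal{M}_d$ is its multiplier algebra, $M_f$ is multiplication by $f$, $M_z=(M_{z_1},\dots,M_{z_d})$. $\mathbb{P}_{d,n}\subset B(H^2_d)$ is the set of orthogonal projections $P$ with $\dim(PH^2_d)=n$ and $PM_f^*P=M_f^*P$ for all $f\in\mathcal{M}_d$, with the operator norm topology. $\mathbb{X}_{d,n}=\mathbb{B}_d^n/S_n$ is the set of multisets of $n$ points of $\mathbb{B}_d$, written as formal sums $\sum_jm_j[\lambda_j]$ with $\sum_j m_j=n$, with the metric $d_s([X],[Y])=\min_{\sigma\in S_n}\max_jd_{ph}(x_j,y_{\sigma(j)})$, where $d_{ph}(z,w)^2=1-\frac{(1-\|z\|^2)(1-\|w\|^2)}{|1-\langle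 z,w\rangle|^2}$. $\mathbb{X}_{d,n}^0\subset\mathbb{X}_{d,n}$ consists of the multisets of $n$ distinct points. $\Psi_{d,n}\colon\mathbb{P}_{d,n}\to\mathbb{X}_{d,n}$ is $\Psi_{d,n}(P)=\sigma_J(PM_z|_{PH^2_d})$, where for a commuting tuple $A$ on an $n$-dimensional space (similar to a strict row contraction) $\sigma_J(A)=\sum_{\lambda\in\sigma(A)}\dim R_\lambda(A)[\lambda]$, $\sigma(A)=\{\lambda\in\mathbb{C}^d:\bigcap_j\ker(A_j-\lambda_j I)\neq\{0\}\}$, $R_\lambda(A)=\bigcap_{|\alpha|=n}\ker(A-\lambda I)^\alpha$. $\mathbb{P}_{d,n}^0=\Psi_{d,n}^{-1}(\mathbb{X}_{d,n}^0)$; it is the set of projections in $\mathbb{P}_{d,n}$ onto spans of $n$ distinct kernel functions. Construction of $b_X$. For $\lambda\in\mathbb{B}_d$ let $\varphi_\lambda(z)=\frac{\lambda-P_\lambda z-\sqrt{1-\|\lambda\|^2}(I-P_\lambda)z}{1-\langle z,\lambda\rangle}$, with $P_\lambda$ the orthogonal projection onto $\mathbb{C}\lambda$ ($P_0=0$), regarded as a row vector of length $d$. Given $[X]\in\mathbb{X}_{d,n}^0$, choose an ordering $X=(\lambda_1,\dots,\lambda_n)$. Put $b_1=\varphi_{\lambda_1}$ and, for $2\le m\le n$, $b_m(z)=b_{m-1}(z)\,U_m\begin{pmatrix}\varphi_{\lambda_m}(z)&0\\0&I_{(m-1)(d-1)}\end{pmatrix}$, where $U_m$ is any (scalar) unitary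 matrix of size $(m-1)(d-1)+1$ with $U_me_1=\frac{1}{\|b_{m-1}(\lambda_m)\|}b_{m-1}(\lambda_m)^*$. Set $b_X=b_n$, a row of length $N=(n-1)(d-1)+d$ with entries in $\mathcal{M}_d$, and let $M_{b_X}\colon H^2_d\otimes\mathbb{C}^N\to H^2_d$ be the corresponding row multiplication operator. It is a partial isometry with range $H^2_d\ominus\mathrm{Span}\{k_\lambda:\lambda\in X\}$. *)

theory Defs
  imports
    "HOL-Analysis.Analysis"
    "HOL-Library.Function_Algebras"
    "HOL-Library.Multiset"
    "HOL-Combinatorics.Permutations"
    "Jordan_Normal_Form.Schur_Decomposition"
begin

no_notation Matrix.vec_index (infixl \<open>$\<close> 100)

section \<open>Hilbert spaces of functions\<close>

definition cscale :: "complex \<Rightarrow> ('x \<Rightarrow> complex) \<Rightarrow> 'x \<Rightarrow> complex" where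
  "cscale c f = (\<lambda>x. c * f x)"

interpretation cfun: vector_space cscale
  by standard (auto simp: cscale_def fun_eq_iff algebra_simps)

definition hnorm :: "(('x \<Rightarrow> complex) \<Rightarrow> ('x \<Rightarrow> complex) \<Rightarrow> complex) \<Rightarrow> ('x \<Rightarrow> complex) \<Rightarrow> real" where
  "hnorm ip f = sqrt (Re (ip f f))"

text \<open>The inner product \<open>ip\<close> is linear in its first argument; only its values on \<open>H\<close> matter.\<close>

locale function_hilbert_space =
  fixes H :: "('x \<Rightarrow> complex) set"
    and ip :: "('x \<Rightarrow> complex) \<Rightarrow> ('x \<Rightarrow> complex) \<Rightarrow> complex"
  assumes subspace: "cfun.subspace H"
    and ip_add: "\<lbrakk>f \<in> H; g \<in> H; h \<in> H\<rbrakk> \<Longrightarrow> ip (f + g) h = ip f h + ip g h"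
    and ip_scale: "\<lbrakk>f \<in> H; g \<in> H\<rbrakk> \<Longrightarrow> ip (cscale c f) g = c * ip f g"
    and ip_commute: "\<lbrakk>f \<in> H; g \<in> H\<rbrakk> \<Longrightarrow> ip g f = cnj (ip f g)"
    and ip_pos: "\<lbrakk>f \<in> H; f \<noteq> 0\<rbrakk> \<Longrightarrow> Re (ip f f) > 0"
    and complete: "\<lbrakk>\<And>i. s i \<in> H;
        \<And>e. e > 0 \<Longrightarrow> \<exists>N. \<forall>i\<ge>N. \<forall>j\<ge>N. hnorm ip (s i - s j) < e\<rbrakk>
      \<Longrightarrow> \<exists>f\<in>H. (\<lambda>i. hnorm ip (s i - f)) \<longlonglongrightarrow> 0"

text \<open>A function on \<open>B\<close> is represented by its extension by \<open>0\<close> to the whole type, so that a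
  function on \<open>B\<close> has exactly one representative.\<close>

locale rkhs = function_hilbert_space H ip
  for H :: "('x \<Rightarrow> complex) set" and ip +
  fixes B :: "'x set" and k :: "'x \<Rightarrow> 'x \<Rightarrow> complex"
  assumes zero_outside: "\<lbrakk>f \<in> H; x \<notin> B\<rbrakk> \<Longrightarrow> f x = 0"
    and kernel_mem: "y \<in> B \<Longrightarrow> (\<lambda>x. if x \<in> B then k x y else 0) \<in> H"
    and reproducing: "\<lbrakk>f \<in> H; y \<in> B\<rbrakk> \<Longrightarrow> ip f (\<lambda>x. if x \<in> B then k x y else 0) = f y"

section \<open>Operators\<close>

text \<open>An operator on \<open>H\<close> is an element of \<open>H \<rightarrow>\<^sub>E H\<close>, i.e. it is \<open>undefined\<close> outside \<open>H\<close>, so that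
  equality of operators is equality in HOL.\<close>

definition bounded_ops ::
  "('x \<Rightarrow> complex) set \<Rightarrow> (('x \<Rightarrow> complex) \<Rightarrow> ('x \<Rightarrow> complex) \<Rightarrow> complex)
    \<Rightarrow> (('x \<Rightarrow> complex) \<Rightarrow> ('x \<Rightarrow> complex)) set" where
  "bounded_ops H ip = {T \<in> H \<rightarrow>\<^sub>E H.
     (\<forall>f\<in>H. \<forall>g\<in>H. T (f + g) = T f + T g) \<and>
     (\<forall>c. \<forall>f\<in>H. T (cscale c f) = cscale c (T f)) \<and>
     (\<exists>C. \<forall>f\<in>H. hnorm ip (T f) \<le> C * hnorm ip f)}"

definition op_dist ::
  "('x \<Rightarrow> complex) set \<Rightarrow> (('x \<Rightarrow> complex) \<Rightarrow> ('x \<Rightarrow> complex) \<Rightarrow> complex)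
    \<Rightarrow> (('x \<Rightarrow> complex) \<Rightarrow> ('x \<Rightarrow> complex)) \<Rightarrow> (('x \<Rightarrow> complex) \<Rightarrow> ('x \<Rightarrow> complex)) \<Rightarrow> real" where
  "op_dist H ip S T = (SUP f \<in> {f \<in> H. hnorm ip f \<le> 1}. hnorm ip (S f - T f))"

definition orth_projections ::
  "('x \<Rightarrow> complex) set \<Rightarrow> (('x \<Rightarrow> complex) \<Rightarrow> ('x \<Rightarrow> complex) \<Rightarrow> complex)
    \<Rightarrow> (('x \<Rightarrow> complex) \<Rightarrow> ('x \<Rightarrow> complex)) set" where
  "orth_projections H ip = {P \<in> bounded_ops H ip.
     (\<forall>f\<in>H. P (P f) = P f) \<and> (\<forall>f\<in>H. \<forall>g\<in>H. ip (P f) g = ip f (P g))}"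

definition adjoint_op ::
  "'a set \<Rightarrow> ('a \<Rightarrow> 'a \<Rightarrow> complex) \<Rightarrow> 'b set \<Rightarrow> ('b \<Rightarrow> 'b \<Rightarrow> complex) \<Rightarrow> ('a \<Rightarrow> 'b) \<Rightarrow> 'b \<Rightarrow> 'a" where
  "adjoint_op H1 ip1 H2 ip2 T =
     (\<lambda>h\<in>H2. THE u. u \<in> H1 \<and> (\<forall>g\<in>H1. ip2 (T g) h = ip1 g u))"

definition multipliers :: "('x \<Rightarrow> complex) set \<Rightarrow> ('x \<Rightarrow> complex) set" where
  "multipliers H = {f. \<forall>g\<in>H. f * g \<in> H}"

definition mult_op :: "('x \<Rightarrow> complex) set \<Rightarrow> ('x \<Rightarrow> complex) \<Rightarrow> ('x \<Rightarrow> complex) \<Rightarrow> 'x \<Rightarrow> complex" where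
  "mult_op H f = (\<lambda>g\<in>H. f * g)"

text \<open>\<open>H \<otimes> \<complex>\<^sup>N\<close> as the space of \<open>N\<close>-tuples in \<open>H\<close>.\<close>

definition tuple_space :: "('x \<Rightarrow> complex) set \<Rightarrow> nat \<Rightarrow> (nat \<Rightarrow> 'x \<Rightarrow> complex) set" where
  "tuple_space H N = {..<N} \<rightarrow>\<^sub>E H"

definition tuple_ip ::
  "(('x \<Rightarrow> complex) \<Rightarrow> ('x \<Rightarrow> complex) \<Rightarrow> complex) \<Rightarrow> nat
    \<Rightarrow> (nat \<Rightarrow> 'x \<Rightarrow> complex) \<Rightarrow> (nat \<Rightarrow> 'x \<Rightarrow> complex) \<Rightarrow> complex" where
  "tuple_ip ip N g h = (\<Sum>j<N. ip (g j) (h j))"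

text \<open>A row of \<open>N\<close> functions is given as a function with values in the \<open>1 \<times> N\<close> matrices.\<close>

definition row_mult_op ::
  "('x \<Rightarrow> complex) set \<Rightarrow> nat \<Rightarrow> ('x \<Rightarrow> complex Matrix.mat) \<Rightarrow> (nat \<Rightarrow> 'x \<Rightarrow> complex) \<Rightarrow> 'x \<Rightarrow> complex" where
  "row_mult_op H N b = (\<lambda>g \<in> tuple_space H N. \<lambda>z. \<Sum>j<N. b z $$ (0, j) * g j z)"

definition row_defect_op ::
  "('x \<Rightarrow> complex) set \<Rightarrow> (('x \<Rightarrow> complex) \<Rightarrow> ('x \<Rightarrow> complex) \<Rightarrow> complex) \<Rightarrow> nat
    \<Rightarrow> ('x \<Rightarrow> complex Matrix.mat) \<Rightarrow> ('x \<Rightarrow> complex) \<Rightarrow> 'x \<Rightarrow> complex" where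
  "row_defect_op H ip N b =
     (\<lambda>f\<in>H. f - row_mult_op H N b
        (adjoint_op (tuple_space H N) (tuple_ip ip N) H ip (row_mult_op H N b) f))"

section \<open>The Drury--Arveson space\<close>

definition cinner :: "complex ^ 'd \<Rightarrow> complex ^ 'd \<Rightarrow> complex" where
  "cinner z w = (\<Sum>i\<in>UNIV. z $ i * cnj (w $ i))"

definition da_kernel :: "complex ^ 'd \<Rightarrow> complex ^ 'd \<Rightarrow> complex" where
  "da_kernel z w = 1 / (1 - cinner z w)"

definition holomorphic_on_ball :: "(complex ^ 'd::finite \<Rightarrow> complex) \<Rightarrow> bool" where
  "holomorphic_on_ball f \<longleftrightarrow>
     (\<forall>z \<in> ball 0 1. \<exists>D. (f has_derivative D) (at z) \<and> (\<forall>c v. D (c *s v) = c * D v))"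

locale drury_arveson = rkhs H ip "ball 0 1" da_kernel
  for H :: "(complex ^ 'd::finite \<Rightarrow> complex) set" and ip +
  assumes holomorphic: "f \<in> H \<Longrightarrow> holomorphic_on_ball f"

text \<open>\<open>cfun.dim\<close> is \<open>0\<close> on infinite-dimensional spaces, so \<open>n > 0\<close> is needed for the dimension
  condition to have its usual meaning.\<close>

definition coinvariant_projections ::
  "(complex ^ 'd::finite \<Rightarrow> complex) set
    \<Rightarrow> ((complex ^ 'd \<Rightarrow> complex) \<Rightarrow> (complex ^ 'd \<Rightarrow> complex) \<Rightarrow> complex) \<Rightarrow> nat
    \<Rightarrow> ((complex ^ 'd \<Rightarrow> complex) \<Rightarrow> (complex ^ 'd \<Rightarrow> complex)) set" where
  "coinvariant_projections H ip n = {P \<in> orth_projections H ip.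
     cfun.dim (P ` H) = n \<and>
     (\<forall>f \<in> multipliers H. \<forall>g\<in>H.
        P (adjoint_op H ip H ip (mult_op H f) (P g)) = adjoint_op H ip H ip (mult_op H f) (P g))}"

section \<open>Multisets of points of the ball\<close>

definition point_multisets :: "nat \<Rightarrow> (complex ^ 'd::finite) multiset set" where
  "point_multisets n = {X. size X = n \<and> set_mset X \<subseteq> ball 0 1}"

definition distinct_point_multisets :: "nat \<Rightarrow> (complex ^ 'd::finite) multiset set" where
  "distinct_point_multisets n = {X \<in> point_multisets n. \<forall>x. count X x \<le> 1}"

definition pseudohyp_dist :: "complex ^ 'd::finite \<Rightarrow> complex ^ 'd \<Rightarrow> real" where
  "pseudohyp_dist z w =
     sqrt (1 - (1 - (norm z)\<^sup>2) * (1 - (norm w)\<^sup>2) / (cmod (1 - cinner z w))\<^sup>2)"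

definition ordering_of :: "'a multiset \<Rightarrow> 'a list" where
  "ordering_of X = (SOME xs. mset xs = X)"

text \<open>The minimum over all permutations does not depend on the orderings of \<open>X\<close> and \<open>Y\<close>.\<close>

definition multiset_dist :: "(complex ^ 'd::finite) multiset \<Rightarrow> (complex ^ 'd) multiset \<Rightarrow> real" where
  "multiset_dist X Y =
     (let n = size X; x = ordering_of X; y = ordering_of Y in
      Min ((\<lambda>\<sigma>. Max ((\<lambda>j. pseudohyp_dist (x ! j) (y ! \<sigma> j)) ` {..<n})) ` {\<sigma>. \<sigma> permutes {..<n}}))"

text \<open>An arbitrary enumeration of the coordinates of \<open>\<complex>\<^sup>d\<close>, where \<open>d = CARD('d)\<close>. It orders the
  entries of row vectors and the factors of \<open>A\<^sup>\<alpha>\<close>.\<close>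

definition coords :: "'d::finite list" where
  "coords = (SOME is. distinct is \<and> set is = UNIV)"

section \<open>Joint spectral multisets\<close>

text \<open>The commuting tuple \<open>A\<close> acts on the finite-dimensional space \<open>V\<close>.\<close>

definition shifted :: "('d \<Rightarrow> ('x \<Rightarrow> complex) \<Rightarrow> 'x \<Rightarrow> complex) \<Rightarrow> complex ^ 'd
    \<Rightarrow> 'd \<Rightarrow> ('x \<Rightarrow> complex) \<Rightarrow> 'x \<Rightarrow> complex" where
  "shifted A \<mu> j = (\<lambda>v. A j v - cscale (\<mu> $ j) v)"

definition tuple_power :: "('d::finite \<Rightarrow> 'a \<Rightarrow> 'a) \<Rightarrow> ('d \<Rightarrow> nat) \<Rightarrow> 'a \<Rightarrow> 'a" where
  "tuple_power A \<alpha> = foldr (\<lambda>j T. (A j ^^ \<alpha> j) \<circ> T) coords id"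

definition joint_spectrum ::
  "('x \<Rightarrow> complex) set \<Rightarrow> ('d \<Rightarrow> ('x \<Rightarrow> complex) \<Rightarrow> 'x \<Rightarrow> complex) \<Rightarrow> (complex ^ 'd) set" where
  "joint_spectrum V A = {\<mu>. {v \<in> V. \<forall>j. shifted A \<mu> j v = 0} \<noteq> {0}}"

definition root_space ::
  "('x \<Rightarrow> complex) set \<Rightarrow> ('d::finite \<Rightarrow> ('x \<Rightarrow> complex) \<Rightarrow> 'x \<Rightarrow> complex) \<Rightarrow> complex ^ 'd
    \<Rightarrow> ('x \<Rightarrow> complex) set" where
  "root_space V A \<mu> =
     {v \<in> V. \<forall>\<alpha>. (\<Sum>j\<in>UNIV. \<alpha> j) = cfun.dim V \<longrightarrow> tuple_power (shifted A \<mu>) \<alpha> v = 0}"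

definition spectral_multiset ::
  "('x \<Rightarrow> complex) set \<Rightarrow> ('d::finite \<Rightarrow> ('x \<Rightarrow> complex) \<Rightarrow> 'x \<Rightarrow> complex) \<Rightarrow> (complex ^ 'd) multiset" where
  "spectral_multiset V A = (\<Sum>\<mu> \<in> joint_spectrum V A. replicate_mset (cfun.dim (root_space V A \<mu>)) \<mu>)"

definition Psi ::
  "(complex ^ 'd::finite \<Rightarrow> complex) set \<Rightarrow> ((complex ^ 'd \<Rightarrow> complex) \<Rightarrow> (complex ^ 'd \<Rightarrow> complex))
    \<Rightarrow> (complex ^ 'd) multiset" where
  "Psi H P = spectral_multiset (P ` H) (\<lambda>j. \<lambda>v \<in> P ` H. P (mult_op H (\<lambda>z. z $ j) v))"

definition coinvariant_projections0 ::
  "(complex ^ 'd::finite \<Rightarrow> complex) set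
    \<Rightarrow> ((complex ^ 'd \<Rightarrow> complex) \<Rightarrow> (complex ^ 'd \<Rightarrow> complex) \<Rightarrow> complex) \<Rightarrow> nat
    \<Rightarrow> ((complex ^ 'd \<Rightarrow> complex) \<Rightarrow> (complex ^ 'd \<Rightarrow> complex)) set" where
  "coinvariant_projections0 H ip n =
     {P \<in> coinvariant_projections H ip n. Psi H P \<in> distinct_point_multisets n}"

section \<open>The rows \<open>b\<^sub>X\<close>\<close>

definition line_proj :: "complex ^ 'd::finite \<Rightarrow> complex ^ 'd \<Rightarrow> complex ^ 'd" where
  "line_proj \<mu> z = (if \<mu> = 0 then 0 else (cinner z \<mu> / cinner \<mu> \<mu>) *s \<mu>)"

definition ball_aut :: "complex ^ 'd::finite \<Rightarrow> complex ^ 'd \<Rightarrow> complex ^ 'd" where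
  "ball_aut \<mu> z = (1 / (1 - cinner z \<mu>)) *s
     (\<mu> - line_proj \<mu> z - complex_of_real (sqrt (1 - (norm \<mu>)\<^sup>2)) *s (z - line_proj \<mu> z))"

definition ball_aut_row :: "complex ^ 'd::finite \<Rightarrow> complex ^ 'd \<Rightarrow> complex Matrix.mat" where
  "ball_aut_row \<mu> z = Matrix.mat 1 CARD('d) (\<lambda>(_, j). ball_aut \<mu> z $ (coords ! j))"

definition row_norm :: "complex Matrix.mat \<Rightarrow> real" where
  "row_norm r = sqrt (\<Sum>j<dim_col r. (cmod (r $$ (0, j)))\<^sup>2)"

definition unitary_mat :: "nat \<Rightarrow> complex Matrix.mat \<Rightarrow> bool" where
  "unitary_mat s U \<longleftrightarrow> U \<in> carrier_mat s s \<and> mat_adjoint U * U = 1\<^sub>m s \<and> U * mat_adjoint U = 1\<^sub>m s"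

text \<open>\<open>b_row xs b\<close> says that \<open>b\<close> is one of the rows that the recursive construction can produce
  for the ordered tuple \<open>xs\<close>; each step allows every admissible unitary \<open>U\<close>. In the recursive
  step \<open>length xs\<close> is \<open>m - 1\<close>.\<close>

inductive b_row :: "(complex ^ 'd::finite) list \<Rightarrow> (complex ^ 'd \<Rightarrow> complex Matrix.mat) \<Rightarrow> bool" where
  single: "b_row [\<mu>] (ball_aut_row \<mu>)"
| step: "\<lbrakk>b_row xs b;
     k = length xs * (CARD('d) - 1);
     unitary_mat (k + 1) U;
     U *\<^sub>v unit_vec (k + 1) 0 =
       complex_of_real (1 / row_norm (b \<mu>)) \<cdot>\<^sub>v Matrix.col (mat_adjoint (b \<mu>)) 0\<rbrakk>
   \<Longrightarrow> b_row (xs @ [\<mu>])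
         (\<lambda>z. b z * U * four_block_mat (ball_aut_row \<mu> z) (0\<^sub>m 1 k) (0\<^sub>m k CARD('d)) (1\<^sub>m k))"

definition b_rows_of :: "(complex ^ 'd::finite) multiset \<Rightarrow> (complex ^ 'd \<Rightarrow> complex Matrix.mat) set" where
  "b_rows_of X = {b. \<exists>xs. mset xs = X \<and> b_row xs b}"

text \<open>The operator \<open>I - M\<^sub>b M\<^sub>b\<^sup>*\<close> for a row \<open>b\<close> arising from \<open>n\<close> points.\<close>

definition b_defect_op ::
  "(complex ^ 'd::finite \<Rightarrow> complex) set
    \<Rightarrow> ((complex ^ 'd \<Rightarrow> complex) \<Rightarrow> (complex ^ 'd \<Rightarrow> complex) \<Rightarrow> complex) \<Rightarrow> nat
    \<Rightarrow> (complex ^ 'd \<Rightarrow> complex Matrix.mat) \<Rightarrow> (complex ^ 'd \<Rightarrow> complex) \<Rightarrow> complex ^ 'd \<Rightarrow> complex" where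
  "b_defect_op H ip n b = row_defect_op H ip ((n - 1) * (CARD('d) - 1) + CARD('d)) b"

definition Phi ::
  "(complex ^ 'd::finite \<Rightarrow> complex) set
    \<Rightarrow> ((complex ^ 'd \<Rightarrow> complex) \<Rightarrow> (complex ^ 'd \<Rightarrow> complex) \<Rightarrow> complex) \<Rightarrow> nat
    \<Rightarrow> (complex ^ 'd) multiset \<Rightarrow> (complex ^ 'd \<Rightarrow> complex) \<Rightarrow> complex ^ 'd \<Rightarrow> complex" where
  "Phi H ip n X = b_defect_op H ip n (SOME b. b \<in> b_rows_of X)"

end

theory Submission
  imports Defs
begin

text \<open>
  For distinct points \<open>X\<close> the operator \<open>\<Phi>(X)\<close> is the orthogonal projection onto the span of the kernel
  functions \<open>k\<^sub>\<lambda>\<close>, \<open>\<lambda> \<in> X\<close>; everything else follows from this description.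

  To see it, one computes with kernels. If \<open>(1 - b(z) b(w)\<^sup>*) k(z, w)\<close> is the kernel \<open>(P k\<^sub>w)(z)\<close> of an
  orthogonal projection \<open>P\<close>, then the row \<open>b\<close> is a contractive multiplier and
  \<open>I - M\<^sub>b M\<^sub>b\<^sup>* = P\<close> (\<open>row_contraction\<close>, \<open>row_defect_op_eq_projection\<close>); the proof rests on Riesz
  representation. The rows \<open>b\<^sub>X\<close> satisfy the hypothesis because their recursive construction is the
  Gram--Schmidt process for the kernel functions (\<open>b_row_defect\<close>): by the automorphism identity for
  \<open>\<phi>\<^sub>\<mu>\<close>, each step adds the rank one kernel of the component of \<open>k\<^sub>\<mu>\<close> orthogonal to the previous
  span. The same result for the row \<open>(z\<^sub>1, \<dots>, z\<^sub>d)\<close> shows that the coordinate functions are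
  multipliers, so points can be separated by polynomials; hence kernel functions at distinct points
  are linearly independent.

  Evaluation on \<open>X\<close> identifies the span with \<open>\<complex>\<^sup>X\<close> and diagonalises the compressed coordinate
  multiplications, so \<open>\<Psi>(\<Phi>(X)) = X\<close> (\<open>Psi_kernel_projection\<close>). Conversely, if the compressions to a
  coinvariant space have \<open>n\<close> distinct joint eigenvalues \<open>\<mu>\<close>, the dual basis of the eigenvectors
  consists of joint eigenvectors of the adjoints \<open>M\<^sub>z\<^sub>j\<^sup>*\<close>. By \<open>joint_adjoint_eigenvector\<close> these are
  multiples of the \<open>k\<^sub>\<mu>\<close>, so the space is spanned by kernel functions (\<open>ker_mem_coinvariant\<close>), which
  gives \<open>\<Phi>(\<Psi>(P)) = P\<close>.

  Continuity: up to the factor \<open>\<parallel>k\<^sub>z\<parallel>\<close>, the pseudohyperbolic distance of \<open>z\<close> and \<open>w\<close> is the distance of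
  \<open>k\<^sub>z\<close> from \<open>\<complex> k\<^sub>w\<close>. So for \<open>Y\<close> close to \<open>X\<close> the two spans have nearby bases, and the projections are
  close in norm (\<open>proj_perturbation\<close>).
\<close>

section \<open>Geometry of a Hilbert space of functions\<close>

context function_hilbert_space
begin

lemma zero_mem [simp]: "0 \<in> H"
  using cfun.subspace_0[OF subspace] .

lemma add_mem [simp]: "f \<in> H \<Longrightarrow> g \<in> H \<Longrightarrow> f + g \<in> H"
  using cfun.subspace_add[OF subspace] .

lemma diff_mem [simp]: "f \<in> H \<Longrightarrow> g \<in> H \<Longrightarrow> f - g \<in> H"
  using cfun.subspace_diff[OF subspace] .

lemma scale_mem [simp]: "f \<in> H \<Longrightarrow> cscale c f \<in> H"
  using cfun.subspace_scale[OF subspace] .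

lemma sum_mem: "(\<And>i. i \<in> A \<Longrightarrow> f i \<in> H) \<Longrightarrow> (\<Sum>i\<in>A. f i) \<in> H"
  using cfun.subspace_sum[OF subspace] .

lemma span_mem: "F \<subseteq> H \<Longrightarrow> f \<in> cfun.span F \<Longrightarrow> f \<in> H"
  using cfun.span_minimal[OF _ subspace] by blast

lemma ip_add_right: "f \<in> H \<Longrightarrow> g \<in> H \<Longrightarrow> h \<in> H \<Longrightarrow> ip h (f + g) = ip h f + ip h g"
  by (metis add_mem complex_cnj_add ip_add ip_commute)

lemma ip_scale_right: "f \<in> H \<Longrightarrow> g \<in> H \<Longrightarrow> ip f (cscale c g) = cnj c * ip f g"
  by (metis complex_cnj_mult ip_commute ip_scale scale_mem)

lemma ip_zero_left [simp]: "f \<in> H \<Longrightarrow> ip 0 f = 0"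
  using ip_scale[of 0 f 0] by simp

lemma ip_zero_right [simp]: "f \<in> H \<Longrightarrow> ip f 0 = 0"
  using ip_commute[of 0 f] by simp

lemma ip_diff: "f \<in> H \<Longrightarrow> g \<in> H \<Longrightarrow> h \<in> H \<Longrightarrow> ip (f - g) h = ip f h - ip g h"
  using ip_add[of "f - g" g h] by simp

lemma ip_diff_right: "f \<in> H \<Longrightarrow> g \<in> H \<Longrightarrow> h \<in> H \<Longrightarrow> ip h (f - g) = ip h f - ip h g"
  using ip_add_right[of "f - g" g h] by simp

lemma ip_sum:
  "(\<And>i. i \<in> A \<Longrightarrow> f i \<in> H) \<Longrightarrow> h \<in> H \<Longrightarrow> ip (\<Sum>i\<in>A. f i) h = (\<Sum>i\<in>A. ip (f i) h)"
  by (induction A rule: infinite_finite_induct) (auto simp: ip_add sum_mem)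

lemma ip_sum_right:
  "(\<And>i. i \<in> A \<Longrightarrow> f i \<in> H) \<Longrightarrow> h \<in> H \<Longrightarrow> ip h (\<Sum>i\<in>A. f i) = (\<Sum>i\<in>A. ip h (f i))"
  by (induction A rule: infinite_finite_induct) (auto simp: ip_add_right sum_mem)

lemma ip_self_ge_0: "f \<in> H \<Longrightarrow> Re (ip f f) \<ge> 0"
  using ip_pos[of f] by (cases "f = 0") auto

lemma hnorm_nonneg [simp]: "f \<in> H \<Longrightarrow> hnorm ip f \<ge> 0"
  by (simp add: hnorm_def ip_self_ge_0)

lemma hnorm_sq: "f \<in> H \<Longrightarrow> (hnorm ip f)\<^sup>2 = Re (ip f f)"
  by (simp add: hnorm_def ip_self_ge_0)

lemma ip_self: "f \<in> H \<Longrightarrow> ip f f = complex_of_real ((hnorm ip f)\<^sup>2)"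
  using ip_commute[of f f] ip_self_ge_0[of f]
  by (simp add: complex_eq_iff hnorm_def)

lemma hnorm_eq_0_iff: "f \<in> H \<Longrightarrow> hnorm ip f = 0 \<longleftrightarrow> f = 0"
  using ip_pos[of f] by (cases "f = 0") (auto simp: hnorm_def)

lemma hnorm_zero [simp]: "hnorm ip 0 = 0"
  by (simp add: hnorm_eq_0_iff)

lemma ip_self_eq_0_iff: "f \<in> H \<Longrightarrow> ip f f = 0 \<longleftrightarrow> f = 0"
  by (simp add: ip_self hnorm_eq_0_iff)

lemma hnorm_scale: "f \<in> H \<Longrightarrow> hnorm ip (cscale c f) = cmod c * hnorm ip f"
proof -
  assume f: "f \<in> H"
  have "ip (cscale c f) (cscale c f) = c * cnj c * ip f f"
    using f by (simp add: ip_scale ip_scale_right)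
  also have "\<dots> = complex_of_real ((cmod c)\<^sup>2 * (hnorm ip f)\<^sup>2)"
    by (simp only: complex_norm_square[symmetric] ip_self[OF f] of_real_mult)
  finally have "(hnorm ip (cscale c f))\<^sup>2 = (cmod c * hnorm ip f)\<^sup>2"
    using f by (simp only: hnorm_sq scale_mem Re_complex_of_real power_mult_distrib)
  then show ?thesis using f by (simp add: power2_eq_iff_nonneg)
qed

lemma hnorm_add_sq:
  "f \<in> H \<Longrightarrow> g \<in> H \<Longrightarrow> (hnorm ip (f + g))\<^sup>2 = (hnorm ip f)\<^sup>2 + (hnorm ip g)\<^sup>2 + 2 * Re (ip f g)"
  using ip_commute[of f g]
  by (simp add: hnorm_sq ip_add ip_add_right)

lemma hnorm_diff_sq:
  "f \<in> H \<Longrightarrow> g \<in> H \<Longrightarrow> (hnorm ip (f - g))\<^sup>2 = (hnorm ip f)\<^sup>2 + (hnorm ip g)\<^sup>2 - 2 * Re (ip f g)"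
  using ip_commute[of f g]
  by (simp add: hnorm_sq ip_diff ip_diff_right)

lemma hnorm_minus_commute: "f \<in> H \<Longrightarrow> g \<in> H \<Longrightarrow> hnorm ip (f - g) = hnorm ip (g - f)"
  by (simp add: hnorm_def ip_diff ip_diff_right algebra_simps)

lemma Cauchy_Schwarz:
  assumes f: "f \<in> H" and g: "g \<in> H"
  shows "cmod (ip f g) \<le> hnorm ip f * hnorm ip g"
proof (cases "g = 0")
  case True
  then show ?thesis using f by simp
next
  case False
  then have pos: "hnorm ip g > 0" using g hnorm_eq_0_iff[of g] hnorm_nonneg[of g] by linarith
  define t where "t = ip f g / ip g g"
  have "0 \<le> (hnorm ip (f - cscale t g))\<^sup>2" by simp
  also have "\<dots> = (hnorm ip f)\<^sup>2 + (cmod t * hnorm ip g)\<^sup>2 - 2 * Re (cnj t * ip f g)"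
    using f g by (simp add: hnorm_diff_sq hnorm_scale ip_scale_right)
  also have "cnj t * ip f g = complex_of_real ((cmod (ip f g))\<^sup>2 / (hnorm ip g)\<^sup>2)"
    using g by (simp add: t_def ip_self complex_norm_square mult.commute del: of_real_power)
  also have "cmod t * hnorm ip g = cmod (ip f g) / hnorm ip g"
    using g pos by (simp add: t_def ip_self norm_divide norm_power) (simp add: power2_eq_square)
  finally have "(cmod (ip f g))\<^sup>2 / (hnorm ip g)\<^sup>2 \<le> (hnorm ip f)\<^sup>2"
    by (simp add: power_divide)
  then have "(cmod (ip f g))\<^sup>2 \<le> (hnorm ip f * hnorm ip g)\<^sup>2"
    using pos by (simp add: pos_divide_le_eq power_mult_distrib)
  then show ?thesis by (rule power2_le_imp_le) (use f g in simp)
qed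

lemma hnorm_triangle: "f \<in> H \<Longrightarrow> g \<in> H \<Longrightarrow> hnorm ip (f + g) \<le> hnorm ip f + hnorm ip g"
proof -
  assume fg: "f \<in> H" "g \<in> H"
  have "Re (ip f g) \<le> hnorm ip f * hnorm ip g"
    using Cauchy_Schwarz[OF fg] complex_Re_le_cmod order_trans by blast
  then have "(hnorm ip (f + g))\<^sup>2 \<le> (hnorm ip f + hnorm ip g)\<^sup>2"
    using fg by (simp add: hnorm_add_sq power2_sum)
  then show ?thesis by (rule power2_le_imp_le) (use fg in simp)
qed

lemma hnorm_sum_le: "(\<And>i. i \<in> A \<Longrightarrow> f i \<in> H) \<Longrightarrow> hnorm ip (\<Sum>i\<in>A. f i) \<le> (\<Sum>i\<in>A. hnorm ip (f i))"
proof (induction A rule: infinite_finite_induct)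
  case (insert x A)
  have "hnorm ip (f x + sum f A) \<le> hnorm ip (f x) + hnorm ip (sum f A)"
    using insert.prems by (intro hnorm_triangle sum_mem) auto
  moreover have "hnorm ip (sum f A) \<le> (\<Sum>i\<in>A. hnorm ip (f i))" using insert by blast
  ultimately show ?case by (simp only: sum.insert[OF insert.hyps])
qed auto

text \<open>
  Riesz representation on a possibly non-closed domain. The functional is given as a linear
  relation rather than as a function: on spans of kernel functions, a functional is naturally
  described by coefficients, and its being well defined is a consequence of the bound. The
  representing vector is the limit of a minimising sequence for \<open>\<parallel>v\<parallel>\<^sup>2 - 2 Re l\<close>, which is Cauchy by
  the parallelogram law.
\<close>

lemma Riesz_relation:
  assumes R0: "(0, 0) \<in> R"
    and RH: "\<And>v l. (v, l) \<in> R \<Longrightarrow> v \<in> H"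
    and Radd: "\<And>v l v' l' c. (v, l) \<in> R \<Longrightarrow> (v', l') \<in> R \<Longrightarrow> (v + cscale c v', l + c * l') \<in> R"
    and bound: "\<And>v l. (v, l) \<in> R \<Longrightarrow> cmod l \<le> C * hnorm ip v"
    and C: "C \<ge> 0"
  obtains u where "u \<in> H" "\<And>v l. (v, l) \<in> R \<Longrightarrow> ip v u = l" "hnorm ip u \<le> C"
proof -
  define J where "J = (\<lambda>p. (hnorm ip (fst p))\<^sup>2 - 2 * Re (snd p))"
  have Jlow: "- C\<^sup>2 \<le> J p" if "p \<in> R" for p
  proof -
    obtain v l where p: "p = (v, l)" by (cases p)
    have "Re l \<le> C * hnorm ip v" using bound[of v l] that p complex_Re_le_cmod[of l] by auto
    moreover have "0 \<le> (hnorm ip v - C)\<^sup>2" by simp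
    ultimately show ?thesis by (simp add: J_def p power2_diff mult.commute)
  qed
  define m where "m = Inf (J ` R)"
  have bdd: "bdd_below (J ` R)" by (rule bdd_belowI[of _ "- C\<^sup>2"]) (use Jlow in auto)
  have m_le: "m \<le> J p" if "p \<in> R" for p
    unfolding m_def using that bdd by (intro cInf_lower) auto
  have "\<exists>p\<in>R. J p < m + 1 / Suc i" for i
  proof -
    have "Inf (J ` R) < m + 1 / Suc i" by (simp add: m_def)
    then show ?thesis using R0 bdd by (subst (asm) cInf_less_iff) auto
  qed
  then obtain p where p: "\<And>i. p i \<in> R" "\<And>i. J (p i) < m + 1 / Suc i" by metis
  define v where "v i = fst (p i)" for i
  define l where "l i = snd (p i)" for i
  have vl: "(v i, l i) \<in> R" for i using p(1)[of i] by (simp add: v_def l_def)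
  have vH [simp]: "v i \<in> H" for i using RH[OF vl] .
  have near: "(hnorm ip (v i - v j))\<^sup>2 \<le> 2 / Suc i + 2 / Suc j" for i j
  proof -
    have "(cscale (1/2) (v i) + cscale (1/2) (v j), 1/2 * l i + 1/2 * l j) \<in> R"
      using Radd[OF Radd[OF R0 vl[of i], of "1/2"] vl[of j], of "1/2"] by simp
    from m_le[OF this]
    have "m \<le> (hnorm ip (cscale (1/2) (v i + v j)))\<^sup>2 - Re (l i) - Re (l j)"
      by (simp add: J_def cfun.scale_right_distrib)
    then have "4 * m \<le> (hnorm ip (v i + v j))\<^sup>2 - 4 * Re (l i) - 4 * Re (l j)"
      by (simp add: hnorm_scale power_mult_distrib power2_eq_square)
    moreover have "(hnorm ip (v i + v j))\<^sup>2 + (hnorm ip (v i - v j))\<^sup>2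
        = 2 * (hnorm ip (v i))\<^sup>2 + 2 * (hnorm ip (v j))\<^sup>2"
      by (simp add: hnorm_add_sq hnorm_diff_sq)
    ultimately show ?thesis using p(2)[of i] p(2)[of j] by (simp add: J_def v_def l_def)
  qed
  have "\<exists>N. \<forall>i\<ge>N. \<forall>j\<ge>N. hnorm ip (v i - v j) < e" if "e > 0" for e
  proof -
    obtain N where N: "4 / e\<^sup>2 < real N" using reals_Archimedean2 by blast
    have "hnorm ip (v i - v j) < e" if "i \<ge> N" "j \<ge> N" for i j
    proof -
      have "0 < real N" using N \<open>e > 0\<close> by (smt (verit) divide_pos_pos zero_less_power)
      then have "2 / Suc i + 2 / Suc j \<le> 2 / N + 2 / N"
        using that by (intro add_mono divide_left_mono) auto
      also have "\<dots> < e\<^sup>2" using N \<open>0 < real N\<close> \<open>e > 0\<close> by (simp add: field_simps)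
      finally have "(hnorm ip (v i - v j))\<^sup>2 < e\<^sup>2" using near[of i j] by linarith
      then show ?thesis using \<open>e > 0\<close> by (simp add: power_less_imp_less_base)
    qed
    then show ?thesis by blast
  qed
  from complete[OF vH this] obtain u where u: "u \<in> H" and lim: "(\<lambda>i. hnorm ip (v i - u)) \<longlonglongrightarrow> 0"
    by blast
  have lim_ip: "(\<lambda>i. ip w (v i)) \<longlonglongrightarrow> ip w u" if w: "w \<in> H" for w
  proof -
    have "(\<lambda>i. ip w (v i) - ip w u) \<longlonglongrightarrow> 0"
    proof (rule Lim_null_comparison)
      show "\<forall>\<^sub>F i in sequentially. norm (ip w (v i) - ip w u) \<le> hnorm ip w * hnorm ip (v i - u)"
        using Cauchy_Schwarz[OF w, of "v i - u" for i] w u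
        by (intro always_eventually) (simp add: ip_diff_right)
      show "(\<lambda>i. hnorm ip w * hnorm ip (v i - u)) \<longlonglongrightarrow> 0"
        using tendsto_mult_left[OF lim, of "hnorm ip w"] by simp
    qed
    then show ?thesis by (simp add: LIM_zero_iff)
  qed
  \<comment> \<open>Comparing \<open>v\<^sub>i\<close> with \<open>v\<^sub>i + t c w\<close> for small real \<open>t\<close> gives the Euler--Lagrange equation; the
    choice \<open>t = 1 / sqrt (i + 1)\<close> is what makes the error terms vanish in the limit.\<close>
  have re: "Re (c * (ip w u - r)) \<ge> 0" if wr: "(w, r) \<in> R" for w r c
  proof -
    have wH: "w \<in> H" using RH[OF wr] .
    define t where "t i = 1 / sqrt (Suc i)" for i
    have t: "t i > 0" "(t i)\<^sup>2 = 1 / Suc i" for i by (auto simp: t_def power_divide)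
    have le: "- t i * (1 + (cmod c * hnorm ip w)\<^sup>2) \<le> 2 * Re (c * ip w (v i)) - 2 * Re (c * r)" for i
    proof -
      have "(v i + cscale (t i * c) w, l i + t i * c * r) \<in> R" by (rule Radd[OF vl wr])
      from m_le[OF this] have "J (p i) - 1 / Suc i \<le>
          (hnorm ip (v i + cscale (t i * c) w))\<^sup>2 - 2 * Re (l i + t i * c * r)"
        using p(2)[of i] by (simp add: J_def)
      moreover have "Re (ip (v i) (cscale (t i * c) w)) = t i * Re (c * ip w (v i))"
        using ip_commute[OF vH[of i] wH] wH by (simp add: ip_scale_right algebra_simps)
      moreover have "(hnorm ip (cscale (t i * c) w))\<^sup>2 = (t i)\<^sup>2 * (cmod c * hnorm ip w)\<^sup>2"
        using wH t(1)[of i] by (simp add: hnorm_scale norm_mult power_mult_distrib)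
      ultimately have "- ((t i)\<^sup>2) \<le> (t i)\<^sup>2 * (cmod c * hnorm ip w)\<^sup>2
          + 2 * t i * Re (c * ip w (v i)) - 2 * (t i * Re (c * r))"
        using wH by (simp add: J_def hnorm_add_sq v_def[symmetric] l_def[symmetric] t(2) algebra_simps)
      then have "0 \<le> t i * (t i * (1 + (cmod c * hnorm ip w)\<^sup>2)
          + 2 * Re (c * ip w (v i)) - 2 * Re (c * r))"
        by (simp add: algebra_simps power2_eq_square)
      then show ?thesis using t(1)[of i] by (simp add: zero_le_mult_iff)
    qed
    have "(\<lambda>i. 1 / real (Suc i)) \<longlonglongrightarrow> 0" by (rule LIMSEQ_Suc[OF lim_1_over_n])
    from tendsto_real_sqrt[OF this] have "t \<longlonglongrightarrow> 0" by (simp add: t_def[abs_def] real_sqrt_divide)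
    then have "(\<lambda>i. - t i * (1 + (cmod c * hnorm ip w)\<^sup>2)) \<longlonglongrightarrow> - 0 * (1 + (cmod c * hnorm ip w)\<^sup>2)"
      by (intro tendsto_intros)
    moreover have "(\<lambda>i. 2 * Re (c * ip w (v i)) - 2 * Re (c * r)) \<longlonglongrightarrow> 2 * Re (c * ip w u) - 2 * Re (c * r)"
      by (intro tendsto_intros lim_ip wH)
    ultimately have "- 0 * (1 + (cmod c * hnorm ip w)\<^sup>2) \<le> 2 * Re (c * ip w u) - 2 * Re (c * r)"
      by (rule LIMSEQ_le) (use le in blast)
    then show ?thesis by (simp add: algebra_simps)
  qed
  have eq: "ip w u = r" if "(w, r) \<in> R" for w r
  proof -
    have "- (cmod (ip w u - r))\<^sup>2 \<ge> 0"
      using re[OF that, of "- cnj (ip w u - r)"]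
      by (simp add: cmod_power2) (simp add: power2_eq_square algebra_simps)
    then show ?thesis by simp
  qed
  have "hnorm ip u \<le> C"
  proof (cases "hnorm ip u = 0")
    case False
    have "ip u (v i) = cnj (l i)" for i using eq[OF vl[of i]] ip_commute[OF vH[of i] u] by simp
    then have "cmod (ip u (v i)) \<le> C * (hnorm ip u + hnorm ip (v i - u))" for i
      using bound[OF vl[of i]] hnorm_triangle[of "v i - u" u] u C
      by (simp add: order_trans[OF _ mult_left_mono] add.commute)
    moreover have "(\<lambda>i. cmod (ip u (v i))) \<longlonglongrightarrow> cmod (ip u u)"
      by (intro tendsto_norm lim_ip u)
    moreover have "(\<lambda>i. C * (hnorm ip u + hnorm ip (v i - u))) \<longlonglongrightarrow> C * (hnorm ip u + 0)"
      by (intro tendsto_intros lim)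
    ultimately have "cmod (ip u u) \<le> C * (hnorm ip u + 0)" by (intro LIMSEQ_le) auto
    then have "hnorm ip u * hnorm ip u \<le> C * hnorm ip u"
      using u by (simp add: ip_self norm_power) (simp add: power2_eq_square)
    then show ?thesis using False u by (metis hnorm_nonneg mult_le_cancel_right_pos order_le_less)
  qed (use C in simp)
  then show ?thesis using that u eq by blast
qed

section \<open>Orthogonal projections\<close>

text \<open>Orthogonality of \<open>f - P f\<close> to \<open>S\<close> determines \<open>P f\<close> and is easy to check for a given formula;
  linearity, idempotence and self-adjointness of \<open>P\<close> on \<open>H\<close> follow from it.\<close>

definition proj_onto :: "('x \<Rightarrow> complex) set \<Rightarrow> (('x \<Rightarrow> complex) \<Rightarrow> ('x \<Rightarrow> complex)) \<Rightarrow> bool" where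
  "proj_onto S P \<longleftrightarrow> cfun.subspace S \<and> S \<subseteq> H \<and>
     (\<forall>f\<in>H. P f \<in> S \<and> (\<forall>s\<in>S. ip (f - P f) s = 0))"

context
  fixes S P
  assumes P: "proj_onto S P"
begin

lemma proj_mem: "f \<in> H \<Longrightarrow> P f \<in> S"
  and proj_range_sub: "S \<subseteq> H"
  and proj_subspace: "cfun.subspace S"
  and proj_orth: "f \<in> H \<Longrightarrow> s \<in> S \<Longrightarrow> ip (f - P f) s = 0"
  using P by (auto simp: proj_onto_def)

lemma proj_mem_H [simp]: "f \<in> H \<Longrightarrow> P f \<in> H"
  using proj_mem proj_range_sub by blast

lemma proj_ip: "f \<in> H \<Longrightarrow> s \<in> S \<Longrightarrow> ip (P f) s = ip f s"
  using proj_orth[of f s] proj_range_sub by (auto simp: ip_diff subset_iff)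

lemma proj_eqI:
  assumes "f \<in> H" "g \<in> S" "\<And>s. s \<in> S \<Longrightarrow> ip g s = ip f s"
  shows "P f = g"
proof -
  have m: "P f - g \<in> S" using assms proj_mem cfun.subspace_diff[OF proj_subspace] by blast
  have gH: "g \<in> H" using assms proj_range_sub by blast
  have "ip (P f - g) (P f - g) = 0"
    using assms m gH proj_range_sub by (subst ip_diff) (auto simp: proj_ip)
  then show ?thesis using assms gH by (simp add: ip_self_eq_0_iff)
qed

lemma proj_fix: "s \<in> S \<Longrightarrow> P s = s"
  using proj_range_sub by (intro proj_eqI) auto

lemma proj_image: "P ` H = S"
  using proj_mem proj_fix proj_range_sub by (force simp: image_iff)

lemma proj_add: "f \<in> H \<Longrightarrow> g \<in> H \<Longrightarrow> P (f + g) = P f + P g"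
  using proj_range_sub
  by (intro proj_eqI)
     (auto simp: ip_add subset_iff proj_ip intro: cfun.subspace_add[OF proj_subspace] proj_mem)

lemma proj_scale: "f \<in> H \<Longrightarrow> P (cscale c f) = cscale c (P f)"
  using proj_range_sub
  by (intro proj_eqI)
     (auto simp: ip_scale subset_iff proj_ip intro: cfun.subspace_scale[OF proj_subspace] proj_mem)

lemma proj_selfadjoint: "f \<in> H \<Longrightarrow> g \<in> H \<Longrightarrow> ip (P f) g = ip f (P g)"
  by (metis ip_commute proj_ip proj_mem proj_mem_H)

lemma proj_self_ip: "f \<in> H \<Longrightarrow> ip (f - P f) f = complex_of_real ((hnorm ip (f - P f))\<^sup>2)"
  using proj_orth[of f "P f"] proj_mem[of f] ip_diff_right[of f "P f" "f - P f"]
  by (simp add: ip_self[symmetric] del: of_real_power)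

lemma proj_pythagoras: "f \<in> H \<Longrightarrow> (hnorm ip f)\<^sup>2 = (hnorm ip (P f))\<^sup>2 + (hnorm ip (f - P f))\<^sup>2"
  using hnorm_add_sq[of "f - P f" "P f"] proj_orth[of f "P f"] proj_mem[of f] by simp

lemma proj_norm_le: "f \<in> H \<Longrightarrow> hnorm ip (P f) \<le> hnorm ip f"
  by (rule power2_le_imp_le) (simp_all add: proj_pythagoras[of f])

lemma proj_compl_norm_le: "f \<in> H \<Longrightarrow> hnorm ip (f - P f) \<le> hnorm ip f"
  by (rule power2_le_imp_le) (simp_all add: proj_pythagoras[of f])

lemma proj_best_approx: "f \<in> H \<Longrightarrow> s \<in> S \<Longrightarrow> hnorm ip (f - P f) \<le> hnorm ip (f - s)"
proof -
  assume f: "f \<in> H" and s: "s \<in> S"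
  have sH: "s \<in> H" using s proj_range_sub by blast
  have "P f = P (f - s) + s"
    using proj_add[of "f - s" s] proj_fix[OF s] f sH by simp
  then have eq: "(f - s) - P (f - s) = f - P f" by simp
  show ?thesis using proj_compl_norm_le[OF diff_mem[OF f sH]] unfolding eq .
qed

end

lemma proj_unique: "proj_onto S P \<Longrightarrow> proj_onto S Q \<Longrightarrow> f \<in> H \<Longrightarrow> P f = Q f"
  by (rule proj_eqI[of S P]) (simp_all add: proj_mem[of S Q] proj_ip[of S Q])

text \<open>One Gram--Schmidt step. Because division by \<open>0\<close> gives \<open>0\<close>, the formula remains correct when
  \<open>a\<close> already lies in the span of \<open>F\<close>.\<close>

lemma proj_onto_insert:
  assumes P: "proj_onto (cfun.span F) P" and a: "a \<in> H" and F: "F \<subseteq> H"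
  defines "q \<equiv> a - P a"
  shows "proj_onto (cfun.span (insert a F)) (\<lambda>f. P f + cscale (ip f q / ip q q) q)"
proof -
  have qH: "q \<in> H" using a P by (simp add: q_def proj_mem_H)
  have sub: "cfun.span (insert a F) \<subseteq> H" using span_mem[of "insert a F"] a F by blast
  have PF: "P f \<in> cfun.span (insert a F)" if "f \<in> H" for f
    using proj_mem[OF P that] cfun.span_mono[of F "insert a F"] by blast
  have q: "q \<in> cfun.span (insert a F)"
    unfolding q_def using PF[OF a] by (simp add: cfun.span_diff cfun.span_base)
  have orth: "ip (f - (P f + cscale (ip f q / ip q q) q)) s = 0"
    if f: "f \<in> H" and s: "s \<in> cfun.span (insert a F)" for f s
  proof -
    obtain c where c: "s - cscale c a \<in> cfun.span F" using s cfun.span_breakdown_eq by blast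
    define s0 where "s0 = s - cscale c a + cscale c (P a)"
    have s0: "s0 \<in> cfun.span F"
      unfolding s0_def by (intro cfun.span_add cfun.span_scale c proj_mem[OF P a])
    have s0H: "s0 \<in> H" using span_mem[OF F s0] .
    have s_eq: "s = s0 + cscale c q"
      by (simp add: s0_def q_def cfun.scale_right_diff_distrib)
    have PfH: "P f \<in> H" using proj_mem_H[OF P f] .
    have 1: "ip q s0 = 0" using proj_orth[OF P a s0] by (simp add: q_def)
    define r where "r = f - P f"
    define t where "t = ip f q / ip q q"
    have rH: "r \<in> H" using f PfH by (simp add: r_def)
    have 2: "ip r s0 = 0" using proj_orth[OF P f s0] by (simp add: r_def)
    have 3: "ip (P f) q = 0"
      using proj_orth[OF P a proj_mem[OF P f]] ip_commute[OF qH PfH] by (simp add: q_def)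
    have "t * ip q q = ip f q"
      using qH f ip_self_eq_0_iff[OF qH] by (cases "q = 0") (auto simp: t_def)
    moreover have "ip r q = ip f q" using 3 f PfH qH by (simp add: r_def ip_diff)
    ultimately have 4: "ip r q = t * ip q q" by simp
    have "f - (P f + cscale t q) = r - cscale t q" by (simp add: r_def)
    then have "ip (f - (P f + cscale t q)) s = ip (r - cscale t q) (s0 + cscale c q)"
      by (simp only: s_eq)
    also have "\<dots> = 0"
      using rH qH s0H 1 2 4 by (simp add: ip_diff ip_add_right ip_scale ip_scale_right)
    finally show ?thesis by (simp only: t_def)
  qed
  show ?thesis
    unfolding proj_onto_def
    using sub orth by (auto intro!: cfun.subspace_span cfun.span_add PF cfun.span_scale q)
qed

lemma proj_onto_empty: "proj_onto (cfun.span {}) (\<lambda>_. 0)"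
  by (simp add: proj_onto_def cfun.subspace_0)

lemma proj_onto_exists:
  assumes "finite F" "F \<subseteq> H"
  obtains P where "proj_onto (cfun.span F) P"
proof -
  have "\<exists>P. proj_onto (cfun.span F) P"
    using assms
  proof (induction F)
    case empty
    then show ?case using proj_onto_empty by blast
  next
    case (insert a F)
    then obtain P where P: "proj_onto (cfun.span F) P" by auto
    show ?case using proj_onto_insert[OF P] insert.prems by blast
  qed
  then show ?thesis using that by blast
qed

lemma restrict_proj_orth_projection:
  assumes P: "proj_onto S P"
  shows "restrict P H \<in> orth_projections H ip"
proof -
  have "\<exists>C. \<forall>f\<in>H. hnorm ip (P f) \<le> C * hnorm ip f"
    using proj_norm_le[OF P] by (intro exI[of _ 1]) simp
  then have "restrict P H \<in> bounded_ops H ip"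
    using proj_mem_H[OF P] proj_add[OF P] proj_scale[OF P] by (simp add: bounded_ops_def)
  moreover have "restrict P H (restrict P H f) = restrict P H f" if "f \<in> H" for f
    using proj_fix[OF P proj_mem[OF P that]] proj_mem_H[OF P that] that by simp
  moreover have "ip (restrict P H f) g = ip f (restrict P H g)" if "f \<in> H" "g \<in> H" for f g
    using proj_selfadjoint[OF P that] that by simp
  ultimately show ?thesis unfolding orth_projections_def by blast
qed

lemma orth_projection_proj_onto:
  assumes P: "P \<in> orth_projections H ip"
  shows "proj_onto (P ` H) P"
proof -
  have B: "P \<in> bounded_ops H ip \<and> (\<forall>f\<in>H. P (P f) = P f) \<and>
      (\<forall>f\<in>H. \<forall>g\<in>H. ip (P f) g = ip f (P g))"
    using P unfolding orth_projections_def mem_Collect_eq .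
  then have "P \<in> bounded_ops H ip" by (rule conjunct1)
  then have B': "P \<in> H \<rightarrow>\<^sub>E H \<and> (\<forall>f\<in>H. \<forall>g\<in>H. P (f + g) = P f + P g) \<and>
      (\<forall>c. \<forall>f\<in>H. P (cscale c f) = cscale c (P f)) \<and>
      (\<exists>C. \<forall>f\<in>H. hnorm ip (P f) \<le> C * hnorm ip f)"
    unfolding bounded_ops_def mem_Collect_eq .
  note idem = bspec[OF conjunct1[OF conjunct2[OF B]]]
  note sa = bspec[OF bspec[OF conjunct2[OF conjunct2[OF B]]]]
  note PH = PiE_mem[OF conjunct1[OF B']]
  note add = bspec[OF bspec[OF conjunct1[OF conjunct2[OF B']]]]
  note sc = bspec[OF spec[OF conjunct1[OF conjunct2[OF conjunct2[OF B']]]]]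
  have "P 0 = 0" using sc[of 0 0] by simp
  then have "0 \<in> P ` H" by (metis image_eqI zero_mem)
  moreover have "P f + P g \<in> P ` H" if "f \<in> H" "g \<in> H" for f g
    using add[OF that] that by (metis add_mem imageI)
  moreover have "cscale c (P f) \<in> P ` H" if "f \<in> H" for c f
    using sc[OF that, of c] that by (metis scale_mem imageI)
  ultimately have "cfun.subspace (P ` H)" unfolding cfun.subspace_def by blast
  moreover have "ip (f - P f) (P g) = 0" if "f \<in> H" "g \<in> H" for f g
    using that PH by (simp add: ip_diff sa[of f "P g"] sa[of "P f"] idem)
  ultimately show ?thesis using PH unfolding proj_onto_def by blast
qed

text \<open>
  The smallness of \<open>C \<eta>\<close> lets the control of coefficients pass from the \<open>a\<^sub>j\<close> to the nearby \<open>u\<^sub>j\<close>, at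
  the price of a factor \<open>2\<close>. Replacing \<open>a\<^sub>j\<close> by \<open>u\<^sub>j\<close> or conversely in a linear combination then shows
  that each unit vector of one range is close to the other range, and
  \<open>P - Q = P (I - Q) - (I - P) Q\<close> is small.
\<close>

lemma proj_perturbation:
  assumes P: "proj_onto S P" and Q: "proj_onto T Q"
    and a: "\<And>j. j \<in> J \<Longrightarrow> a j \<in> S" and u: "\<And>j. j \<in> J \<Longrightarrow> u j \<in> T"
    and Sspan: "\<And>s. s \<in> S \<Longrightarrow> \<exists>c. s = (\<Sum>j\<in>J. cscale (c j) (a j))"
    and Tspan: "\<And>t. t \<in> T \<Longrightarrow> \<exists>c. t = (\<Sum>j\<in>J. cscale (c j) (u j))"
    and close: "\<And>j. j \<in> J \<Longrightarrow> hnorm ip (a j - u j) \<le> \<eta>"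
    and coeff: "\<And>c. (\<Sum>j\<in>J. cmod (c j)) \<le> C * hnorm ip (\<Sum>j\<in>J. cscale (c j) (a j))"
    and small: "C * \<eta> \<le> 1 / 2" and C: "C \<ge> 0" and \<eta>: "\<eta> \<ge> 0" and f: "f \<in> H"
  shows "hnorm ip (P f - Q f) \<le> 3 * C * \<eta> * hnorm ip f"
proof -
  have SH: "S \<subseteq> H" and TH: "T \<subseteq> H" using proj_range_sub P Q by auto
  have aH: "a j \<in> H" and uH: "u j \<in> H" if "j \<in> J" for j using a u SH TH that by auto
  have diff: "hnorm ip ((\<Sum>j\<in>J. cscale (c j) (a j)) - (\<Sum>j\<in>J. cscale (c j) (u j)))
      \<le> \<eta> * (\<Sum>j\<in>J. cmod (c j))" for c
  proof -
    have eq: "(\<Sum>j\<in>J. cscale (c j) (a j)) - (\<Sum>j\<in>J. cscale (c j) (u j))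
        = (\<Sum>j\<in>J. cscale (c j) (a j - u j))"
      by (simp add: sum_subtractf cfun.scale_right_diff_distrib)
    have "hnorm ip (\<Sum>j\<in>J. cscale (c j) (a j - u j)) \<le> (\<Sum>j\<in>J. hnorm ip (cscale (c j) (a j - u j)))"
      using aH uH by (intro hnorm_sum_le) simp
    also have "\<dots> \<le> (\<Sum>j\<in>J. cmod (c j) * \<eta>)"
      using aH uH close by (intro sum_mono) (simp add: hnorm_scale mult_left_mono)
    finally show ?thesis unfolding eq by (simp add: sum_distrib_left mult.commute)
  qed
  \<comment> \<open>\<open>Q s\<close> is the best approximation of \<open>s\<close> in \<open>T\<close>, so it beats the combination of the \<open>u\<^sub>j\<close> with
    the coefficients of \<open>s\<close>.\<close>
  have near_T: "hnorm ip (s - Q s) \<le> C * \<eta> * hnorm ip s" if s: "s \<in> S" for s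
  proof -
    obtain c where c: "s = (\<Sum>j\<in>J. cscale (c j) (a j))" using Sspan[OF s] by blast
    have "(\<Sum>j\<in>J. cscale (c j) (u j)) \<in> T"
      using u proj_subspace[OF Q] by (intro cfun.subspace_sum cfun.subspace_scale) auto
    then have "hnorm ip (s - Q s) \<le> hnorm ip (s - (\<Sum>j\<in>J. cscale (c j) (u j)))"
      using s SH by (intro proj_best_approx[OF Q]) auto
    also have "\<dots> \<le> \<eta> * (\<Sum>j\<in>J. cmod (c j))" unfolding c by (rule diff)
    also have "\<dots> \<le> \<eta> * (C * hnorm ip s)" unfolding c by (intro mult_left_mono coeff \<eta>)
    finally show ?thesis by (simp add: mult_ac)
  qed
  have near_S: "hnorm ip (t - P t) \<le> 2 * C * \<eta> * hnorm ip t" if t: "t \<in> T" for t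
  proof -
    obtain c where c: "t = (\<Sum>j\<in>J. cscale (c j) (u j))" using Tspan[OF t] by blast
    define s where "s = (\<Sum>j\<in>J. cscale (c j) (a j))"
    have s: "s \<in> S" unfolding s_def
      using a proj_subspace[OF P] by (intro cfun.subspace_sum cfun.subspace_scale) auto
    have sH: "s \<in> H" and tH: "t \<in> H" using s t SH TH by auto
    let ?c = "\<Sum>j\<in>J. cmod (c j)"
    have d: "hnorm ip (s - t) \<le> \<eta> * ?c" unfolding s_def c by (rule diff)
    have s_le: "hnorm ip s \<le> hnorm ip (s - t) + hnorm ip t"
      using hnorm_triangle[of "s - t" t] sH tH by simp
    have "?c \<le> C * hnorm ip s" unfolding s_def by (rule coeff)
    also have "\<dots> \<le> C * (hnorm ip (s - t) + hnorm ip t)" by (rule mult_left_mono[OF s_le C])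
    also have "C * (hnorm ip (s - t) + hnorm ip t) \<le> C * (\<eta> * ?c + hnorm ip t)"
      using d C by (intro mult_left_mono) auto
    also have "\<dots> = (C * \<eta>) * ?c + C * hnorm ip t" by (simp add: algebra_simps)
    also have "\<dots> \<le> 1 / 2 * ?c + C * hnorm ip t"
      using small by (intro add_right_mono mult_right_mono sum_nonneg) auto
    finally have c_le: "?c \<le> 2 * C * hnorm ip t" using C by (simp add: mult_left_mono)
    have "hnorm ip (t - P t) \<le> hnorm ip (t - s)"
      by (rule proj_best_approx[OF P tH s])
    also have "\<dots> \<le> \<eta> * ?c" using d hnorm_minus_commute[OF sH tH] by simp
    also have "\<dots> \<le> \<eta> * (2 * C * hnorm ip t)" by (intro mult_left_mono c_le \<eta>)
    finally show ?thesis by (simp add: mult_ac)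
  qed
  have QH: "Q f \<in> H" and QT: "Q f \<in> T" using proj_mem_H[OF Q f] proj_mem[OF Q f] .
  define g where "g = f - Q f"
  have gH: "g \<in> H" using f QH by (simp add: g_def)
  define v where "v = P g"
  have vS: "v \<in> S" and vH: "v \<in> H" using proj_mem[OF P gH] SH by (auto simp: v_def)
  have QvH: "Q v \<in> H" using proj_mem_H[OF Q vH] .
  \<comment> \<open>\<open>\<parallel>P (I - Q)\<parallel> = \<parallel>(I - Q) P\<parallel>\<close> by duality: \<open>g = f - Q f\<close> only sees the part of \<open>v\<close> outside \<open>T\<close>.\<close>
  have "ip v v = ip g v" unfolding v_def using proj_ip[OF P gH] proj_mem[OF P gH] by simp
  also have "\<dots> = ip g (v - Q v)"
    using proj_orth[OF Q f proj_mem[OF Q vH]] gH vH QvH by (simp add: ip_diff_right g_def)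
  finally have "cmod (ip v v) \<le> hnorm ip g * hnorm ip (v - Q v)"
    using Cauchy_Schwarz[of g "v - Q v"] gH vH QvH by simp
  also have "\<dots> \<le> hnorm ip f * (C * \<eta> * hnorm ip v)"
    using proj_compl_norm_le[OF Q f] near_T[OF vS] f gH vH QvH unfolding g_def
    by (intro mult_mono) auto
  finally have "hnorm ip v * hnorm ip v \<le> (C * \<eta> * hnorm ip f) * hnorm ip v"
    using vH by (simp add: ip_self norm_power) (simp add: power2_eq_square mult_ac)
  then have 1: "hnorm ip v \<le> C * \<eta> * hnorm ip f"
    using hnorm_nonneg[OF vH] hnorm_nonneg[OF f] C \<eta>
    by (cases "hnorm ip v = 0") (auto simp: mult_le_cancel_right)
  have "hnorm ip (Q f - P (Q f)) \<le> 2 * C * \<eta> * hnorm ip (Q f)" by (rule near_S[OF QT])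
  also have "\<dots> \<le> 2 * C * \<eta> * hnorm ip f"
    using C \<eta> by (intro mult_left_mono proj_norm_le[OF Q f]) auto
  finally have 2: "hnorm ip (P (Q f) - Q f) \<le> 2 * C * \<eta> * hnorm ip f"
    using hnorm_minus_commute[OF QH proj_mem_H[OF P QH]] by simp
  have eq: "P f - Q f = v + (P (Q f) - Q f)"
    using proj_add[OF P gH QH] by (simp add: v_def g_def)
  have "hnorm ip (P f - Q f) \<le> hnorm ip v + hnorm ip (P (Q f) - Q f)"
    unfolding eq using QH proj_mem_H[OF P QH] by (intro hnorm_triangle[OF vH]) simp
  then show ?thesis using 1 2 by linarith
qed

lemma orthogonal_span:
  assumes F: "F \<subseteq> H" and f: "f \<in> H" and orth: "\<And>g. g \<in> F \<Longrightarrow> ip f g = 0" and s: "s \<in> cfun.span F"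
  shows "ip f s = 0"
proof -
  have "cfun.subspace {s \<in> H. ip f s = 0}"
    unfolding cfun.subspace_def using f by (auto simp: ip_add_right ip_scale_right)
  then have "cfun.span F \<subseteq> {s \<in> H. ip f s = 0}"
    using F orth by (intro cfun.span_minimal) auto
  then show ?thesis using s by blast
qed

lemma proj_sum:
  assumes P: "proj_onto S P" and "finite A" and "\<And>i. i \<in> A \<Longrightarrow> f i \<in> H"
  shows "P (\<Sum>i\<in>A. f i) = (\<Sum>i\<in>A. P (f i))"
  using assms(2,3)
proof (induction A)
  case empty
  then show ?case
    using proj_fix[OF P cfun.subspace_0[OF proj_subspace[OF P]]] by (simp only: sum.empty)
next
  case (insert i A)
  then have "P (f i + sum f A) = P (f i) + P (sum f A)"
    by (intro proj_add[OF P] sum_mem) auto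
  moreover have "P (sum f A) = (\<Sum>i\<in>A. P (f i))" using insert by blast
  ultimately show ?case by (simp only: sum.insert[OF insert.hyps])
qed

section \<open>Adjoints\<close>

lemma adjoint_op_eqI:
  assumes "h \<in> H" "u \<in> H" "\<And>g. g \<in> H \<Longrightarrow> ip (T g) h = ip g u"
  shows "adjoint_op H ip H ip T h = u"
proof -
  have "(THE u. u \<in> H \<and> (\<forall>g\<in>H. ip (T g) h = ip g u)) = u"
  proof (rule the_equality)
    fix v assume v: "v \<in> H \<and> (\<forall>g\<in>H. ip (T g) h = ip g v)"
    then have "ip (v - u) v = ip (v - u) u" using assms by simp
    then have "ip (v - u) (v - u) = 0" using v assms(2) by (subst ip_diff_right) auto
    then show "v = u" using v assms(2) by (simp add: ip_self_eq_0_iff)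
  qed (use assms in blast)
  then show ?thesis using assms(1) by (simp add: adjoint_op_def)
qed

lemma tuple_adjoint_op_eqI:
  assumes h: "h \<in> H" and u: "u \<in> tuple_space H N"
    and eq: "\<And>g. g \<in> tuple_space H N \<Longrightarrow> ip (T g) h = tuple_ip ip N g u"
  shows "adjoint_op (tuple_space H N) (tuple_ip ip N) H ip T h = u"
proof -
  have "(THE u. u \<in> tuple_space H N \<and> (\<forall>g\<in>tuple_space H N. ip (T g) h = tuple_ip ip N g u)) = u"
  proof (rule the_equality)
    fix v assume v: "v \<in> tuple_space H N \<and> (\<forall>g\<in>tuple_space H N. ip (T g) h = tuple_ip ip N g v)"
    have vH: "v j \<in> H" and uH: "u j \<in> H" if "j < N" for j
      using that u v by (auto simp: tuple_space_def PiE_iff)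
    define g where "g = (\<lambda>j\<in>{..<N}. v j - u j)"
    have g: "g \<in> tuple_space H N" using vH uH by (auto simp: g_def tuple_space_def)
    have "0 = tuple_ip ip N g v - tuple_ip ip N g u" using v eq g by simp
    also have "\<dots> = (\<Sum>j<N. ip (v j - u j) (v j) - ip (v j - u j) (u j))"
      by (simp add: tuple_ip_def g_def sum_subtractf)
    also have "\<dots> = (\<Sum>j<N. ip (v j - u j) (v j - u j))"
      using vH uH by (intro sum.cong refl) (simp add: ip_diff_right)
    also have "\<dots> = of_real (\<Sum>j<N. (hnorm ip (v j - u j))\<^sup>2)"
      using vH uH by (simp add: ip_self)
    finally have "(\<Sum>j<N. (hnorm ip (v j - u j))\<^sup>2) = 0" by (metis of_real_eq_0_iff)
    then have "hnorm ip (v j - u j) = 0" if "j < N" for j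
      using that by (subst (asm) sum_nonneg_eq_0_iff) auto
    then have "v j = u j" if "j < N" for j
      using that vH uH by (simp add: hnorm_eq_0_iff)
    then show "v = u" using u v unfolding tuple_space_def by (intro PiE_ext) auto
  qed (use u eq in blast)
  then show ?thesis using h by (simp add: adjoint_op_def)
qed

lemma bounded_multiplication_adjoint:
  assumes \<phi>: "\<And>g. g \<in> H \<Longrightarrow> \<phi> * g \<in> H"
    and bound: "\<And>g. g \<in> H \<Longrightarrow> hnorm ip (\<phi> * g) \<le> C * hnorm ip g" and C: "C \<ge> 0" and h: "h \<in> H"
  obtains u where "u \<in> H" "\<And>g. g \<in> H \<Longrightarrow> ip (\<phi> * g) h = ip g u"
proof -
  let ?R = "{(g, ip (\<phi> * g) h) | g. g \<in> H}"
  have add: "\<phi> * (v + cscale c v') = \<phi> * v + cscale c (\<phi> * v')" for v v' c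
    by (auto simp: fun_eq_iff cscale_def algebra_simps)
  have zero: "\<phi> * 0 = 0" by (auto simp: fun_eq_iff)
  obtain u where u: "u \<in> H" "\<And>v l. (v, l) \<in> ?R \<Longrightarrow> ip v u = l"
  proof (rule Riesz_relation[of ?R "hnorm ip h * C"])
    show "(0, 0) \<in> ?R" using h by (auto intro!: exI[of _ 0] simp: zero)
    show "v \<in> H" if "(v, l) \<in> ?R" for v l using that by auto
    show "(v + cscale c v', l + c * l') \<in> ?R" if "(v, l) \<in> ?R" "(v', l') \<in> ?R" for v l v' l' c
      using that h \<phi> by (auto intro!: exI[of _ "v + cscale c v'"] simp: add ip_add ip_scale)
    show "cmod l \<le> hnorm ip h * C * hnorm ip v" if "(v, l) \<in> ?R" for v l
    proof -
      have v: "v \<in> H" and l: "l = ip (\<phi> * v) h" using that by auto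
      have "cmod l \<le> hnorm ip (\<phi> * v) * hnorm ip h"
        unfolding l by (rule Cauchy_Schwarz[OF \<phi>[OF v] h])
      also have "\<dots> \<le> C * hnorm ip v * hnorm ip h"
        by (rule mult_right_mono[OF bound[OF v] hnorm_nonneg[OF h]])
      finally show ?thesis by (simp add: mult_ac)
    qed
    show "0 \<le> hnorm ip h * C" using C h by simp
  qed blast
  then show ?thesis by (intro that[of u]) (auto simp: eq_commute)
qed

end

section \<open>Row multipliers in a reproducing kernel Hilbert space\<close>

context rkhs
begin

definition ker :: "'x \<Rightarrow> 'x \<Rightarrow> complex" where
  "ker y = (\<lambda>x. if x \<in> B then k x y else 0)"

lemma ker_apply: "z \<in> B \<Longrightarrow> ker w z = k z w"
  by (simp add: ker_def)

lemma ker_mem [simp]: "y \<in> B \<Longrightarrow> ker y \<in> H"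
  using kernel_mem by (simp add: ker_def)

lemma ip_ker [simp]: "f \<in> H \<Longrightarrow> y \<in> B \<Longrightarrow> ip f (ker y) = f y"
  using reproducing by (simp add: ker_def)

lemma ip_ker_left: "f \<in> H \<Longrightarrow> y \<in> B \<Longrightarrow> ip (ker y) f = cnj (f y)"
  using ip_commute[of f "ker y"] by simp

lemma mem_ext: "f \<in> H \<Longrightarrow> g \<in> H \<Longrightarrow> (\<And>z. z \<in> B \<Longrightarrow> f z = g z) \<Longrightarrow> f = g"
  using zero_outside by (metis ext)

lemma ker_span_sub: "X \<subseteq> B \<Longrightarrow> cfun.span (ker ` X) \<subseteq> H"
  by (intro cfun.span_minimal subspace) auto

text \<open>
  The Riesz vector of the functional that pairs \<open>f\<close> with finite combinations of kernel functions
  takes the values of \<open>f\<close> on \<open>B\<close>, hence equals \<open>f\<close>.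
\<close>

lemma mem_if_kernel_bound:
  assumes supp: "\<And>x. x \<notin> B \<Longrightarrow> f x = 0" and C: "C \<ge> 0"
    and bound: "\<And>F c. finite F \<Longrightarrow> F \<subseteq> B \<Longrightarrow>
      cmod (\<Sum>w\<in>F. c w * cnj (f w)) \<le> C * hnorm ip (\<Sum>w\<in>F. cscale (c w) (ker w))"
  shows "f \<in> H" "hnorm ip f \<le> C"
proof -
  let ?v = "\<lambda>F c. \<Sum>w\<in>F. cscale (c w) (ker w)" and ?l = "\<lambda>F c. \<Sum>w\<in>F. c w * cnj (f w)"
  let ?R = "{(?v F c, ?l F c) | F c. finite F \<and> F \<subseteq> B}"
  obtain u where u: "u \<in> H" "\<And>v l. (v, l) \<in> ?R \<Longrightarrow> ip v u = l" "hnorm ip u \<le> C"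
  proof (rule Riesz_relation[of ?R C])
    show "(0, 0) \<in> ?R" by (auto intro!: exI[of _ "{}"])
    show "v \<in> H" if "(v, l) \<in> ?R" for v l using that by (auto intro!: sum_mem)
    show "cmod l \<le> C * hnorm ip v" if "(v, l) \<in> ?R" for v l using that bound by auto
    show "(v + cscale t v', l + t * l') \<in> ?R" if "(v, l) \<in> ?R" "(v', l') \<in> ?R" for v l v' l' t
    proof -
      obtain F c F' c' where F: "finite F" "F \<subseteq> B" "finite F'" "F' \<subseteq> B"
        and v: "v = ?v F c" "v' = ?v F' c'" and l: "l = ?l F c" "l' = ?l F' c'"
        using \<open>(v, l) \<in> ?R\<close> \<open>(v', l') \<in> ?R\<close> by auto
      define a where "a w = (if w \<in> F then c w else 0)" for w
      define a' where "a' w = (if w \<in> F' then t * c' w else 0)" for w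
      have "?v F c = ?v (F \<union> F') a" "?l F c = ?l (F \<union> F') a"
        using F by (auto simp: a_def intro!: sum.mono_neutral_cong_left)
      moreover have "cscale t (?v F' c') = ?v (F \<union> F') a'"
        unfolding cfun.scale_sum_right
        using F by (auto simp: a'_def intro!: sum.mono_neutral_cong_left)
      moreover have "t * ?l F' c' = ?l (F \<union> F') a'"
        unfolding sum_distrib_left
        using F by (auto simp: a'_def mult.assoc intro!: sum.mono_neutral_cong_left)
      ultimately have "v + cscale t v' = ?v (F \<union> F') (\<lambda>w. a w + a' w)"
        "l + t * l' = ?l (F \<union> F') (\<lambda>w. a w + a' w)"
        unfolding v l by (simp_all only: cfun.scale_left_distrib sum.distrib ring_distribs)
      then show ?thesis
        using F by (intro CollectI exI[of _ "F \<union> F'"] exI[of _ "\<lambda>w. a w + a' w"]) simp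
    qed
  qed (use C in auto)
  have "u w = f w" if w: "w \<in> B" for w
  proof -
    have "(?v {w} (\<lambda>_. 1), ?l {w} (\<lambda>_. 1)) \<in> ?R"
      using w by (intro CollectI exI[of _ "{w}"] exI[of _ "\<lambda>_. 1"]) simp
    from u(2)[OF this] have "ip (ker w) u = cnj (f w)" by simp
    then show ?thesis using ip_ker_left[OF u(1) w] by simp
  qed
  then have "u = f" using supp zero_outside[OF u(1)] by (metis ext)
  then show "f \<in> H" "hnorm ip f \<le> C" using u by auto
qed

text \<open>
  A row \<open>\<beta>\<close> for which \<open>(1 - \<beta>(z) \<beta>(w)\<^sup>*) k(z, w)\<close> is the kernel of a projection \<open>P\<close>. Since
  \<open>M\<^sub>\<beta>\<^sup>*\<close> must send \<open>k\<^sub>w\<close> to \<open>(\<beta>\<^sub>j(w)\<^sup>* k\<^sub>w)\<^sub>j\<close>, the hypothesis says that \<open>M\<^sub>\<beta> M\<^sub>\<beta>\<^sup>*\<close> and \<open>I - P\<close>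
  agree on kernel functions.
\<close>

context
  fixes S P and N :: nat and \<beta> :: "nat \<Rightarrow> 'x \<Rightarrow> complex"
  assumes P: "proj_onto S P"
    and defect: "\<And>z w. z \<in> B \<Longrightarrow> w \<in> B \<Longrightarrow>
      (1 - (\<Sum>j<N. \<beta> j z * cnj (\<beta> j w))) * k z w = P (ker w) z"
begin

lemma defect_kernel:
  "z \<in> B \<Longrightarrow> w \<in> B \<Longrightarrow> (ker w - P (ker w)) z = (\<Sum>j<N. \<beta> j z * cnj (\<beta> j w)) * k z w"
  by (simp add: ker_apply algebra_simps flip: defect)

text \<open>The functions \<open>t\<^sub>j\<close> are the components of \<open>M\<^sub>\<beta>\<^sup>* V\<close>, so this is \<open>\<parallel>M\<^sub>\<beta>\<^sup>* V\<parallel>\<^sup>2 = \<langle>(I - P) V, V\<rangle>\<close>; both sides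
  are the same Hermitian form in the coefficients \<open>c\<close>.\<close>

lemma row_kernel_isometry:
  fixes c :: "'x \<Rightarrow> complex"
  assumes F: "finite F" "F \<subseteq> B"
  defines "V \<equiv> \<Sum>w\<in>F. cscale (c w) (ker w)"
    and "t \<equiv> \<lambda>j. \<Sum>w\<in>F. cscale (c w * cnj (\<beta> j w)) (ker w)"
  shows "(\<Sum>j<N. (hnorm ip (t j))\<^sup>2) = (hnorm ip (V - P V))\<^sup>2"
proof -
  have kerH: "ker w \<in> H" if "w \<in> F" for w using that F by auto
  have PkerH: "P (ker w) \<in> H" if "w \<in> F" for w using proj_mem_H[OF P kerH[OF that]] .
  have tH: "t j \<in> H" for j unfolding t_def using kerH by (intro sum_mem) auto
  have VH: "V \<in> H" unfolding V_def using kerH by (intro sum_mem) auto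
  have "V - P V = (\<Sum>w\<in>F. cscale (c w) (ker w - P (ker w)))"
    unfolding V_def using kerH F
    by (simp add: proj_sum[OF P] proj_scale[OF P] cfun.scale_right_diff_distrib sum_subtractf)
  then have "ip (V - P V) V = (\<Sum>w\<in>F. c w * ip (ker w - P (ker w)) V)"
    using kerH PkerH VH by (simp only:) (subst ip_sum, auto simp: ip_scale simp del: ip_ker)
  also have "\<dots> = (\<Sum>w\<in>F. c w * (\<Sum>w'\<in>F. cnj (c w') * ip (ker w - P (ker w)) (ker w')))"
  proof (intro sum.cong refl arg_cong2[where f = "(*)"])
    fix w assume w: "w \<in> F"
    show "ip (ker w - P (ker w)) V = (\<Sum>w'\<in>F. cnj (c w') * ip (ker w - P (ker w)) (ker w'))"
      unfolding V_def using kerH PkerH w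
      by (subst ip_sum_right) (auto simp: ip_scale_right simp del: ip_ker)
  qed
  also have "\<dots> = (\<Sum>w\<in>F. \<Sum>w'\<in>F. c w * (cnj (c w') * ip (ker w - P (ker w)) (ker w')))"
    by (simp only: sum_distrib_left)
  also have "\<dots> = (\<Sum>w\<in>F. \<Sum>w'\<in>F. \<Sum>j<N.
      c w * cnj (\<beta> j w) * (cnj (c w' * cnj (\<beta> j w')) * ker w w'))"
  proof (intro sum.cong refl)
    fix w w' assume w: "w \<in> F" "w' \<in> F"
    then have "ip (ker w - P (ker w)) (ker w') = (\<Sum>j<N. \<beta> j w' * cnj (\<beta> j w)) * ker w w'"
      using F kerH PkerH defect_kernel[of w' w] by (subst ip_ker) (auto simp: ker_def)
    then show "c w * (cnj (c w') * ip (ker w - P (ker w)) (ker w')) = (\<Sum>j<N.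
        c w * cnj (\<beta> j w) * (cnj (c w' * cnj (\<beta> j w')) * ker w w'))"
      by (simp add: sum_distrib_left sum_distrib_right mult_ac)
  qed
  also have "\<dots> = (\<Sum>w\<in>F. \<Sum>j<N. \<Sum>w'\<in>F.
      c w * cnj (\<beta> j w) * (cnj (c w' * cnj (\<beta> j w')) * ker w w'))"
    by (intro sum.cong refl sum.swap)
  also have "\<dots> = (\<Sum>w\<in>F. \<Sum>j<N. \<Sum>w'\<in>F.
      c w * cnj (\<beta> j w) * (cnj (c w' * cnj (\<beta> j w')) * ip (ker w) (ker w')))"
    using F by (intro sum.cong refl) (auto simp: subset_iff)
  also have "\<dots> = (\<Sum>j<N. \<Sum>w\<in>F. \<Sum>w'\<in>F.
      c w * cnj (\<beta> j w) * (cnj (c w' * cnj (\<beta> j w')) * ip (ker w) (ker w')))"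
    by (rule sum.swap)
  also have "\<dots> = (\<Sum>j<N. ip (t j) (t j))"
  proof (intro sum.cong refl)
    fix j
    have "ip (t j) (t j) = (\<Sum>w\<in>F. c w * cnj (\<beta> j w) * ip (ker w) (t j))"
    proof -
      have "ip (t j) h = (\<Sum>w\<in>F. c w * cnj (\<beta> j w) * ip (ker w) h)" if "h \<in> H" for h
        unfolding t_def using kerH that by (subst ip_sum) (auto simp: ip_scale simp del: ip_ker)
      then show ?thesis using tH by blast
    qed
    also have "\<dots> = (\<Sum>w\<in>F. c w * cnj (\<beta> j w) *
        (\<Sum>w'\<in>F. cnj (c w' * cnj (\<beta> j w')) * ip (ker w) (ker w')))"
      unfolding t_def using kerH
      by (intro sum.cong refl) (simp add: ip_sum_right ip_scale_right del: ip_ker)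
    finally show "(\<Sum>w\<in>F. \<Sum>w'\<in>F.
      c w * cnj (\<beta> j w) * (cnj (c w' * cnj (\<beta> j w')) * ip (ker w) (ker w'))) = ip (t j) (t j)"
      by (simp only: sum_distrib_left)
  qed
  also have "\<dots> = of_real (\<Sum>j<N. (hnorm ip (t j))\<^sup>2)"
    using tH by (simp add: ip_self)
  finally have "complex_of_real ((hnorm ip (V - P V))\<^sup>2) = of_real (\<Sum>j<N. (hnorm ip (t j))\<^sup>2)"
    by (simp only: proj_self_ip[OF P VH])
  then show ?thesis by (simp only: of_real_eq_iff)
qed

text \<open>By duality: pairing \<open>\<Sum>\<^sub>j \<beta>\<^sub>j g\<^sub>j\<close> with \<open>V\<close> is pairing the tuple \<open>g\<close> with \<open>M\<^sub>\<beta>\<^sup>* V\<close>, whose norm is at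
  most \<open>\<parallel>V\<parallel>\<close>.\<close>

lemma row_contraction:
  assumes g: "\<And>j. j < N \<Longrightarrow> g j \<in> H"
  shows "(\<lambda>z. \<Sum>j<N. \<beta> j z * g j z) \<in> H"
    and "hnorm ip (\<lambda>z. \<Sum>j<N. \<beta> j z * g j z) \<le> sqrt (\<Sum>j<N. (hnorm ip (g j))\<^sup>2)"
proof -
  let ?f = "\<lambda>z. \<Sum>j<N. \<beta> j z * g j z" and ?C = "sqrt (\<Sum>j<N. (hnorm ip (g j))\<^sup>2)"
  have bound: "cmod (\<Sum>w\<in>F. c w * cnj (?f w)) \<le> ?C * hnorm ip (\<Sum>w\<in>F. cscale (c w) (ker w))"
    if F: "finite F" "F \<subseteq> B" for F c
  proof -
    let ?V = "\<Sum>w\<in>F. cscale (c w) (ker w)"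
    have kerH: "ker w \<in> H" if "w \<in> F" for w using that F by auto
    have VH: "?V \<in> H" using kerH by (intro sum_mem) auto
    define t where "t j = (\<Sum>w\<in>F. cscale (c w * cnj (\<beta> j w)) (ker w))" for j
    have tH: "t j \<in> H" for j unfolding t_def using kerH by (intro sum_mem) auto
    have "(\<Sum>w\<in>F. c w * cnj (?f w)) = (\<Sum>w\<in>F. \<Sum>j<N. c w * cnj (\<beta> j w) * cnj (g j w))"
      by (simp add: sum_distrib_left mult_ac)
    also have "\<dots> = (\<Sum>j<N. \<Sum>w\<in>F. c w * cnj (\<beta> j w) * cnj (g j w))" by (rule sum.swap)
    also have "\<dots> = (\<Sum>j<N. ip (t j) (g j))"
      unfolding t_def using kerH F g
      by (intro sum.cong refl) (auto simp: ip_sum ip_scale ip_ker_left subset_iff)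
    also have "cmod \<dots> \<le> (\<Sum>j<N. hnorm ip (t j) * hnorm ip (g j))"
      using g tH by (intro sum_norm_le Cauchy_Schwarz) auto
    also have "\<dots> = (\<Sum>j<N. \<bar>hnorm ip (t j)\<bar> * \<bar>hnorm ip (g j)\<bar>)"
      using g tH by (intro sum.cong refl) simp
    also have "\<dots> \<le> L2_set (\<lambda>j. hnorm ip (t j)) {..<N} * L2_set (\<lambda>j. hnorm ip (g j)) {..<N}"
      by (rule L2_set_mult_ineq)
    also have "L2_set (\<lambda>j. hnorm ip (t j)) {..<N} = hnorm ip (?V - P ?V)"
      unfolding L2_set_def t_def using row_kernel_isometry[OF F] proj_mem_H[OF P VH] VH
      by simp
    also have "L2_set (\<lambda>j. hnorm ip (g j)) {..<N} = ?C" by (simp add: L2_set_def)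
    also have "hnorm ip (?V - P ?V) * ?C \<le> hnorm ip ?V * ?C"
      by (intro mult_right_mono proj_compl_norm_le[OF P VH]) (simp add: sum_nonneg)
    finally show ?thesis by (simp add: mult.commute)
  qed
  have supp: "?f x = 0" if "x \<notin> B" for x
    using zero_outside[OF g that] by simp
  show "?f \<in> H" "hnorm ip ?f \<le> ?C"
    using mem_if_kernel_bound[of ?f ?C] supp bound by (simp_all add: sum_nonneg)
qed

lemma row_entry_contraction:
  assumes j: "j < N" and g: "g \<in> H"
  shows "\<beta> j * g \<in> H" and "hnorm ip (\<beta> j * g) \<le> 1 * hnorm ip g"
proof -
  define G where "G i = (if i = j then g else 0)" for i
  have G: "G i \<in> H" for i using g by (simp add: G_def)
  have "(\<lambda>z. \<Sum>i<N. \<beta> i z * G i z) = (\<lambda>z. \<Sum>i<N. if i = j then \<beta> j z * g z else 0)"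
    by (intro ext sum.cong) (auto simp: G_def)
  then have "(\<lambda>z. \<Sum>i<N. \<beta> i z * G i z) = \<beta> j * g"
    using j by (simp add: fun_eq_iff)
  moreover have "(\<Sum>i<N. (hnorm ip (G i))\<^sup>2) = (\<Sum>i<N. if i = j then (hnorm ip g)\<^sup>2 else 0)"
    by (intro sum.cong) (auto simp: G_def)
  then have "sqrt (\<Sum>i<N. (hnorm ip (G i))\<^sup>2) = hnorm ip g"
    using j g by simp
  ultimately show "\<beta> j * g \<in> H" "hnorm ip (\<beta> j * g) \<le> 1 * hnorm ip g"
    using row_contraction[of G] G by auto
qed

lemma row_entry_multiplier: "j < N \<Longrightarrow> \<beta> j \<in> multipliers H"
  using row_entry_contraction(1) by (simp add: multipliers_def)

text \<open>The adjoint exists componentwise because each entry acts as a contraction. The value of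
  \<open>M\<^sub>\<beta> M\<^sub>\<beta>\<^sup>* h\<close> at \<open>z\<close> is \<open>\<langle>h, M\<^sub>\<beta> M\<^sub>\<beta>\<^sup>* k\<^sub>z\<rangle> = \<langle>h, (I - P) k\<^sub>z\<rangle>\<close>, so the identity on kernel functions
  extends to \<open>H\<close> without a density argument.\<close>

lemma row_defect_op_eq_projection:
  assumes b: "\<And>z j. j < N \<Longrightarrow> b z $$ (0, j) = \<beta> j z"
  shows "row_defect_op H ip N b = restrict P H"
proof -
  have row: "row_mult_op H N b g = (\<lambda>z. \<Sum>j<N. \<beta> j z * g j z)" if "g \<in> tuple_space H N" for g
    using that b by (simp add: row_mult_op_def)
  have "h - row_mult_op H N b
      (adjoint_op (tuple_space H N) (tuple_ip ip N) H ip (row_mult_op H N b) h) = P h"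
    if h: "h \<in> H" for h
  proof -
    have "\<exists>u\<in>H. \<forall>g\<in>H. ip (\<beta> j * g) h = ip g u" if "j < N" for j
      using bounded_multiplication_adjoint[of "\<beta> j" 1 h] row_entry_contraction[OF that] h
      by (metis zero_le_one)
    then obtain u where u: "\<And>j. j < N \<Longrightarrow> u j \<in> H"
      "\<And>j g. j < N \<Longrightarrow> g \<in> H \<Longrightarrow> ip (\<beta> j * g) h = ip g (u j)" by metis
    define u' where "u' = restrict u {..<N}"
    have u': "u' \<in> tuple_space H N" using u by (simp add: u'_def tuple_space_def)
    have adj: "adjoint_op (tuple_space H N) (tuple_ip ip N) H ip (row_mult_op H N b) h = u'"
    proof (rule tuple_adjoint_op_eqI[OF h u'])
      fix g assume g: "g \<in> tuple_space H N"
      then have gH: "g j \<in> H" if "j < N" for j using that by (auto simp: tuple_space_def PiE_iff)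
      have "row_mult_op H N b g = (\<Sum>j<N. \<beta> j * g j)"
        unfolding row[OF g] by (induction N) (auto simp: fun_eq_iff)
      then have "ip (row_mult_op H N b g) h = (\<Sum>j<N. ip (\<beta> j * g j) h)"
        using gH h row_entry_contraction(1) by (simp only:) (subst ip_sum, auto)
      also have "\<dots> = tuple_ip ip N g u'"
        using gH u by (simp add: tuple_ip_def u'_def)
      finally show "ip (row_mult_op H N b g) h = tuple_ip ip N g u'" .
    qed
    have MH: "row_mult_op H N b u' \<in> H"
      unfolding row[OF u'] using u by (intro row_contraction(1)) (simp add: u'_def)
    have "row_mult_op H N b u' z = (h - P h) z" if z: "z \<in> B" for z
    proof -
      have kz: "ker z \<in> H" using z by simp
      have Dz: "ker z - P (ker z) \<in> H" using kz proj_mem_H[OF P kz] by simp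
      have entry: "\<beta> j * ker z \<in> H" if "j < N" for j using row_entry_contraction(1)[OF that kz] .
      have D: "ker z - P (ker z) = (\<Sum>j<N. cscale (cnj (\<beta> j z)) (\<beta> j * ker z))"
      proof (rule mem_ext[OF Dz])
        show "(\<Sum>j<N. cscale (cnj (\<beta> j z)) (\<beta> j * ker z)) \<in> H"
          using entry by (intro sum_mem) auto
        fix x assume x: "x \<in> B"
        have "(\<Sum>j<M. cscale (cnj (\<beta> j z)) (\<beta> j * ker z)) x = (\<Sum>j<M. \<beta> j x * cnj (\<beta> j z)) * k x z" for M
          using x by (induction M) (auto simp: cscale_def ker_def algebra_simps)
        then show "(ker z - P (ker z)) x = (\<Sum>j<N. cscale (cnj (\<beta> j z)) (\<beta> j * ker z)) x"
          using defect_kernel[OF x z] by simp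
      qed
      have "row_mult_op H N b u' z = (\<Sum>j<N. \<beta> j z * u j z)"
        unfolding row[OF u'] by (simp add: u'_def)
      also have "\<dots> = (\<Sum>j<N. cnj (cnj (\<beta> j z) * ip (\<beta> j * ker z) h))"
        using u kz z by (intro sum.cong refl) (simp add: ip_ker_left)
      also have "\<dots> = cnj (ip (ker z - P (ker z)) h)"
        unfolding D using entry h by (subst ip_sum) (auto simp: ip_scale)
      also have "\<dots> = ip h (ker z - P (ker z))" using ip_commute[OF Dz h] by simp
      also have "\<dots> = h z - ip h (P (ker z))"
        using h kz proj_mem_H[OF P kz] z by (simp add: ip_diff_right)
      also have "ip h (P (ker z)) = P h z"
        using proj_selfadjoint[OF P h kz] proj_mem_H[OF P h] z by simp
      finally show ?thesis by simp
    qed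
    then have "row_mult_op H N b u' = h - P h"
      using MH h proj_mem_H[OF P h] by (intro mem_ext) auto
    then show ?thesis by (simp add: adj)
  qed
  then show ?thesis by (auto simp: row_defect_op_def)
qed

end

end

section \<open>Ball automorphisms and unitary matrices\<close>

lemma cinner_diff_left: "cinner (x - y) z = cinner x z - cinner y z"
  by (simp add: cinner_def algebra_simps sum_subtractf)

lemma cinner_diff_right: "cinner z (x - y) = cinner z x - cinner z y"
  by (simp add: cinner_def algebra_simps sum_subtractf)

lemma cinner_scale_left: "cinner (c *s x) y = c * cinner x y"
  by (simp add: cinner_def sum_distrib_left mult_ac)

lemma cinner_scale_right: "cinner x (c *s y) = cnj c * cinner x y"
  by (simp add: cinner_def sum_distrib_left mult_ac)

lemma cinner_commute: "cinner y x = cnj (cinner x y)"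
  by (simp add: cinner_def mult.commute)

lemma cinner_self: "cinner x x = complex_of_real ((norm x)\<^sup>2)"
proof -
  have "(norm x)\<^sup>2 = (\<Sum>i\<in>UNIV. (cmod (x $ i))\<^sup>2)"
    by (simp add: norm_vec_def L2_set_def sum_nonneg)
  then show ?thesis
    by (simp add: cinner_def complex_norm_square del: of_real_power)
qed

lemma cinner_le: "cmod (cinner x y) \<le> norm x * norm y"
proof -
  have "cmod (cinner x y) \<le> (\<Sum>i\<in>UNIV. \<bar>norm (x $ i)\<bar> * \<bar>norm (y $ i)\<bar>)"
    unfolding cinner_def by (rule sum_norm_le) (simp add: norm_mult)
  also have "\<dots> \<le> norm x * norm y"
    unfolding norm_vec_def by (rule L2_set_mult_ineq)
  finally show ?thesis .
qed

lemma one_minus_cinner_nonzero: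
  assumes "z \<in> ball 0 1" "w \<in> ball 0 1"
  shows "1 - cinner z w \<noteq> 0"
proof
  assume "1 - cinner z w = 0"
  then have "1 \<le> norm z * norm w" using cinner_le[of z w] by simp
  moreover have "norm z * norm w < 1"
    using assms mult_strict_mono[of "norm z" 1 "norm w" 1] by simp
  ultimately show False by simp
qed

lemma da_kernel_self: "da_kernel z z = complex_of_real (1 / (1 - (norm z)\<^sup>2))"
  by (simp add: da_kernel_def cinner_self)

lemma ball_sq: "z \<in> ball 0 1 \<Longrightarrow> 1 - (norm z)\<^sup>2 > 0"
  by (simp add: power_less_one_iff abs_square_less_1)

text \<open>The involutive automorphism identity, in the form that makes
  \<open>(1 - \<phi>\<^sub>\<mu>(z) \<phi>\<^sub>\<mu>(w)\<^sup>*) k(z, w)\<close> the rank one kernel of the projection onto \<open>\<complex> k\<^sub>\<mu>\<close>. Both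
  branches of \<open>P\<^sub>\<mu>\<close> are covered by writing the numerator of \<open>\<phi>\<^sub>\<mu>\<close> as
  \<open>(1 - t \<langle>z, \<mu>\<rangle>) \<mu> - s z\<close> with \<open>s\<^sup>2 = 1 - \<parallel>\<mu>\<parallel>\<^sup>2\<close> and \<open>t \<parallel>\<mu>\<parallel>\<^sup>2 = 1 - s\<close>.\<close>

lemma ball_aut_identity:
  assumes \<mu>: "\<mu> \<in> ball 0 1" and z: "z \<in> ball 0 1" and w: "w \<in> ball 0 1"
  shows "(1 - cinner (ball_aut \<mu> z) (ball_aut \<mu> w)) * da_kernel z w
    = da_kernel z \<mu> * da_kernel \<mu> w / da_kernel \<mu> \<mu>"
proof -
  define s where "s = complex_of_real (sqrt (1 - (norm \<mu>)\<^sup>2))"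
  define A where "A = cinner \<mu> \<mu>"
  define t where "t = (1 - s) / A"
  define p where "p = cinner z \<mu>"
  define q where "q = cinner \<mu> w"
  define r where "r = cinner z w"
  have s2: "s * s = 1 - A"
    using ball_sq[OF \<mu>] by (simp add: s_def A_def cinner_self flip: of_real_mult)
  have cs: "cnj s = s" by (simp add: s_def)
  have cA: "cnj A = A" by (simp add: A_def cinner_self)
  then have ct: "cnj t = t" by (simp add: t_def cs)
  have num: "\<mu> - line_proj \<mu> x - s *s (x - line_proj \<mu> x) = (1 - t * cinner x \<mu>) *s \<mu> - s *s x" for x
    unfolding line_proj_def t_def A_def vec_eq_iff
    by (cases "\<mu> = 0") (simp_all add: algebra_simps diff_divide_distrib)
  have aut: "ball_aut \<mu> x = (1 / (1 - cinner x \<mu>)) *s ((1 - t * cinner x \<mu>) *s \<mu> - s *s x)" for x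
    by (simp only: ball_aut_def s_def[symmetric] num)
  have q': "cinner w \<mu> = cnj q" using cinner_commute[of w \<mu>] by (simp add: q_def)
  have N: "cinner ((1 - t * p) *s \<mu> - s *s z) ((1 - t * cnj q) *s \<mu> - s *s w)
      = (1 - t * p) * (1 - t * q) * A - (1 - t * p) * s * q - s * (1 - t * q) * p + s * s * r"
    by (simp add: cinner_diff_left cinner_diff_right cinner_scale_left cinner_scale_right
        cs ct p_def[symmetric] q_def[symmetric] r_def[symmetric] A_def[symmetric]) (simp add: algebra_simps)
  also have "\<dots> = (1 - p) * (1 - q) - (1 - A) * (1 - r)"
  proof (cases "A = 0")
    case True
    then have "\<mu> = 0" by (simp add: A_def cinner_self)
    then have "p = 0" "q = 0" by (simp_all add: p_def q_def cinner_def)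
    then show ?thesis using s2 True by simp
  next
    case False
    then have tA: "t * A = 1 - s" by (simp add: t_def)
    have "(1 - t * p) * (1 - t * q) * A - (1 - t * p) * s * q - s * (1 - t * q) * p + s * s * r
        = A - (t * A) * (p + q) + t * (t * A) * p * q - s * (p + q) + 2 * s * t * p * q + s * s * r"
      by (simp add: algebra_simps)
    also have "\<dots> = A - (p + q) + t * (1 + s) * p * q + s * s * r"
      unfolding tA by (simp add: algebra_simps)
    also have "t * (1 + s) = 1"
    proof -
      have "t * (1 + s) * A = (1 - s) * (1 + s)" using tA by (simp add: mult_ac)
      also have "\<dots> = A" using s2 by (simp add: algebra_simps)
      finally show ?thesis using False by simp
    qed
    also have "A - (p + q) + 1 * p * q + s * s * r = (1 - p) * (1 - q) - (1 - A) * (1 - r)"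
      unfolding s2 by (simp add: algebra_simps)
    finally show ?thesis .
  qed
  finally have num_eq: "cinner ((1 - t * p) *s \<mu> - s *s z) ((1 - t * cnj q) *s \<mu> - s *s w)
      = (1 - p) * (1 - q) - (1 - A) * (1 - r)" .
  have nz: "1 - p \<noteq> 0" "1 - q \<noteq> 0" "1 - r \<noteq> 0" "1 - A \<noteq> 0"
    using one_minus_cinner_nonzero \<mu> z w by (auto simp: p_def q_def r_def A_def)
  have "cinner (ball_aut \<mu> z) (ball_aut \<mu> w)
      = 1 / (1 - p) * (1 / (1 - q)) * ((1 - p) * (1 - q) - (1 - A) * (1 - r))"
    unfolding aut cinner_scale_left cinner_scale_right q' p_def[symmetric] num_eq by simp
  also have "\<dots> = 1 - (1 - A) * (1 - r) / ((1 - p) * (1 - q))"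
    using nz by (simp add: diff_divide_distrib)
  finally have "(1 - cinner (ball_aut \<mu> z) (ball_aut \<mu> w)) * (1 / (1 - r))
      = 1 / (1 - p) * (1 / (1 - q)) / (1 / (1 - A))"
    using nz by simp
  then show ?thesis by (simp add: da_kernel_def p_def q_def r_def A_def)
qed

lemma coords_distinct: "distinct (coords :: 'd::finite list)"
  and coords_set: "set (coords :: 'd::finite list) = UNIV"
proof -
  have "\<exists>is :: 'd list. distinct is \<and> set is = UNIV" 
    using finite_distinct_list[OF finite[of "UNIV :: 'd set"]] by blast
  from someI_ex[OF this] show "distinct (coords :: 'd list)" "set (coords :: 'd list) = UNIV"
    by (simp_all add: coords_def)
qed

lemma length_coords: "length (coords :: 'd::finite list) = CARD('d)"
  using distinct_card[OF coords_distinct] coords_set by metis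

lemma sum_coords: "(\<Sum>j<CARD('d). f ((coords :: 'd::finite list) ! j)) = (\<Sum>i\<in>UNIV. f i)"
  by (rule sum.reindex_bij_betw)
    (use bij_betw_nth[OF coords_distinct[where 'd = 'd] refl coords_set[symmetric]] length_coords[where 'd = 'd] in
      \<open>simp add: lessThan_atLeast0\<close>)

definition row_ip :: "complex Matrix.mat \<Rightarrow> complex Matrix.mat \<Rightarrow> complex" where
  "row_ip r s = (\<Sum>j<dim_col r. r $$ (0, j) * cnj (s $$ (0, j)))"

lemma row_ip_self: "row_ip r r = complex_of_real ((row_norm r)\<^sup>2)"
proof -
  have "(row_norm r)\<^sup>2 = (\<Sum>j<dim_col r. (cmod (r $$ (0, j)))\<^sup>2)"
    by (simp add: row_norm_def sum_nonneg)
  then show ?thesis by (simp add: row_ip_def complex_norm_square del: of_real_power)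
qed

lemma row_ip_ball_aut: "row_ip (ball_aut_row \<mu> z) (ball_aut_row \<mu> w) = cinner (ball_aut \<mu> z) (ball_aut \<mu> w)"
proof -
  have "row_ip (ball_aut_row \<mu> z) (ball_aut_row \<mu> w) =
    (\<Sum>j<CARD('a). ball_aut \<mu> z $ (coords ! j) * cnj (ball_aut \<mu> w $ (coords ! j)))"
    by (simp add: row_ip_def ball_aut_row_def)
  then show ?thesis
    using sum_coords[of "\<lambda>i. ball_aut \<mu> z $ i * cnj (ball_aut \<mu> w $ i)"] by (simp add: cinner_def)
qed

lemma mat_adjoint_index:
  "i < dim_col A \<Longrightarrow> j < dim_row A \<Longrightarrow> mat_adjoint A $$ (i, j) = cnj (A $$ (j, i))"
  for A :: "complex Matrix.mat"
  by (simp add: mat_adjoint_def mat_of_rows_index)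

lemma mat_adjoint_carrier: "A \<in> carrier_mat m n \<Longrightarrow> mat_adjoint A \<in> carrier_mat n m"
  for A :: "complex Matrix.mat"
  unfolding mat_adjoint_def by auto

lemma unitary_rows:
  assumes U: "unitary_mat m U" and "i < m" "l < m"
  shows "(\<Sum>j<m. U $$ (i, j) * cnj (U $$ (l, j))) = (if i = l then 1 else 0)"
proof -
  have c: "U \<in> carrier_mat m m" "mat_adjoint U \<in> carrier_mat m m"
    using U mat_adjoint_carrier by (auto simp: unitary_mat_def)
  have "(U * mat_adjoint U) $$ (i, l) = (\<Sum>j<m. U $$ (i, j) * mat_adjoint U $$ (j, l))"
    using c assms(2,3) by (simp add: scalar_prod_def lessThan_atLeast0)
  also have "\<dots> = (\<Sum>j<m. U $$ (i, j) * cnj (U $$ (l, j)))"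
    using c assms(2,3) by (intro sum.cong refl) (simp add: mat_adjoint_index)
  finally show ?thesis using U assms(2,3) by (simp add: unitary_mat_def)
qed

lemma row_ip_unitary:
  assumes U: "unitary_mat m U" and r: "r \<in> carrier_mat 1 m" and s: "s \<in> carrier_mat 1 m"
  shows "row_ip (r * U) (s * U) = row_ip r s"
proof -
  have c: "U \<in> carrier_mat m m" using U by (simp add: unitary_mat_def)
  have ent: "(x * U) $$ (0, j) = (\<Sum>i<m. x $$ (0, i) * U $$ (i, j))"
    if "x \<in> carrier_mat 1 m" "j < m" for x j
    using that c by (simp add: scalar_prod_def lessThan_atLeast0)
  have "row_ip (r * U) (s * U) = (\<Sum>j<m. (r * U) $$ (0, j) * cnj ((s * U) $$ (0, j)))"
    using c unfolding row_ip_def by (simp only: index_mult_mat(3) carrier_matD(2))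
  also have "\<dots> = (\<Sum>j<m. (\<Sum>i<m. r $$ (0, i) * U $$ (i, j)) *
      (\<Sum>l<m. cnj (s $$ (0, l)) * cnj (U $$ (l, j))))"
    by (intro sum.cong refl)
      (simp only: ent[OF r] ent[OF s] lessThan_iff cnj_sum complex_cnj_mult)
  also have "\<dots> = (\<Sum>j<m. \<Sum>i<m. \<Sum>l<m. r $$ (0, i) * cnj (s $$ (0, l)) * (U $$ (i, j) * cnj (U $$ (l, j))))"
    by (simp add: sum_product mult_ac)
  also have "\<dots> = (\<Sum>i<m. \<Sum>j<m. \<Sum>l<m. r $$ (0, i) * cnj (s $$ (0, l)) * (U $$ (i, j) * cnj (U $$ (l, j))))"
    by (rule sum.swap)
  also have "\<dots> = (\<Sum>i<m. \<Sum>l<m. \<Sum>j<m. r $$ (0, i) * cnj (s $$ (0, l)) * (U $$ (i, j) * cnj (U $$ (l, j))))"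
    by (intro sum.cong refl sum.swap)
  also have "\<dots> = (\<Sum>i<m. \<Sum>l<m. r $$ (0, i) * cnj (s $$ (0, l)) * (if i = l then 1 else 0))"
    by (intro sum.cong refl) (simp add: unitary_rows[OF U] flip: sum_distrib_left)
  also have "\<dots> = (\<Sum>i<m. r $$ (0, i) * cnj (s $$ (0, i)))"
    by (intro sum.cong refl) (simp add: if_distrib[of "\<lambda>x. _ * x"] cong: if_cong)
  finally show ?thesis using r by (simp add: row_ip_def)
qed

text \<open>The block matrix replaces the first entry \<open>r\<^sub>0\<close> of a row by \<open>r\<^sub>0 \<phi>\<close> and keeps the other entries.\<close>

lemma row_ip_block_step:
  assumes r: "r \<in> carrier_mat 1 (k + 1)" and s: "s \<in> carrier_mat 1 (k + 1)"
    and \<phi>: "\<phi> \<in> carrier_mat 1 d" and \<psi>: "\<psi> \<in> carrier_mat 1 d"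
  shows "row_ip (r * four_block_mat \<phi> (0\<^sub>m 1 k) (0\<^sub>m k d) (1\<^sub>m k))
      (s * four_block_mat \<psi> (0\<^sub>m 1 k) (0\<^sub>m k d) (1\<^sub>m k))
    = row_ip r s - (1 - row_ip \<phi> \<psi>) * (r $$ (0, 0) * cnj (s $$ (0, 0)))"
proof -
  let ?D = "\<lambda>\<phi>. four_block_mat \<phi> (0\<^sub>m 1 k) (0\<^sub>m k d) (1\<^sub>m k)"
  have ent1: "(x * ?D \<theta>) $$ (0, j) = x $$ (0, 0) * \<theta> $$ (0, j)"
    if "x \<in> carrier_mat 1 (k + 1)" "\<theta> \<in> carrier_mat 1 d" "j < d" for x \<theta> :: "complex Matrix.mat" and j
  proof -
    have "(x * ?D \<theta>) $$ (0, j) = (\<Sum>i<k + 1. x $$ (0, i) * ?D \<theta> $$ (i, j))"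
      using that by (simp add: scalar_prod_def lessThan_atLeast0 del: sum.op_ivl_Suc sum.lessThan_Suc)
    also have "\<dots> = (\<Sum>i<k + 1. if i = 0 then x $$ (0, 0) * \<theta> $$ (0, j) else 0)"
      using that by (intro sum.cong refl) auto
    finally show ?thesis by simp
  qed
  have ent2: "(x * ?D \<theta>) $$ (0, d + j) = x $$ (0, Suc j)"
    if "x \<in> carrier_mat 1 (k + 1)" "\<theta> \<in> carrier_mat 1 d" "j < k" for x \<theta> :: "complex Matrix.mat" and j
  proof -
    have "(x * ?D \<theta>) $$ (0, d + j) = (\<Sum>i<k + 1. x $$ (0, i) * ?D \<theta> $$ (i, d + j))"
      using that by (simp add: scalar_prod_def lessThan_atLeast0 del: sum.op_ivl_Suc sum.lessThan_Suc)
    also have "\<dots> = (\<Sum>i<k + 1. if i = Suc j then x $$ (0, Suc j) else 0)"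
      using that by (intro sum.cong refl) auto
    finally show ?thesis using that by simp
  qed
  have split: "(\<Sum>j<d + k. f j) = (\<Sum>j<d. f j) + (\<Sum>j<k. f (d + j))" for f :: "nat \<Rightarrow> complex"
    by (induction k) (auto simp: add.assoc)
  have "row_ip (r * ?D \<phi>) (s * ?D \<psi>) = (\<Sum>j<d + k. (r * ?D \<phi>) $$ (0, j) * cnj ((s * ?D \<psi>) $$ (0, j)))"
    using \<phi> by (simp add: row_ip_def)
  also have "\<dots> = (\<Sum>j<d. r $$ (0, 0) * \<phi> $$ (0, j) * cnj (s $$ (0, 0) * \<psi> $$ (0, j)))
      + (\<Sum>j<k. r $$ (0, Suc j) * cnj (s $$ (0, Suc j)))"
    unfolding split
    by (intro arg_cong2[where f = "(+)"] sum.cong refl) 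
      (simp_all add: ent1[OF r \<phi>] ent1[OF s \<psi>] ent2[OF r \<phi>] ent2[OF s \<psi>] del: One_nat_def)
  also have "(\<Sum>j<d. r $$ (0, 0) * \<phi> $$ (0, j) * cnj (s $$ (0, 0) * \<psi> $$ (0, j)))
      = row_ip \<phi> \<psi> * (r $$ (0, 0) * cnj (s $$ (0, 0)))"
    using \<phi> by (simp add: row_ip_def sum_distrib_left sum_distrib_right mult_ac)
  also have "row_ip r s = r $$ (0, 0) * cnj (s $$ (0, 0)) + (\<Sum>j<k. r $$ (0, Suc j) * cnj (s $$ (0, Suc j)))"
    using r by (simp add: row_ip_def sum.lessThan_Suc_shift del: sum.lessThan_Suc)
  then have "(\<Sum>j<k. r $$ (0, Suc j) * cnj (s $$ (0, Suc j))) = row_ip r s - r $$ (0, 0) * cnj (s $$ (0, 0))"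
    by simp
  finally show ?thesis by (simp add: algebra_simps)
qed

text \<open>With \<open>\<alpha>\<close> the phase of \<open>v\<^sub>0\<close> and \<open>w = v + \<alpha> e\<^sub>0\<close>, which never vanishes, the matrix is \<open>- \<alpha>\<close> times
  the Householder reflection along \<open>w\<close>.\<close>

lemma unitary_with_first_column:
  assumes m: "m > 0" and v: "v \<in> carrier_vec m" and unit: "(\<Sum>i<m. vec_index v i * cnj (vec_index v i)) = 1"
  obtains U where "unitary_mat m U" "U *\<^sub>v unit_vec m 0 = v"
proof -
  define v0 where "v0 = vec_index v 0"
  define \<alpha> where "\<alpha> = (if v0 = 0 then 1 else sgn v0)"
  define c where "c = complex_of_real (1 + cmod v0)"
  define w where "w i = vec_index v i + (if i = 0 then \<alpha> else 0)" for i
  define U where "U = Matrix.mat m m (\<lambda>(i, j). - \<alpha> * ((if i = j then 1 else 0) - w i * cnj (w j) / c))"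
  have "cmod \<alpha> = 1" by (simp add: \<alpha>_def norm_sgn)
  then have \<alpha>: "\<alpha> * cnj \<alpha> = 1" using complex_norm_square[of \<alpha>] by simp
  have \<alpha>v: "\<alpha> * cnj v0 = cmod v0" "v0 * cnj \<alpha> = cmod v0"
    by (auto simp: \<alpha>_def sgn_eq mult.commute[of "cnj v0"] complex_norm_square[symmetric] power2_eq_square)
  have "1 + cmod v0 > 0" by (simp add: add_pos_nonneg)
  then have c0: "c \<noteq> 0" unfolding c_def using of_real_eq_0_iff by (metis less_irrefl)
  have cc: "cnj c = c" by (simp add: c_def)
  have "(\<Sum>j<m. w j * cnj (w j)) = (\<Sum>j<m. vec_index v j * cnj (vec_index v j)
      + (if j = 0 then v0 * cnj \<alpha> + \<alpha> * cnj v0 + \<alpha> * cnj \<alpha> else 0))"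
    by (intro sum.cong refl) (auto simp: w_def v0_def algebra_simps)
  also have "\<dots> = 2 * c"
    using m by (simp add: sum.distrib unit \<alpha> \<alpha>v c_def)
  finally have ww: "(\<Sum>j<m. w j * cnj (w j)) = 2 * c" .
  have U: "U \<in> carrier_mat m m" by (simp add: U_def)
  have aU: "mat_adjoint U \<in> carrier_mat m m" using mat_adjoint_carrier[OF U] .
  have "U * mat_adjoint U = 1\<^sub>m m"
  proof (rule eq_matI)
    fix i l assume "i < dim_row (1\<^sub>m m :: complex Matrix.mat)" "l < dim_col (1\<^sub>m m :: complex Matrix.mat)"
    then have i: "i < m" "l < m" by auto
    have "(U * mat_adjoint U) $$ (i, l) = (\<Sum>j<m. U $$ (i, j) * mat_adjoint U $$ (j, l))"
      using U aU i by (simp add: scalar_prod_def lessThan_atLeast0)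
    also have "\<dots> = (\<Sum>j<m. (\<alpha> * cnj \<alpha>) * ((if j = i then (if i = l then 1 else 0) - w i * cnj (w l) / c else 0)
        - (if j = l then w i * cnj (w l) / c else 0) + w i * cnj (w l) * (w j * cnj (w j)) / (c * c)))"
      using U i c0 by (intro sum.cong refl)
        (auto simp: mat_adjoint_index U_def cc field_simps)
    also have "\<dots> = (if i = l then 1 else 0) - w i * cnj (w l) / c - w i * cnj (w l) / c
        + w i * cnj (w l) * (\<Sum>j<m. w j * cnj (w j)) / (c * c)"
      using i by (simp add: \<alpha> sum.distrib sum_subtractf sum_distrib_left sum_divide_distrib)
    also have "\<dots> = (if i = l then 1 else 0)" unfolding ww using c0 by (simp add: field_simps)
    finally show "(U * mat_adjoint U) $$ (i, l) = 1\<^sub>m m $$ (i, l)" using i by simp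
  qed (use U aU in auto)
  then have "unitary_mat m U"
    using U aU mat_mult_left_right_inverse by (auto simp: unitary_mat_def)
  moreover have "U *\<^sub>v unit_vec m 0 = v"
  proof (rule eq_vecI)
    fix i assume "i < dim_vec v"
    then have i: "i < m" using v by simp
    have "\<alpha> * cnj (w 0) = c" by (simp add: w_def v0_def[symmetric] distrib_left \<alpha> \<alpha>v c_def)
    moreover have "vec_index (U *\<^sub>v unit_vec m 0) i = U $$ (i, 0)"
      using U i m by (simp add: scalar_prod_right_unit)
    moreover have "U $$ (i, 0) = - (if i = 0 then \<alpha> else 0) + w i * (\<alpha> * cnj (w 0)) / c"
      using i m by (simp add: U_def algebra_simps)
    ultimately show "vec_index (U *\<^sub>v unit_vec m 0) i = vec_index v i"
      using c0 by (simp add: w_def)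
  qed (use U v in auto)
  ultimately show ?thesis using that by blast
qed

section \<open>Interpolation and spans of kernel functions\<close>

lemma sum_fun_apply: "(\<Sum>i\<in>A. f i) x = (\<Sum>i\<in>A. f i x)" for f :: "'i \<Rightarrow> 'x \<Rightarrow> complex"
  by (induction A rule: infinite_finite_induct) auto

lemma (in function_hilbert_space) proj_onto_cong:
  "proj_onto S P \<Longrightarrow> (\<And>f. f \<in> H \<Longrightarrow> Q f = P f) \<Longrightarrow> proj_onto S Q"
  by (simp add: proj_onto_def)

context rkhs
begin

lemma proj_onto_single_kernel:
  assumes \<mu>: "\<mu> \<in> B"
  shows "proj_onto (cfun.span {ker \<mu>}) (\<lambda>f. cscale (f \<mu> / k \<mu> \<mu>) (ker \<mu>))"
proof -
  have "proj_onto (cfun.span {ker \<mu>})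
      (\<lambda>f. 0 + cscale (ip f (ker \<mu> - 0) / ip (ker \<mu> - 0) (ker \<mu> - 0)) (ker \<mu> - 0))"
    by (rule proj_onto_insert[OF proj_onto_empty]) (use \<mu> in auto)
  then show ?thesis
    by (rule proj_onto_cong) (use \<mu> in \<open>simp add: ker_apply\<close>)
qed

text \<open>In the presence of functions \<open>e x\<close> that interpolate the point masses on a finite set \<open>X\<close>,
  evaluation on \<open>X\<close> identifies the span of the kernel functions with \<open>\<complex>\<^sup>X\<close>.\<close>

context
  fixes X e
  assumes finX: "finite X" and XB: "X \<subseteq> B"
    and e_mem: "\<And>x. x \<in> X \<Longrightarrow> e x \<in> H"
    and e_val: "\<And>x y. x \<in> X \<Longrightarrow> y \<in> X \<Longrightarrow> e x y = (if x = y then 1 else 0)"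
begin

lemma kernel_coefficient:
  assumes y: "y \<in> X"
  shows "ip (\<Sum>x\<in>X. cscale (c x) (ker x)) (e y) = c y"
proof -
  have "ip (\<Sum>x\<in>X. cscale (c x) (ker x)) (e y) = (\<Sum>x\<in>X. ip (cscale (c x) (ker x)) (e y))"
    using XB e_mem[OF y] by (intro ip_sum) auto
  also have "\<dots> = (\<Sum>x\<in>X. if x = y then c y else 0)"
    using XB e_mem[OF y] y
    by (intro sum.cong refl) (auto simp: ip_scale ip_ker_left e_val subset_iff)
  finally show ?thesis using finX y by simp
qed

lemma inj_on_ker: "inj_on ker X"
proof (rule inj_onI)
  fix x y assume xy: "x \<in> X" "y \<in> X" and eq: "ker x = ker y"
  have "cnj (e x x) = cnj (e x y)"
    using ip_ker_left[OF e_mem[OF xy(1)]] xy XB eq by (metis subsetD)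
  then show "x = y" using xy by (auto simp: e_val split: if_splits)
qed

lemma independent_ker: "cfun.independent (ker ` X)"
proof (rule cfun.independent_if_scalars_zero)
  fix c v assume sum: "(\<Sum>v\<in>ker ` X. cscale (c v) v) = 0" and "v \<in> ker ` X"
  then obtain y where y: "y \<in> X" "v = ker y" by blast
  have "ip (\<Sum>x\<in>X. cscale (c (ker x)) (ker x)) (e y) = 0"
    using sum e_mem[OF y(1)] by (simp add: sum.reindex[OF inj_on_ker])
  then show "c v = 0" using kernel_coefficient[OF y(1), of "\<lambda>x. c (ker x)"] y by simp
qed (use finX in simp)

lemma dim_span_ker: "cfun.dim (cfun.span (ker ` X)) = card X"
  using cfun.dim_span_eq_card_independent[OF independent_ker] card_image[OF inj_on_ker] by simp

lemma span_ker_coefficients: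
  assumes "v \<in> cfun.span (ker ` X)"
  obtains c where "v = (\<Sum>x\<in>X. cscale (c x) (ker x))"
proof -
  obtain c where "v = (\<Sum>v\<in>ker ` X. cscale (c v) v)"
    using assms finX by (auto simp: cfun.span_finite)
  then show ?thesis using that[of "\<lambda>x. c (ker x)"] by (simp add: sum.reindex[OF inj_on_ker])
qed

lemma coefficient_bound:
  "(\<Sum>x\<in>X. cmod (c x)) \<le> (\<Sum>x\<in>X. hnorm ip (e x)) * hnorm ip (\<Sum>x\<in>X. cscale (c x) (ker x))"
proof -
  let ?v = "\<Sum>x\<in>X. cscale (c x) (ker x)"
  have v: "?v \<in> H" using XB by (intro sum_mem) auto
  have "cmod (c x) \<le> hnorm ip (e x) * hnorm ip ?v" if "x \<in> X" for x
    using Cauchy_Schwarz[OF v e_mem[OF that]] kernel_coefficient[OF that, of c]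
    by (simp add: mult.commute)
  then show ?thesis unfolding sum_distrib_right by (rule sum_mono)
qed

end

lemma proj_ker_eval:
  assumes P: "proj_onto (cfun.span (ker ` X)) P" and x: "x \<in> X" "X \<subseteq> B" and f: "f \<in> H"
  shows "P f x = f x"
  using proj_ip[OF P f, of "ker x"] x f proj_mem_H[OF P f] cfun.span_base[of "ker x" "ker ` X"]
  by (auto simp: subset_iff)

text \<open>Vanishing on \<open>X\<close> means being orthogonal to the span itself.\<close>

lemma span_ker_zeroI:
  assumes X: "X \<subseteq> B" and v: "v \<in> cfun.span (ker ` X)" and zero: "\<And>x. x \<in> X \<Longrightarrow> v x = 0"
  shows "v = 0"
proof -
  have vH: "v \<in> H" using v ker_span_sub[OF X] by blast
  have "ip v v = 0"
    by (rule orthogonal_span[OF _ vH _ v]) (use X vH zero in auto)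
  then show ?thesis using vH by (simp add: ip_self_eq_0_iff)
qed

text \<open>Kernel functions are eigenvectors of adjoints of multiplication operators, so their spans are
  coinvariant.\<close>

lemma span_ker_coinvariant:
  assumes X: "X \<subseteq> B" and \<phi>: "\<phi> \<in> multipliers H" and h: "h \<in> cfun.span (ker ` X)"
  shows "adjoint_op H ip H ip (mult_op H \<phi>) h \<in> cfun.span (ker ` X)"
proof -
  let ?S = "cfun.span (ker ` X)"
  have \<phi>H: "\<phi> * g \<in> H" if "g \<in> H" for g using \<phi> that by (simp add: multipliers_def)
  have SH: "?S \<subseteq> H" by (rule ker_span_sub[OF X])
  let ?T = "{h \<in> ?S. \<exists>u\<in>?S. \<forall>g\<in>H. ip (\<phi> * g) h = ip g u}"
  have "cfun.subspace ?T"
    unfolding cfun.subspace_def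
  proof (intro conjI ballI allI)
    show "0 \<in> ?T" using \<phi>H by (auto intro!: bexI[of _ 0] simp: cfun.span_zero)
    fix x assume "x \<in> ?T"
    then obtain u where x: "x \<in> ?S" and u: "u \<in> ?S" "\<forall>g\<in>H. ip (\<phi> * g) x = ip g u" by blast
    have xuH: "x \<in> H" "u \<in> H" using SH x u by auto
    show "cscale c x \<in> ?T" for c
      using x u xuH \<phi>H
      by (auto intro!: bexI[of _ "cscale c u"] simp: ip_scale_right cfun.span_scale)
    fix y assume "y \<in> ?T"
    then obtain w where y: "y \<in> ?S" and w: "w \<in> ?S" "\<forall>g\<in>H. ip (\<phi> * g) y = ip g w" by blast
    have "y \<in> H" "w \<in> H" using SH y w by auto
    then show "x + y \<in> ?T"
      using x u y w xuH \<phi>H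
      by (auto intro!: bexI[of _ "u + w"] simp: ip_add_right cfun.span_add)
  qed
  moreover have "ker ` X \<subseteq> ?T"
  proof
    fix v assume "v \<in> ker ` X"
    then obtain x where x: "x \<in> X" "v = ker x" by blast
    have v: "v \<in> ?S" using x by (simp add: cfun.span_base)
    moreover have "ip (\<phi> * g) v = ip g (cscale (cnj (\<phi> x)) v)" if "g \<in> H" for g
      using that x X \<phi>H[OF that] by (auto simp: ip_scale_right subset_iff)
    ultimately show "v \<in> ?T" using cfun.span_scale[OF v] by blast
  qed
  ultimately have "?S \<subseteq> ?T" by (intro cfun.span_minimal)
  then obtain u where u: "u \<in> ?S" "\<And>g. g \<in> H \<Longrightarrow> ip (\<phi> * g) h = ip g u" using h by blast
  then have "adjoint_op H ip H ip (mult_op H \<phi>) h = u"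
    using h SH by (intro adjoint_op_eqI) (auto simp: mult_op_def)
  then show ?thesis using u by simp
qed

end

context drury_arveson
begin

lemma ker_0: "z \<in> ball 0 1 \<Longrightarrow> ker 0 z = 1"
  by (simp add: ker_apply da_kernel_def cinner_def)

text \<open>The row of coordinate functions satisfies \<open>(1 - \<langle>z, w\<rangle>) k(z, w) = 1\<close>, and \<open>1\<close> is the kernel of the
  projection onto the constants; so the row theorem applies to it.\<close>

lemma coordinate_multiplication:
  fixes i :: 'd
  assumes g: "g \<in> H"
  shows "(\<lambda>z. z $ i) * g \<in> H" "hnorm ip ((\<lambda>z. z $ i) * g) \<le> 1 * hnorm ip g"
proof -
  let ?P = "\<lambda>f. cscale (f 0 / da_kernel (0 :: complex ^ 'd) 0) (ker 0)"
  let ?\<beta> = "\<lambda>j z. z $ ((coords :: 'd list) ! j)"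
  have P: "proj_onto (cfun.span {ker 0}) ?P" by (rule proj_onto_single_kernel) simp
  have defect: "(1 - (\<Sum>j<CARD('d). ?\<beta> j z * cnj (?\<beta> j w))) * da_kernel z w = ?P (ker w) z"
    if "z \<in> ball 0 1" "w \<in> ball 0 1" for z w :: "complex ^ 'd"
  proof -
    have "(\<Sum>j<CARD('d). ?\<beta> j z * cnj (?\<beta> j w)) = cinner z w"
      unfolding cinner_def by (rule sum_coords[of "\<lambda>i. z $ i * cnj (w $ i)"])
    moreover have "(1 - cinner z w) * da_kernel z w = 1"
      using one_minus_cinner_nonzero[OF that] by (simp add: da_kernel_def)
    moreover have "ker w 0 = 1" "da_kernel (0 :: complex ^ 'd) 0 = 1"
      by (simp_all add: ker_apply da_kernel_def cinner_def)
    ultimately show ?thesis using ker_0[OF that(1)] by (simp add: cscale_def)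
  qed
  obtain j where j: "j < CARD('d)" "(coords :: 'd list) ! j = i"
    using coords_set length_coords by (metis UNIV_I in_set_conv_nth)
  show "(\<lambda>z. z $ i) * g \<in> H" "hnorm ip ((\<lambda>z. z $ i) * g) \<le> 1 * hnorm ip g"
    using row_entry_contraction[OF P defect j(1) g] j(2) by simp_all
qed

lemma coordinate_multiplier: "(\<lambda>z. z $ i) \<in> multipliers H"
  using coordinate_multiplication by (simp add: multipliers_def)

lemma affine_multiplication_sum:
  "(\<lambda>z. (cinner z a - c) * f z)
    = (\<Sum>i\<in>UNIV. cscale (cnj (a $ i)) ((\<lambda>z. z $ i) * f)) - cscale c f"
  by (simp add: fun_eq_iff sum_fun_apply cinner_def cscale_def sum_distrib_left sum_distrib_right
      algebra_simps)

lemma affine_multiplication: "f \<in> H \<Longrightarrow> (\<lambda>z. (cinner z a - c) * f z) \<in> H"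
  unfolding affine_multiplication_sum
  using coordinate_multiplication(1) by (intro diff_mem sum_mem scale_mem) auto

text \<open>Up to a scalar, \<open>f\<close> is the product over \<open>x \<in> X\<close> of the affine functions \<open>\<langle>z - x, y - x\<rangle>\<close>, applied
  to the constant function \<open>1 = k\<^sub>0\<close>.\<close>

lemma separating_function:
  assumes "finite X" "X \<subseteq> ball 0 1" "y \<in> ball 0 1" "y \<notin> X"
  obtains f where "f \<in> H" "f y = 1" "\<And>x. x \<in> X \<Longrightarrow> f x = 0"
proof -
  have "\<exists>f\<in>H. f y = 1 \<and> (\<forall>x\<in>X. f x = 0)"
    using assms(1,2,4)
  proof (induction X)
    case empty
    then show ?case using assms(3) by (intro bexI[of _ "ker 0"]) (auto simp: ker_0)
  next
    case (insert x X)
    then obtain f where f: "f \<in> H" "f y = 1" "\<forall>x\<in>X. f x = 0" by auto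
    define g where "g = (\<lambda>z. (cinner z (y - x) - cinner x (y - x)) * f z)"
    have g: "g \<in> H" unfolding g_def by (rule affine_multiplication[OF f(1)])
    have "g y = cinner (y - x) (y - x)" by (simp add: g_def f(2) cinner_diff_left)
    then have "g y \<noteq> 0" using insert.prems by (auto simp: cinner_self)
    moreover have "g t = 0" if "t \<in> insert x X" for t using that f(3) by (auto simp: g_def)
    moreover have "cscale (1 / g y) g \<in> H" using g by simp
    ultimately show ?case by (intro bexI[of _ "cscale (1 / g y) g"]) (simp_all add: cscale_def)
  qed
  then show ?thesis using that by blast
qed

lemma interpolating_functions:
  assumes "finite X" "X \<subseteq> ball 0 1"
  obtains e where "\<And>x. x \<in> X \<Longrightarrow> e x \<in> H"
    "\<And>x y. x \<in> X \<Longrightarrow> y \<in> X \<Longrightarrow> e x y = (if x = y then 1 else 0)"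
proof -
  have "\<exists>f. f \<in> H \<and> f x = 1 \<and> (\<forall>y\<in>X - {x}. f y = 0)" if "x \<in> X" for x
    by (rule separating_function[of "X - {x}" x]) (use assms that in auto)
  then obtain e where "\<And>x. x \<in> X \<Longrightarrow> e x \<in> H \<and> e x x = 1 \<and> (\<forall>y\<in>X - {x}. e x y = 0)" by metis
  then show ?thesis using that[of e] by auto
qed

section \<open>The rows \<open>b\<^sub>X\<close>\<close>

lemma row_length_step: "n > 0 \<Longrightarrow> (n - 1) * (CARD('d) - 1) + CARD('d) = n * (CARD('d) - 1) + 1"
proof -
  assume "n > 0"
  moreover have "CARD('d) > 0" by simp
  ultimately obtain m e where "n = Suc m" "CARD('d) = Suc e" by (metis gr0_implies_Suc)
  then show ?thesis by simp
qed

text \<open>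
  The recursion is Gram--Schmidt: if \<open>(1 - b(z) b(w)\<^sup>*) k(z, w)\<close> is the kernel of \<open>P\<close>, then
  \<open>q = k\<^sub>\<mu> - P k\<^sub>\<mu>\<close> is \<open>z \<mapsto> b(z) b(\<mu>)\<^sup>* k(z, \<mu>)\<close>. The unitary turns the factor \<open>\<phi>\<^sub>\<mu>\<close> towards the
  direction \<open>b(\<mu>)\<^sup>*\<close>, and by the automorphism identity the defect of the new row exceeds the old
  one by \<open>q(z) q(w)\<^sup>* / \<parallel>q\<parallel>\<^sup>2\<close>.
\<close>

lemma b_row_defect:
  fixes xs :: "(complex ^ 'd) list"
  assumes "b_row xs b" "set xs \<subseteq> ball 0 1"
  shows "xs \<noteq> [] \<and> (\<forall>z. b z \<in> carrier_mat 1 ((length xs - 1) * (CARD('d) - 1) + CARD('d))) \<and>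
    (\<exists>P. proj_onto (cfun.span (ker ` set xs)) P \<and>
      (\<forall>z\<in>ball 0 1. \<forall>w\<in>ball 0 1. (1 - row_ip (b z) (b w)) * da_kernel z w = P (ker w) z))"
  using assms
proof (induction)
  case (single \<mu>)
  then have \<mu>: "\<mu> \<in> ball 0 1" by simp
  let ?P = "\<lambda>f. cscale (f \<mu> / da_kernel \<mu> \<mu>) (ker \<mu>)"
  have "(1 - row_ip (ball_aut_row \<mu> z) (ball_aut_row \<mu> w)) * da_kernel z w = ?P (ker w) z"
    if "z \<in> ball 0 1" "w \<in> ball 0 1" for z w
    using ball_aut_identity[OF \<mu> that] that \<mu> by (simp add: row_ip_ball_aut cscale_def ker_apply)
  moreover have "ball_aut_row \<mu> z \<in> carrier_mat 1 CARD('d)" for z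
    by (simp add: ball_aut_row_def)
  ultimately show ?case using proj_onto_single_kernel[OF \<mu>] by (auto intro!: exI[of _ ?P])
next
  case (step xs b k U \<mu>)
  then have \<mu>: "\<mu> \<in> ball 0 1" and xs: "set xs \<subseteq> ball 0 1" by auto
  with step obtain P where P: "proj_onto (cfun.span (ker ` set xs)) P"
    and defect: "\<And>z w. z \<in> ball 0 1 \<Longrightarrow> w \<in> ball 0 1 \<Longrightarrow>
      (1 - row_ip (b z) (b w)) * da_kernel z w = P (ker w) z"
    and ne: "xs \<noteq> []"
    and carr: "\<And>z. b z \<in> carrier_mat 1 ((length xs - 1) * (CARD('d) - 1) + CARD('d))" by auto
  have bc: "b z \<in> carrier_mat 1 (k + 1)" for z
    using carr[of z] ne step.hyps(2)
    by (simp only: row_length_step length_greater_0_conv not_False_eq_True)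
  have Uc: "U \<in> carrier_mat (k + 1) (k + 1)" using step.hyps(3) by (simp add: unitary_mat_def)
  have bUc: "b z * U \<in> carrier_mat 1 (k + 1)" for z using bc Uc by (rule mult_carrier_mat)
  define \<nu> where "\<nu> = row_norm (b \<mu>)"
  define q where "q = ker \<mu> - P (ker \<mu>)"
  have kH: "ker \<mu> \<in> H" using \<mu> by simp
  have qH: "q \<in> H" using proj_mem_H[OF P kH] kH by (simp add: q_def)
  have q_val: "q z = row_ip (b z) (b \<mu>) * da_kernel z \<mu>" if "z \<in> ball 0 1" for z
    using defect[OF that \<mu>] that by (simp add: q_def ker_apply algebra_simps)
  have kk: "da_kernel \<mu> \<mu> \<noteq> 0"
    using one_minus_cinner_nonzero[OF \<mu> \<mu>] by (simp add: da_kernel_def)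
  have qq: "ip q q = complex_of_real (\<nu>\<^sup>2) * da_kernel \<mu> \<mu>"
  proof -
    have "ip q q = ip q (ker \<mu>)"
      unfolding q_def using proj_orth[OF P kH proj_mem[OF P kH]] proj_mem_H[OF P kH] kH
      by (simp add: ip_diff_right del: ip_ker)
    also have "\<dots> = q \<mu>" using qH \<mu> by simp
    finally show ?thesis using q_val[OF \<mu>] by (simp add: row_ip_self \<nu>_def)
  qed
  have U0: "U $$ (i, 0) = complex_of_real (1 / \<nu>) * cnj (b \<mu> $$ (0, i))" if i: "i < k + 1" for i
  proof -
    have "U $$ (i, 0) = vec_index (U *\<^sub>v unit_vec (k + 1) 0) i"
      using Uc i by (simp add: scalar_prod_right_unit)
    also have "\<dots> = complex_of_real (1 / \<nu>) * cnj (b \<mu> $$ (0, i))"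
      unfolding step.hyps(4) using i bc[of \<mu>] mat_adjoint_carrier[OF bc[of \<mu>]]
      by (simp add: mat_adjoint_index \<nu>_def)
    finally show ?thesis .
  qed
  have y0: "(b z * U) $$ (0, 0) = complex_of_real (1 / \<nu>) * row_ip (b z) (b \<mu>)" for z
  proof -
    have "(b z * U) $$ (0, 0) = (\<Sum>i<k + 1. b z $$ (0, i) * U $$ (i, 0))"
      using bc[of z] Uc by (simp add: scalar_prod_def lessThan_atLeast0 del: sum.op_ivl_Suc sum.lessThan_Suc)
    also have "\<dots> = (\<Sum>i<k + 1. complex_of_real (1 / \<nu>) * (b z $$ (0, i) * cnj (b \<mu> $$ (0, i))))"
      by (intro sum.cong refl) (simp add: U0)
    also have "\<dots> = complex_of_real (1 / \<nu>) * row_ip (b z) (b \<mu>)"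
      using bc[of z] by (simp only: row_ip_def sum_distrib_left carrier_matD(2))
    finally show ?thesis .
  qed
  let ?D = "\<lambda>z. four_block_mat (ball_aut_row \<mu> z) (0\<^sub>m 1 k) (0\<^sub>m k CARD('d)) (1\<^sub>m k)"
  let ?b = "\<lambda>z. b z * U * ?D z"
  let ?P = "\<lambda>f. P f + cscale (ip f q / ip q q) q"
  have ac: "ball_aut_row \<mu> z \<in> carrier_mat 1 CARD('d)" for z by (simp add: ball_aut_row_def)
  have P': "proj_onto (cfun.span (ker ` set (xs @ [\<mu>]))) ?P"
  proof -
    have "ker ` set xs \<subseteq> H" using xs by auto
    then show ?thesis using proj_onto_insert[OF P kH] by (simp add: q_def)
  qed
  have "(1 - row_ip (?b z) (?b w)) * da_kernel z w = ?P (ker w) z"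
    if z: "z \<in> ball 0 1" and w: "w \<in> ball 0 1" for z w
  proof -
    let ?\<rho> = "row_ip (ball_aut_row \<mu> z) (ball_aut_row \<mu> w)"
    define n where "n = complex_of_real (1 / \<nu>)"
    have eq: "row_ip (?b z) (?b w) = row_ip (b z) (b w)
        - (1 - ?\<rho>) * (n * row_ip (b z) (b \<mu>) * (n * cnj (row_ip (b w) (b \<mu>))))"
      using row_ip_block_step[OF bUc bUc ac ac] row_ip_unitary[OF step.hyps(3) bc bc]
      by (simp add: y0 n_def)
    have "(1 - row_ip (?b z) (?b w)) * da_kernel z w = (1 - row_ip (b z) (b w)) * da_kernel z w
        + ((1 - ?\<rho>) * da_kernel z w) * (n * n) * (row_ip (b z) (b \<mu>) * cnj (row_ip (b w) (b \<mu>)))"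
      by (simp only: eq) (simp add: algebra_simps)
    also have "(1 - ?\<rho>) * da_kernel z w = da_kernel z \<mu> * da_kernel \<mu> w / da_kernel \<mu> \<mu>"
      using ball_aut_identity[OF \<mu> z w] by (simp only: row_ip_ball_aut)
    also have "da_kernel \<mu> w = cnj (da_kernel w \<mu>)"
      using cinner_commute[of \<mu> w] by (simp add: da_kernel_def)
    also have "da_kernel z \<mu> * cnj (da_kernel w \<mu>) / da_kernel \<mu> \<mu> * (n * n)
          * (row_ip (b z) (b \<mu>) * cnj (row_ip (b w) (b \<mu>)))
        = cnj (q w) / ip q q * q z"
      unfolding qq q_val[OF z] q_val[OF w] by (simp add: n_def power2_eq_square mult_ac)
    also have "cnj (q w) = ip (ker w) q" using ip_ker_left[OF qH w] by simp
    also have "(1 - row_ip (b z) (b w)) * da_kernel z w = P (ker w) z" by (rule defect[OF z w])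
    finally show ?thesis by (simp add: cscale_def)
  qed
  moreover have "?b z \<in> carrier_mat 1 ((length (xs @ [\<mu>]) - 1) * (CARD('d) - 1) + CARD('d))" for z
  proof -
    have "?D z \<in> carrier_mat (k + 1) (CARD('d) + k)"
      unfolding add.commute[of k 1] by (rule four_block_carrier_mat[OF ac one_carrier_mat])
    then have "?b z \<in> carrier_mat 1 (CARD('d) + k)" by (rule mult_carrier_mat[OF bUc])
    then show ?thesis using step.hyps(2) by (simp add: add.commute)
  qed
  ultimately show ?case using P' by blast
qed

lemma ker_notin_span:
  assumes "finite X" "X \<subseteq> ball 0 1" "\<mu> \<in> ball 0 1" "\<mu> \<notin> X"
  shows "ker \<mu> \<notin> cfun.span (ker ` X)"
proof
  assume s: "ker \<mu> \<in> cfun.span (ker ` X)"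
  obtain f where f: "f \<in> H" "f \<mu> = 1" "\<And>x. x \<in> X \<Longrightarrow> f x = 0"
    using separating_function[OF assms] by blast
  have "ip f (ker \<mu>) = 0"
    by (rule orthogonal_span[OF _ f(1) _ s]) (use assms f in auto)
  then show False using f assms(3) by simp
qed

text \<open>The prescribed first column is a unit vector because \<open>b(\<mu>) \<noteq> 0\<close>: otherwise \<open>k\<^sub>\<mu>\<close> would lie in the
  span of the kernel functions of the preceding points.\<close>

lemma b_row_exists:
  fixes xs :: "(complex ^ 'd) list"
  assumes "xs \<noteq> []" "distinct xs" "set xs \<subseteq> ball 0 1"
  shows "\<exists>b. b_row xs b"
  using assms
proof (induction xs rule: rev_nonempty_induct)
  case (single \<mu>)
  then show ?case using b_row.single by blast
next
  case (snoc \<mu> xs)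
  then have \<mu>: "\<mu> \<in> ball 0 1" and xs: "set xs \<subseteq> ball 0 1" "\<mu> \<notin> set xs" by auto
  from snoc obtain b where b: "b_row xs b" by auto
  define k where "k = length xs * (CARD('d) - 1)"
  note D = b_row_defect[OF b xs(1)]
  obtain P where P: "proj_onto (cfun.span (ker ` set xs)) P"
    and defect: "(1 - row_ip (b \<mu>) (b \<mu>)) * da_kernel \<mu> \<mu> = P (ker \<mu>) \<mu>"
    using D \<mu> by blast
  have "b \<mu> \<in> carrier_mat 1 ((length xs - 1) * (CARD('d) - 1) + CARD('d))" using D by blast
  then have carr: "b \<mu> \<in> carrier_mat 1 (k + 1)"
    using snoc.hyps by (simp only: row_length_step k_def length_greater_0_conv not_False_eq_True)
  let ?\<nu> = "row_norm (b \<mu>)"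
  have "?\<nu> \<noteq> 0"
  proof
    assume "?\<nu> = 0"
    then have "(ker \<mu> - P (ker \<mu>)) \<mu> = 0" using defect \<mu> by (simp add: row_ip_self ker_apply)
    moreover have kH: "ker \<mu> \<in> H" using \<mu> by simp
    ultimately have "hnorm ip (ker \<mu> - P (ker \<mu>)) = 0"
      using proj_self_ip[OF P kH] proj_mem_H[OF P kH] \<mu> by simp
    then have "ker \<mu> = P (ker \<mu>)" using proj_mem_H[OF P kH] kH by (simp add: hnorm_eq_0_iff)
    then show False using proj_mem[OF P kH] ker_notin_span[of "set xs" \<mu>] xs \<mu> by auto
  qed
  define v where "v = complex_of_real (1 / ?\<nu>) \<cdot>\<^sub>v Matrix.col (mat_adjoint (b \<mu>)) 0"
  have vc: "v \<in> carrier_vec (k + 1)"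
    unfolding v_def by (intro carrier_vecI)
      (simp only: index_smult_vec dim_col carrier_matD(1)[OF mat_adjoint_carrier[OF carr]])
  have vi: "vec_index v i = complex_of_real (1 / ?\<nu>) * cnj (b \<mu> $$ (0, i))" if "i < k + 1" for i
    using that carr mat_adjoint_carrier[OF carr] by (simp add: v_def mat_adjoint_index)
  have "(\<Sum>i<k + 1. vec_index v i * cnj (vec_index v i))
      = (\<Sum>i<k + 1. complex_of_real (1 / ?\<nu>\<^sup>2) * (b \<mu> $$ (0, i) * cnj (b \<mu> $$ (0, i))))"
    by (intro sum.cong refl) (simp add: vi power2_eq_square)
  also have "\<dots> = complex_of_real (1 / ?\<nu>\<^sup>2) * row_ip (b \<mu>) (b \<mu>)"
    using carr by (simp only: row_ip_def sum_distrib_left carrier_matD(2))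
  also have "\<dots> = 1" using \<open>?\<nu> \<noteq> 0\<close> by (simp add: row_ip_self)
  finally obtain U where U: "unitary_mat (k + 1) U" "U *\<^sub>v unit_vec (k + 1) 0 = v"
    using unitary_with_first_column[of "k + 1" v] vc by auto
  show ?case using b_row.step[OF b k_def U(1)] U(2) unfolding v_def by blast
qed

end

section \<open>The operators \<open>\<Phi>(X)\<close> and their joint spectra\<close>

text \<open>The ambient space is infinite-dimensional; the assumption \<open>dim V > 0\<close> makes \<open>V\<close> finite-dimensional,
  because the dimension of an infinite-dimensional space is \<open>0\<close> by convention.\<close>

lemma independent_card_eq_dim_span:
  assumes V: "cfun.subspace V" and S: "S \<subseteq> V" "cfun.independent S"
    and card: "card S = cfun.dim V" "cfun.dim V > 0"
  shows "cfun.span S = V"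
proof
  show "cfun.span S \<subseteq> V" using cfun.span_minimal[OF S(1) V] .
  obtain B where B: "B \<subseteq> V" "V \<subseteq> cfun.span B" "card B = cfun.dim V"
    using cfun.basis_exists[of V] by metis
  have finB: "finite B" using B(3) card(2) card.infinite by fastforce
  show "V \<subseteq> cfun.span S"
  proof (rule ccontr)
    assume "\<not> V \<subseteq> cfun.span S"
    then obtain w where w: "w \<in> V" "w \<notin> cfun.span S" by blast
    have ind: "cfun.independent (insert w S)" using w S by (intro cfun.independent_insertI)
    have "insert w S \<subseteq> cfun.span B" using w(1) S(1) B(2) by auto
    note bound = cfun.independent_span_bound[OF finB ind this]
    have "w \<notin> S" using w(2) cfun.span_base by blast
    then have "card (insert w S) = Suc (card S)" using bound by simp
    then show False using bound B(3) card by simp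
  qed
qed

lemma cscale_apply: "cscale c f x = c * f x"
  by (simp add: cscale_def)

lemma sum_singleton_mset: "finite X \<Longrightarrow> (\<Sum>\<mu>\<in>X. {#\<mu>#}) = mset_set X"
  by (induction X rule: finite_induct) auto

lemma distinct_point_multiset_list:
  assumes X: "X \<in> distinct_point_multisets n" and xs: "mset xs = X"
  shows "distinct xs" "length xs = n" "set xs \<subseteq> ball 0 1"
proof -
  have c: "count (mset xs) x \<le> 1" for x using X xs by (simp add: distinct_point_multisets_def)
  have "count (mset xs) x = (if x \<in> set xs then 1 else 0)" for x
    using c[of x] count_greater_zero_iff[of "mset xs" x] by (auto simp: not_in_iff simp del: count_greater_zero_iff)
  then show "distinct xs" by (simp add: distinct_count_atmost_1)
  show "length xs = n" "set xs \<subseteq> ball 0 1"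
    using X xs by (auto simp: distinct_point_multisets_def point_multisets_def)
qed

lemma distinct_point_multiset_set:
  assumes X: "X \<in> distinct_point_multisets n"
  shows "finite (set_mset X)" "set_mset X \<subseteq> ball 0 1" "card (set_mset X) = n"
    "mset_set (set_mset X) = X"
proof -
  obtain xs where xs: "mset xs = X" using ex_mset by blast
  note D = distinct_point_multiset_list[OF X xs]
  show "set_mset X \<subseteq> ball 0 1" "card (set_mset X) = n" "mset_set (set_mset X) = X"
    using D xs distinct_card[OF D(1)] mset_set_set[OF D(1)] by auto
qed simp

context drury_arveson
begin

lemma b_rows_of_nonempty:
  fixes X :: "(complex ^ 'd) multiset"
  assumes X: "X \<in> distinct_point_multisets n" and n: "n \<ge> 1"
  shows "b_rows_of X \<noteq> {}"
proof -
  obtain xs where xs: "mset xs = X" using ex_mset by blast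
  note D = distinct_point_multiset_list[OF X xs]
  have "xs \<noteq> []" using D(2) n by auto
  then show ?thesis using b_row_exists[OF _ D(1,3)] xs unfolding b_rows_of_def by blast
qed

text \<open>The projection only depends on the set of points, which is why neither the ordering nor the
  unitaries matter.\<close>

lemma b_defect_op_projection:
  assumes X: "X \<in> distinct_point_multisets n" and b: "b \<in> b_rows_of X"
  shows "proj_onto (cfun.span (ker ` set_mset X)) (b_defect_op H ip n b)"
    and "b_defect_op H ip n b \<in> extensional H"
    and "\<And>j. j < (n - 1) * (CARD('d) - 1) + CARD('d) \<Longrightarrow> (\<lambda>z. b z $$ (0, j)) \<in> multipliers H"
proof -
  let ?N = "(n - 1) * (CARD('d) - 1) + CARD('d)"
  obtain xs where xs: "mset xs = X" "b_row xs b" using b by (auto simp: b_rows_of_def)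
  note D = distinct_point_multiset_list[OF X xs(1)]
  have carr: "b z \<in> carrier_mat 1 ?N" for z using b_row_defect[OF xs(2) D(3)] D(2) by blast
  obtain P where P: "proj_onto (cfun.span (ker ` set xs)) P"
    and defect: "\<And>z w. z \<in> ball 0 1 \<Longrightarrow> w \<in> ball 0 1 \<Longrightarrow>
      (1 - row_ip (b z) (b w)) * da_kernel z w = P (ker w) z"
    using b_row_defect[OF xs(2) D(3)] by blast
  have defect': "(1 - (\<Sum>j<?N. b z $$ (0, j) * cnj (b w $$ (0, j)))) * da_kernel z w = P (ker w) z"
    if "z \<in> ball 0 1" "w \<in> ball 0 1" for z w
    using defect[OF that] carr[of z] by (simp add: row_ip_def)
  have op: "b_defect_op H ip n b = restrict P H"
    unfolding b_defect_op_def
    by (rule row_defect_op_eq_projection[OF P, where \<beta> = "\<lambda>j z. b z $$ (0, j)"])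
      (use defect' in auto)
  then show "b_defect_op H ip n b \<in> extensional H" by simp
  have "set xs = set_mset X" using xs(1) by auto
  then show "proj_onto (cfun.span (ker ` set_mset X)) (b_defect_op H ip n b)"
    unfolding op using P proj_onto_cong by fastforce
  show "(\<lambda>z. b z $$ (0, j)) \<in> multipliers H" if "j < ?N" for j
    by (rule row_entry_multiplier[OF P _ that, where \<beta> = "\<lambda>j z. b z $$ (0, j)"]) (rule defect')
qed

lemma extensional_projection_eq:
  "proj_onto S P \<Longrightarrow> proj_onto S Q \<Longrightarrow> P \<in> extensional H \<Longrightarrow> Q \<in> extensional H \<Longrightarrow> P = Q"
  by (rule extensionalityI[of P H Q]) (auto intro: proj_unique)

lemma Phi_projection:
  assumes X: "X \<in> distinct_point_multisets n" and n: "n \<ge> 1"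
  shows "proj_onto (cfun.span (ker ` set_mset X)) (Phi H ip n X)" "Phi H ip n X \<in> extensional H"
proof -
  have "(SOME b. b \<in> b_rows_of X) \<in> b_rows_of X"
    using b_rows_of_nonempty[OF X n] by (simp add: some_in_eq)
  from b_defect_op_projection(1,2)[OF X this]
  show "proj_onto (cfun.span (ker ` set_mset X)) (Phi H ip n X)" "Phi H ip n X \<in> extensional H"
    by (simp_all add: Phi_def)
qed

lemma b_defect_op_eq_Phi:
  assumes "X \<in> distinct_point_multisets n" "n \<ge> 1" "b \<in> b_rows_of X"
  shows "b_defect_op H ip n b = Phi H ip n X"
  using assms b_defect_op_projection Phi_projection by (intro extensional_projection_eq) auto

text \<open>In the coordinates given by evaluation on \<open>X\<close>, compressed multiplication by \<open>z\<^sub>j\<close> is the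
  diagonal operator with entries \<open>x\<^sub>j\<close>. So the joint spectrum is \<open>X\<close>, and a vector lies in the
  root space of \<open>\<mu>\<close> exactly when it vanishes on \<open>X - {\<mu>}\<close>.\<close>

lemma Psi_kernel_projection:
  fixes X :: "(complex ^ 'd) set"
  assumes X: "finite X" "X \<subseteq> ball 0 1" "X \<noteq> {}"
    and P: "proj_onto (cfun.span (ker ` X)) P"
  shows "Psi H P = mset_set X"
proof -
  let ?V = "cfun.span (ker ` X)"
  define A where "A = (\<lambda>j :: 'd. \<lambda>v\<in>?V. P (mult_op H (\<lambda>z. z $ j) v))"
  obtain e where e: "\<And>x. x \<in> X \<Longrightarrow> e x \<in> H"
    "\<And>x y. x \<in> X \<Longrightarrow> y \<in> X \<Longrightarrow> e x y = (if x = y then 1 else 0)"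
    using interpolating_functions[OF X(1,2)] by metis
  have VH: "?V \<subseteq> H" by (rule ker_span_sub[OF X(2)])
  have dimV: "cfun.dim ?V = card X" by (rule dim_span_ker[OF X(1,2) e])
  have card_pos: "card X > 0" using X by (simp add: card_gt_0_iff)
  have A_mem: "A j v \<in> ?V" and A_val: "x \<in> X \<Longrightarrow> A j v x = x $ j * v x" if "v \<in> ?V" for j v x
  proof -
    have zv: "(\<lambda>z. z $ j) * v \<in> H" using that VH coordinate_multiplication(1) by blast
    have Av: "A j v = P ((\<lambda>z. z $ j) * v)" using that VH by (auto simp: A_def mult_op_def)
    show "A j v \<in> ?V" unfolding Av by (rule proj_mem[OF P zv])
    show "A j v x = x $ j * v x" if "x \<in> X"
      unfolding Av using proj_ker_eval[OF P that X(2) zv] by simp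
  qed
  have S_mem: "shifted A \<mu> j v \<in> ?V" if "v \<in> ?V" for \<mu> j v
    unfolding shifted_def by (intro cfun.span_diff cfun.span_scale A_mem that)
  have S_val: "shifted A \<mu> j v x = (x $ j - \<mu> $ j) * v x" if "v \<in> ?V" "x \<in> X" for \<mu> j v x
    using A_val[OF that] by (simp add: shifted_def cscale_apply algebra_simps)
  have pow: "(shifted A \<mu> j ^^ a) v \<in> ?V \<and>
      (\<forall>x\<in>X. (shifted A \<mu> j ^^ a) v x = (x $ j - \<mu> $ j) ^ a * v x)" if "v \<in> ?V" for \<mu> j a v
    using that by (induction a) (auto simp: S_mem S_val)
  define F where "F \<mu> \<alpha> js = foldr (\<lambda>j T. (shifted A \<mu> j ^^ \<alpha> j) \<circ> T) js id" for \<mu> \<alpha> js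
  have F_Nil: "F \<mu> \<alpha> [] v = v"
    and F_Cons: "F \<mu> \<alpha> (j # js) v = (shifted A \<mu> j ^^ \<alpha> j) (F \<mu> \<alpha> js v)" for \<mu> \<alpha> j js v
    by (simp_all add: F_def)
  have fold: "F \<mu> \<alpha> js v \<in> ?V \<and>
      (\<forall>x\<in>X. F \<mu> \<alpha> js v x = prod_list (map (\<lambda>j. (x $ j - \<mu> $ j) ^ \<alpha> j) js) * v x)"
    if "v \<in> ?V" for \<mu> \<alpha> js v
    using that
  proof (induction js)
    case (Cons j js)
    then show ?case
      using pow[where v = "F \<mu> \<alpha> js v" and \<mu> = \<mu> and j = j and a = "\<alpha> j"]
      by (simp add: F_Cons mult.assoc)
  qed (simp add: F_Nil)
  have tp: "tuple_power (shifted A \<mu>) \<alpha> = F \<mu> \<alpha> coords" for \<mu> \<alpha>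
    by (simp only: tuple_power_def F_def)
  have tp_mem: "tuple_power (shifted A \<mu>) \<alpha> v \<in> ?V"
    and tp_val: "x \<in> X \<Longrightarrow> tuple_power (shifted A \<mu>) \<alpha> v x
      = prod_list (map (\<lambda>j. (x $ j - \<mu> $ j) ^ \<alpha> j) coords) * v x"
    if "v \<in> ?V" for \<mu> \<alpha> v x
    using fold[OF that, where \<mu> = \<mu> and \<alpha> = \<alpha> and js = coords] unfolding tp by blast+
  have zeroI: "v = 0" if "v \<in> ?V" "\<And>x. x \<in> X \<Longrightarrow> v x = 0" for v
    using span_ker_zeroI[OF X(2) that] .
  have root: "root_space ?V A \<mu> = {v \<in> ?V. \<forall>x\<in>X - {\<mu>}. v x = 0}" for \<mu>
  proof (rule Set.set_eqI, rule iffI)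
    fix v assume v: "v \<in> root_space ?V A \<mu>"
    then have vV: "v \<in> ?V" by (simp add: root_space_def)
    have "v x = 0" if x: "x \<in> X - {\<mu>}" for x
    proof -
      obtain j where j: "x $ j \<noteq> \<mu> $ j" using x by (auto simp: Finite_Cartesian_Product.vec_eq_iff)
      define \<alpha> where "\<alpha> i = (if i = j then card X else 0)" for i
      have "(\<Sum>i\<in>UNIV. \<alpha> i) = cfun.dim ?V" unfolding dimV by (simp add: \<alpha>_def)
      then have "tuple_power (shifted A \<mu>) \<alpha> v = 0" using v unfolding root_space_def by blast
      then have "prod_list (map (\<lambda>j. (x $ j - \<mu> $ j) ^ \<alpha> j) coords) * v x = 0"
        using tp_val[OF vV, of x \<mu> \<alpha>] x by simp
      moreover have "prod_list (map (\<lambda>j. (x $ j - \<mu> $ j) ^ \<alpha> j) coords) \<noteq> 0"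
        using j by (auto simp: prod_list_zero_iff \<alpha>_def split: if_splits)
      ultimately show ?thesis by simp
    qed
    then show "v \<in> {v \<in> ?V. \<forall>x\<in>X - {\<mu>}. v x = 0}" using vV by simp
  next
    fix v assume "v \<in> {v \<in> ?V. \<forall>x\<in>X - {\<mu>}. v x = 0}"
    then have v: "v \<in> ?V" "\<And>x. x \<in> X - {\<mu>} \<Longrightarrow> v x = 0" by auto
    have "tuple_power (shifted A \<mu>) \<alpha> v = 0" if \<alpha>: "(\<Sum>j\<in>UNIV. \<alpha> j) = cfun.dim ?V" for \<alpha>
    proof (rule zeroI[OF tp_mem[OF v(1)]])
      fix x assume x: "x \<in> X"
      show "tuple_power (shifted A \<mu>) \<alpha> v x = 0"
      proof (cases "x = \<mu>")
        case True
        obtain j where "\<alpha> j \<noteq> 0" using \<alpha> dimV card_pos by (metis less_irrefl sum.neutral UNIV_I)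
        then have "(x $ j - \<mu> $ j) ^ \<alpha> j = 0" using True by simp
        moreover have "(x $ j - \<mu> $ j) ^ \<alpha> j \<in> set (map (\<lambda>j. (x $ j - \<mu> $ j) ^ \<alpha> j) coords)"
          unfolding set_map coords_set by (rule rangeI)
        ultimately have "prod_list (map (\<lambda>j. (x $ j - \<mu> $ j) ^ \<alpha> j) coords) = 0"
          by (simp only: prod_list_zero_iff)
        then show ?thesis using tp_val[OF v(1) x] by simp
      qed (use tp_val[OF v(1) x] v(2) x in simp)
    qed
    then show "v \<in> root_space ?V A \<mu>" using v by (simp add: root_space_def)
  qed
  define u where "u \<mu> = P (e \<mu>)" for \<mu>
  have u: "u \<mu> \<in> ?V" "x \<in> X \<Longrightarrow> u \<mu> x = (if \<mu> = x then 1 else 0)" if "\<mu> \<in> X" for \<mu> x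
    using that proj_mem[OF P e(1)] proj_ker_eval[OF P _ X(2) e(1), of x \<mu>] e(2)
    by (auto simp: u_def)
  have u0: "u \<mu> \<noteq> 0" if "\<mu> \<in> X" for \<mu>
    using u(2)[OF that that] by auto
  have dim_root: "cfun.dim (root_space ?V A \<mu>) = 1" if \<mu>: "\<mu> \<in> X" for \<mu>
  proof -
    have "root_space ?V A \<mu> = cfun.span {u \<mu>}"
    proof
      show "root_space ?V A \<mu> \<subseteq> cfun.span {u \<mu>}"
      proof
        fix v assume "v \<in> root_space ?V A \<mu>"
        then have v: "v \<in> ?V" "\<And>x. x \<in> X - {\<mu>} \<Longrightarrow> v x = 0" by (auto simp: root)
        have "v - cscale (v \<mu>) (u \<mu>) = 0"
        proof (rule zeroI)
          show "v - cscale (v \<mu>) (u \<mu>) \<in> ?V"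
            using v(1) u(1)[OF \<mu>] by (intro cfun.span_diff cfun.span_scale)
          show "(v - cscale (v \<mu>) (u \<mu>)) x = 0" if "x \<in> X" for x
            using that u(2)[OF \<mu> that] v(2)[of x] by (auto simp: cscale_def)
        qed
        then have "v = cscale (v \<mu>) (u \<mu>)" by simp
        then show "v \<in> cfun.span {u \<mu>}" using cfun.span_base cfun.span_scale by (metis singletonI)
      qed
      have "u \<mu> \<in> root_space ?V A \<mu>" using u[OF \<mu>] by (auto simp: root)
      moreover have "cfun.subspace (root_space ?V A \<mu>)"
        unfolding root cfun.subspace_def
        by (auto simp: cfun.span_zero cfun.span_add cfun.span_scale cscale_apply)
      ultimately show "cfun.span {u \<mu>} \<subseteq> root_space ?V A \<mu>" by (intro cfun.span_minimal) auto
    qed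
    moreover have "cfun.dim (cfun.span {u \<mu>}) = card {u \<mu>}"
      by (rule cfun.dim_span_eq_card_independent) (use u0[OF \<mu>] in simp)
    ultimately show ?thesis by simp
  qed
  have "joint_spectrum ?V A = X"
  proof (rule Set.set_eqI, rule iffI)
    fix \<mu> assume \<mu>: "\<mu> \<in> X"
    have "shifted A \<mu> j (u \<mu>) = 0" for j
      using S_mem[OF u(1)[OF \<mu>]] S_val[OF u(1)[OF \<mu>]] u(2)[OF \<mu>] by (intro zeroI) auto
    then have "u \<mu> \<in> {v \<in> ?V. \<forall>j. shifted A \<mu> j v = 0}" using u(1)[OF \<mu>] by simp
    then show "\<mu> \<in> joint_spectrum ?V A" using u0[OF \<mu>] unfolding joint_spectrum_def by blast
  next
    fix \<mu> assume \<mu>: "\<mu> \<in> joint_spectrum ?V A"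
    have "0 \<in> {v \<in> ?V. \<forall>j. shifted A \<mu> j v = 0}"
      using S_mem[OF cfun.span_zero] S_val[OF cfun.span_zero]
      by (auto simp: cfun.span_zero intro!: zeroI)
    then obtain v where v: "v \<in> ?V" "\<And>j. shifted A \<mu> j v = 0" "v \<noteq> 0"
      using \<mu> unfolding joint_spectrum_def by blast
    then obtain x where x: "x \<in> X" "v x \<noteq> 0" using zeroI by blast
    have "x $ j = \<mu> $ j" for j using S_val[OF v(1) x(1), of \<mu> j] v(2)[of j] x(2) by simp
    then show "\<mu> \<in> X" using x(1) by (metis Finite_Cartesian_Product.vec_eq_iff)
  qed
  then have "spectral_multiset ?V A = (\<Sum>\<mu>\<in>X. {#\<mu>#})"
    unfolding spectral_multiset_def by (intro sum.cong) (simp_all add: dim_root)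
  then show ?thesis
    unfolding Psi_def proj_image[OF P] using sum_singleton_mset[OF X(1)]
    by (simp only: A_def)
qed

lemma Psi_Phi:
  fixes X :: "(complex ^ 'd) multiset"
  assumes X: "X \<in> distinct_point_multisets n" and n: "n \<ge> 1"
  shows "Psi H (Phi H ip n X) = X"
proof -
  note D = distinct_point_multiset_set[OF X]
  have "set_mset X \<noteq> {}" using D(3) n by auto
  then show ?thesis using Psi_kernel_projection[OF D(1,2) _ Phi_projection(1)[OF X n]] D(4) by simp
qed

lemma Phi_mem:
  fixes X :: "(complex ^ 'd) multiset"
  assumes X: "X \<in> distinct_point_multisets n" and n: "n \<ge> 1"
  shows "Phi H ip n X \<in> coinvariant_projections0 H ip n"
proof -
  let ?P = "Phi H ip n X" and ?S = "cfun.span (ker ` set_mset X)"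
  note D = distinct_point_multiset_set[OF X] and P = Phi_projection[OF X n]
  obtain e where e: "\<And>x. x \<in> set_mset X \<Longrightarrow> e x \<in> H"
    "\<And>x y. x \<in> set_mset X \<Longrightarrow> y \<in> set_mset X \<Longrightarrow> e x y = (if x = y then 1 else 0)"
    using interpolating_functions[OF D(1,2)] by metis
  have "?P \<in> orth_projections H ip"
    using restrict_proj_orth_projection[OF P(1)] extensional_restrict[OF P(2)] by simp
  moreover have "cfun.dim (?P ` H) = n"
    unfolding proj_image[OF P(1)] using dim_span_ker[OF D(1,2) e] D(3) by simp
  moreover have "?P (adjoint_op H ip H ip (mult_op H \<phi>) (?P g)) = adjoint_op H ip H ip (mult_op H \<phi>) (?P g)"
    if "\<phi> \<in> multipliers H" "g \<in> H" for \<phi> g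
    using span_ker_coinvariant[OF D(2) that(1) proj_mem[OF P(1) that(2)]] by (rule proj_fix[OF P(1)])
  ultimately show ?thesis
    using Psi_Phi[OF X n] X by (simp add: coinvariant_projections0_def coinvariant_projections_def)
qed

end

section \<open>Coinvariant projections with distinct joint eigenvalues\<close>

context drury_arveson
begin

text \<open>Pairing \<open>w\<close> with \<open>(1 - \<langle>z, l\<rangle>) k\<^sub>l = 1\<close> gives \<open>(1 - \<langle>\<mu>, l\<rangle>) \<langle>k\<^sub>l, w\<rangle> = \<langle>1, w\<rangle>\<close>, which expresses \<open>w(l)\<close>
  by \<open>w(0)\<close>. So the kernel functions are, up to scalars, the only joint eigenvectors of the adjoints
  \<open>M\<^sub>z\<^sub>j\<^sup>*\<close>.\<close>

lemma joint_adjoint_eigenvector: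
  assumes \<mu>: "\<mu> \<in> ball 0 1" and w: "w \<in> H"
    and eig: "\<And>i g. g \<in> H \<Longrightarrow> ip ((\<lambda>z. z $ i) * g) w = \<mu> $ i * ip g w"
  shows "w = cscale (w 0) (ker \<mu>)"
proof (rule mem_ext[OF w])
  show "cscale (w 0) (ker \<mu>) \<in> H" using \<mu> by simp
  fix l :: "complex ^ 'd" assume l: "l \<in> ball 0 1"
  have kl: "ker l \<in> H" using l by simp
  have k0: "ker 0 \<in> H" by simp
  let ?t = "ip (ker l) w"
  have "(\<Sum>i\<in>UNIV. cscale (cnj (l $ i)) ((\<lambda>z. z $ i) * ker l)) - cscale 1 (ker l) = cscale (-1) (ker 0)"
  proof (rule ext)
    fix z
    have "(cinner z l - 1) * ker l z = - ker 0 z"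
    proof (cases "z \<in> ball 0 1")
      case True
      then show ?thesis
        using one_minus_cinner_nonzero[OF True l] ker_0[OF True]
        by (simp add: ker_apply da_kernel_def field_simps)
    qed (simp add: ker_def)
    then show "((\<Sum>i\<in>UNIV. cscale (cnj (l $ i)) ((\<lambda>z. z $ i) * ker l)) - cscale 1 (ker l)) z
        = cscale (-1) (ker 0) z"
      unfolding affine_multiplication_sum[of l 1 "ker l", symmetric] by (simp add: cscale_apply)
  qed
  then have "ip ((\<Sum>i\<in>UNIV. cscale (cnj (l $ i)) ((\<lambda>z. z $ i) * ker l)) - cscale 1 (ker l)) w
      = - ip (ker 0) w"
    using ip_scale[OF k0 w, of "-1"] by simp
  moreover have zl: "(\<lambda>z. z $ i) * ker l \<in> H" for i using coordinate_multiplication(1)[OF kl] .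
  have "ip (\<Sum>i\<in>UNIV. cscale (cnj (l $ i)) ((\<lambda>z. z $ i) * ker l)) w = cinner \<mu> l * ?t"
    using zl w by (subst ip_sum) (auto simp: ip_scale eig[OF kl] cinner_def sum_distrib_left mult_ac)
  moreover have "(\<Sum>i\<in>UNIV. cscale (cnj (l $ i)) ((\<lambda>z. z $ i) * ker l)) \<in> H"
    using zl by (intro sum_mem) auto
  ultimately have "cinner \<mu> l * ?t - ?t = - ip (ker 0) w"
    using kl w by (simp add: ip_diff ip_scale)
  then have "(1 - cinner \<mu> l) * ?t = ip (ker 0) w" by (simp add: algebra_simps)
  then have "(1 - cinner \<mu> l) * cnj (w l) = cnj (w 0)" using w l by (simp add: ip_ker_left)
  then have "(1 - cinner l \<mu>) * w l = w 0"
    by (metis cinner_commute complex_cnj_cnj complex_cnj_diff complex_cnj_mult complex_cnj_one)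
  then show "w l = cscale (w 0) (ker \<mu>) l"
    using one_minus_cinner_nonzero[OF l \<mu>] l
    by (simp add: cscale_apply ker_apply da_kernel_def field_simps)
qed

lemma coordinate_mult_sum:
  "(\<lambda>z. z $ i) * (\<Sum>\<mu>\<in>M. cscale (c \<mu>) (v \<mu>)) = (\<Sum>\<mu>\<in>M. cscale (c \<mu>) ((\<lambda>z. z $ i) * v \<mu>))"
  by (auto simp: fun_eq_iff sum_fun_apply cscale_apply sum_distrib_left mult_ac)

context
  fixes V P and M :: "(complex ^ 'd) set" and v
  assumes P: "proj_onto V P" and finM: "finite M"
    and v_mem: "\<And>\<mu>. \<mu> \<in> M \<Longrightarrow> v \<mu> \<in> V" and v_nz: "\<And>\<mu>. \<mu> \<in> M \<Longrightarrow> v \<mu> \<noteq> 0"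
    and v_eig: "\<And>\<mu> i. \<mu> \<in> M \<Longrightarrow> P ((\<lambda>z. z $ i) * v \<mu>) = cscale (\<mu> $ i) (v \<mu>)"
begin

lemma compressed_coordinate_sum:
  assumes "N \<subseteq> M"
  shows "P ((\<lambda>z. z $ i) * (\<Sum>\<mu>\<in>N. cscale (c \<mu>) (v \<mu>))) = (\<Sum>\<mu>\<in>N. cscale (c \<mu> * \<mu> $ i) (v \<mu>))"
proof -
  have vH: "v \<mu> \<in> H" if "\<mu> \<in> N" for \<mu> using v_mem that assms proj_range_sub[OF P] by blast
  have zv: "(\<lambda>z. z $ i) * v \<mu> \<in> H" if "\<mu> \<in> N" for \<mu> using coordinate_multiplication(1)[OF vH[OF that]] .
  have "P (\<Sum>\<mu>\<in>N. cscale (c \<mu>) ((\<lambda>z. z $ i) * v \<mu>)) = (\<Sum>\<mu>\<in>N. P (cscale (c \<mu>) ((\<lambda>z. z $ i) * v \<mu>)))"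
    using zv finite_subset[OF assms finM] by (intro proj_sum[OF P]) auto
  also have "\<dots> = (\<Sum>\<mu>\<in>N. cscale (c \<mu> * \<mu> $ i) (v \<mu>))"
    using zv assms by (intro sum.cong refl) (auto simp: proj_scale[OF P] v_eig)
  finally show ?thesis by (simp only: coordinate_mult_sum)
qed

text \<open>The usual argument for eigenvectors with distinct eigenvalues: distinct points \<open>\<kappa>\<close> and \<open>\<nu>\<close> differ
  in some coordinate \<open>i\<close>, and subtracting \<open>\<nu>\<^sub>i\<close> times the relation from its image under the \<open>i\<close>-th
  operator removes \<open>v\<^sub>\<nu>\<close>.\<close>

lemma joint_eigenvector_coefficients:
  assumes "N \<subseteq> M" and "(\<Sum>\<mu>\<in>N. cscale (c \<mu>) (v \<mu>)) = 0" and "\<mu> \<in> N"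
  shows "c \<mu> = 0"
  using finite_subset[OF assms(1) finM] assms
proof (induction N arbitrary: c \<mu> rule: finite_induct)
  case (insert \<nu> N)
  have c0: "c \<kappa> = 0" if \<kappa>: "\<kappa> \<in> N" for \<kappa>
  proof -
    obtain i where i: "\<kappa> $ i \<noteq> \<nu> $ i"
      using \<kappa> insert.hyps(2) by (metis Finite_Cartesian_Product.vec_eq_iff)
    have "(\<Sum>\<mu>\<in>insert \<nu> N. cscale (c \<mu> * \<mu> $ i) (v \<mu>)) = P ((\<lambda>z. z $ i) * 0)"
      using compressed_coordinate_sum[OF insert.prems(1), of i c] unfolding insert.prems(2) by simp
    also have "(\<lambda>z. z $ i) * 0 = (0 :: complex ^ 'd \<Rightarrow> complex)" by (simp add: fun_eq_iff)
    also have "P 0 = 0" by (rule proj_fix[OF P cfun.subspace_0[OF proj_subspace[OF P]]])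
    finally have "(\<Sum>\<mu>\<in>insert \<nu> N. cscale (c \<mu> * \<mu> $ i) (v \<mu>))
        - cscale (\<nu> $ i) (\<Sum>\<mu>\<in>insert \<nu> N. cscale (c \<mu>) (v \<mu>)) = 0"
      unfolding insert.prems(2) by simp
    then have "(\<Sum>\<mu>\<in>insert \<nu> N. cscale (c \<mu> * (\<mu> $ i - \<nu> $ i)) (v \<mu>)) = 0"
      by (simp only: cfun.scale_sum_right sum_subtractf[symmetric] cfun.scale_scale
          cfun.scale_left_diff_distrib[symmetric] mult.commute[of "\<nu> $ i"] right_diff_distrib)
    then have "(\<Sum>\<mu>\<in>N. cscale (c \<mu> * (\<mu> $ i - \<nu> $ i)) (v \<mu>)) = 0"
      unfolding sum.insert[OF insert.hyps] by simp
    then have "c \<kappa> * (\<kappa> $ i - \<nu> $ i) = 0"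
      using insert.IH[of "\<lambda>\<mu>. c \<mu> * (\<mu> $ i - \<nu> $ i)" \<kappa>] insert.prems(1) \<kappa> by blast
    then show ?thesis using i by simp
  qed
  have "(\<Sum>\<mu>\<in>N. cscale (c \<mu>) (v \<mu>)) = 0" by (rule sum.neutral) (simp add: c0)
  then have "cscale (c \<nu>) (v \<nu>) = 0"
    using insert.prems(2) unfolding sum.insert[OF insert.hyps] by (simp only: add.right_neutral)
  then have "c \<nu> = 0" using v_nz[of \<nu>] insert.prems(1) by simp
  then show ?case using c0 insert.prems(3) by blast
qed simp

lemma inj_on_joint_eigenvectors: "inj_on v M"
proof (rule inj_onI, rule ccontr)
  fix \<mu> \<nu> assume *: "\<mu> \<in> M" "\<nu> \<in> M" "v \<mu> = v \<nu>" "\<mu> \<noteq> \<nu>"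
  have "(\<Sum>\<kappa>\<in>{\<mu>, \<nu>}. cscale (if \<kappa> = \<mu> then 1 else -1) (v \<kappa>)) = 0" using * by simp
  from joint_eigenvector_coefficients[OF _ this, of \<mu>] show False using * by simp
qed

lemma independent_joint_eigenvectors: "cfun.independent (v ` M)"
proof (rule cfun.independent_if_scalars_zero)
  fix c u assume sum: "(\<Sum>u\<in>v ` M. cscale (c u) u) = 0" and "u \<in> v ` M"
  then obtain \<mu> where \<mu>: "\<mu> \<in> M" "u = v \<mu>" by blast
  have "(\<Sum>\<mu>\<in>M. cscale (c (v \<mu>)) (v \<mu>)) = 0"
    using sum by (simp add: sum.reindex[OF inj_on_joint_eigenvectors])
  from joint_eigenvector_coefficients[OF subset_refl this \<mu>(1)] show "c u = 0" using \<mu> by simp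
qed (use finM in simp)

text \<open>If the eigenvectors \<open>v\<^sub>\<mu>\<close> form a basis of the coinvariant space \<open>V\<close>, the dual basis vector
  \<open>w\<close> of \<open>v\<^sub>\<mu>\<close> is an eigenvector of the adjoints of the compressions. By coinvariance these are the
  restrictions of the operators \<open>M\<^sub>z\<^sub>j\<^sup>*\<close>, hence \<open>w\<close> is a multiple of \<open>k\<^sub>\<mu>\<close>.\<close>

lemma ker_mem_coinvariant:
  assumes dim: "cfun.dim V = card M" and \<mu>: "\<mu> \<in> M" and Mball: "M \<subseteq> ball 0 1"
    and coinv: "\<And>i g. g \<in> V \<Longrightarrow> adjoint_op H ip H ip (mult_op H (\<lambda>z. z $ i)) g \<in> V"
  shows "ker \<mu> \<in> V"
proof -
  have VH: "V \<subseteq> H" and subV: "cfun.subspace V" using proj_range_sub[OF P] proj_subspace[OF P] .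
  have card_pos: "card M > 0" using finM \<mu> by (auto simp: card_gt_0_iff)
  have spanV: "cfun.span (v ` M) = V"
    using v_mem independent_joint_eigenvectors card_image[OF inj_on_joint_eigenvectors] dim card_pos
    by (intro independent_card_eq_dim_span[OF subV]) auto
  let ?F = "v ` (M - {\<mu>})"
  have F: "finite ?F" "?F \<subseteq> H" using finM v_mem VH by auto
  obtain Q where Q: "proj_onto (cfun.span ?F) Q" using proj_onto_exists[OF F] .
  define w where "w = v \<mu> - Q (v \<mu>)"
  have vV: "v \<mu> \<in> V" and vH: "v \<mu> \<in> H" using v_mem[OF \<mu>] VH by auto
  have "Q (v \<mu>) \<in> V"
    using proj_mem[OF Q vH] cfun.span_mono[of ?F "v ` M"] spanV by auto
  then have wV: "w \<in> V" unfolding w_def using vV cfun.subspace_diff[OF subV] by blast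
  then have wH: "w \<in> H" using VH by blast
  have "v ` M - {v \<mu>} = ?F" using inj_on_joint_eigenvectors \<mu> by (auto simp: inj_on_def)
  then have "v \<mu> \<notin> cfun.span ?F"
    using independent_joint_eigenvectors \<mu> unfolding cfun.dependent_def by auto
  then have w0: "w \<noteq> 0" using proj_mem[OF Q vH] unfolding w_def by auto
  have orth: "ip (v \<nu>) w = 0" if "\<nu> \<in> M - {\<mu>}" for \<nu>
  proof -
    have "ip w (v \<nu>) = 0"
      unfolding w_def by (rule proj_orth[OF Q vH]) (use that in \<open>auto intro: cfun.span_base\<close>)
    then show ?thesis using ip_commute[OF wH, of "v \<nu>"] v_mem[of \<nu>] that VH by auto
  qed
  have compressed: "ip (P ((\<lambda>z. z $ i) * u)) w = \<mu> $ i * ip u w" if u: "u \<in> V" for i u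
  proof -
    obtain c where "u = (\<Sum>x\<in>v ` M. cscale (c x) x)"
      using u unfolding spanV[symmetric] cfun.span_finite[OF finite_imageI[OF finM]] by blast
    then have u_eq: "u = (\<Sum>\<nu>\<in>M. cscale (c (v \<nu>)) (v \<nu>))"
      by (simp add: sum.reindex[OF inj_on_joint_eigenvectors])
    have ip_w: "ip (\<Sum>\<nu>\<in>M. cscale (d \<nu>) (v \<nu>)) w = d \<mu> * ip (v \<mu>) w" for d
    proof -
      have "ip (\<Sum>\<nu>\<in>M. cscale (d \<nu>) (v \<nu>)) w = (\<Sum>\<nu>\<in>M. d \<nu> * ip (v \<nu>) w)"
        using v_mem VH wH by (subst ip_sum) (auto simp: ip_scale subset_iff)
      also have "\<dots> = (\<Sum>\<nu>\<in>M. if \<nu> = \<mu> then d \<mu> * ip (v \<mu>) w else 0)"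
        using orth by (intro sum.cong refl) auto
      finally show ?thesis using finM \<mu> by simp
    qed
    show ?thesis
      unfolding u_eq compressed_coordinate_sum[OF subset_refl] ip_w by simp
  qed
  have "ip ((\<lambda>z. z $ i) * g) w = \<mu> $ i * ip g w" if g: "g \<in> H" for i g
  proof -
    obtain u where u: "u \<in> H" "\<And>g. g \<in> H \<Longrightarrow> ip ((\<lambda>z. z $ i) * g) w = ip g u"
      using bounded_multiplication_adjoint[of "\<lambda>z. z $ i" 1 w] coordinate_multiplication wH by auto
    have "adjoint_op H ip H ip (mult_op H (\<lambda>z. z $ i)) w = u"
      using u wH by (intro adjoint_op_eqI) (auto simp: mult_op_def)
    then have uV: "u \<in> V" using coinv[OF wV, of i] by simp
    have cw: "cscale (cnj (\<mu> $ i)) w \<in> V" using wV cfun.subspace_scale[OF subV] by blast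
    let ?d = "u - cscale (cnj (\<mu> $ i)) w"
    have dV: "?d \<in> V" using uV cw cfun.subspace_diff[OF subV] by blast
    have dH: "?d \<in> H" using dV VH by blast
    have "ip ?d u = ip (P ((\<lambda>z. z $ i) * ?d)) w"
      using u(2)[OF dH] proj_ip[OF P coordinate_multiplication(1)[OF dH] wV] by simp
    also have "\<dots> = ip ?d (cscale (cnj (\<mu> $ i)) w)"
      unfolding compressed[OF dV] using dH wH by (simp add: ip_scale_right)
    finally have "ip ?d ?d = 0" using dH u(1) wH by (subst ip_diff_right) auto
    then have "u = cscale (cnj (\<mu> $ i)) w" using ip_self_eq_0_iff[OF dH] by simp
    then show ?thesis using u(2)[OF g] g wH by (simp add: ip_scale_right)
  qed
  then have w_eq: "w = cscale (w 0) (ker \<mu>)"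
    using joint_adjoint_eigenvector wH \<mu> Mball by blast
  then have "w 0 \<noteq> 0" using w0 by (metis cfun.scale_zero_left)
  then have "ker \<mu> = cscale (1 / w 0) w" using w_eq by (metis cfun.scale_scale cfun.scale_one nonzero_eq_divide_eq)
  then show ?thesis using wV cfun.subspace_scale[OF subV] by metis
qed

end

lemma Phi_Psi:
  assumes P: "P \<in> coinvariant_projections0 H ip n" and n: "n \<ge> 1"
  shows "Phi H ip n (Psi H P) = P"
proof -
  let ?X = "Psi H P" and ?V = "P ` H"
  let ?A = "\<lambda>j. \<lambda>v \<in> ?V. P (mult_op H (\<lambda>z. z $ j) v)"
  have X: "?X \<in> distinct_point_multisets n" and PO: "P \<in> orth_projections H ip"
    and dim: "cfun.dim ?V = n"
    and coinv: "\<And>\<phi> g. \<phi> \<in> multipliers H \<Longrightarrow> g \<in> H \<Longrightarrow>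
      P (adjoint_op H ip H ip (mult_op H \<phi>) (P g)) = adjoint_op H ip H ip (mult_op H \<phi>) (P g)"
    using P by (simp_all add: coinvariant_projections0_def coinvariant_projections_def)
  have PV: "proj_onto ?V P" by (rule orth_projection_proj_onto[OF PO])
  have Pext: "P \<in> extensional H"
    using PO by (auto simp: orth_projections_def bounded_ops_def PiE_def)
  have VH: "?V \<subseteq> H" by (rule proj_range_sub[OF PV])
  have subV: "cfun.subspace ?V" by (rule proj_subspace[OF PV])
  note D = distinct_point_multiset_set[OF X]
  have "\<exists>v. v \<in> ?V \<and> v \<noteq> 0 \<and> (\<forall>i. P ((\<lambda>z. z $ i) * v) = cscale (\<mu> $ i) v)" if \<mu>: "\<mu> \<in># ?X" for \<mu>
  proof -
    have "\<mu> \<in> joint_spectrum ?V ?A"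
    proof (rule ccontr)
      assume "\<mu> \<notin> joint_spectrum ?V ?A"
      then have "count ?X \<mu> = 0"
        unfolding Psi_def spectral_multiset_def count_sum
        by (intro sum.neutral ballI) (auto simp: count_replicate_mset)
      then show False using \<mu> by (simp add: count_eq_zero_iff)
    qed
    moreover have "0 \<in> {v \<in> ?V. \<forall>j. shifted ?A \<mu> j v = 0}"
    proof -
      have "0 \<in> ?V" using cfun.subspace_0[OF subV] .
      moreover have "mult_op H (\<lambda>z. z $ j) 0 = 0" for j by (auto simp: mult_op_def fun_eq_iff)
      moreover have "P 0 = 0" by (rule proj_fix[OF PV \<open>0 \<in> ?V\<close>])
      ultimately show ?thesis by (simp add: shifted_def)
    qed
    ultimately obtain v where v: "v \<in> ?V" "v \<noteq> 0" "\<And>j. shifted ?A \<mu> j v = 0"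
      unfolding joint_spectrum_def by blast
    have vH: "v \<in> H" using v(1) VH by blast
    have "P ((\<lambda>z. z $ i) * v) = cscale (\<mu> $ i) v" for i
    proof -
      have "?A i v - cscale (\<mu> $ i) v = 0" using v(3)[of i] unfolding shifted_def .
      moreover have "?A i v = P ((\<lambda>z. z $ i) * v)"
        unfolding restrict_apply' [OF v(1)] using vH by (simp add: mult_op_def)
      ultimately show ?thesis by simp
    qed
    then show ?thesis using v by blast
  qed
  then obtain v where v: "\<And>\<mu>. \<mu> \<in> set_mset ?X \<Longrightarrow> v \<mu> \<in> ?V"
    "\<And>\<mu>. \<mu> \<in> set_mset ?X \<Longrightarrow> v \<mu> \<noteq> 0"
    "\<And>\<mu> i. \<mu> \<in> set_mset ?X \<Longrightarrow> P ((\<lambda>z. z $ i) * v \<mu>) = cscale (\<mu> $ i) (v \<mu>)" by metis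
  have coinvV: "adjoint_op H ip H ip (mult_op H (\<lambda>z. z $ i)) g \<in> ?V" if g: "g \<in> ?V" for i g
  proof -
    have gH: "g \<in> H" and Pg: "P g = g" using g VH proj_fix[OF PV g] by auto
    obtain u where u: "u \<in> H" "\<And>f. f \<in> H \<Longrightarrow> ip ((\<lambda>z. z $ i) * f) g = ip f u"
      using bounded_multiplication_adjoint[of "\<lambda>z. z $ i" 1 g] coordinate_multiplication gH by auto
    have eq: "adjoint_op H ip H ip (mult_op H (\<lambda>z. z $ i)) g = u"
      using u gH by (intro adjoint_op_eqI) (auto simp: mult_op_def)
    have "P u = u" using coinv[OF coordinate_multiplier[of i] gH] unfolding Pg eq .
    then show ?thesis unfolding eq using u(1) by (metis imageI)
  qed
  have kerV: "ker ` set_mset ?X \<subseteq> ?V"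
    using ker_mem_coinvariant[OF PV D(1) v, of _] dim D(2,3) coinvV by auto
  obtain e where e: "\<And>x. x \<in> set_mset ?X \<Longrightarrow> e x \<in> H"
    "\<And>x y. x \<in> set_mset ?X \<Longrightarrow> y \<in> set_mset ?X \<Longrightarrow> e x y = (if x = y then 1 else 0)"
    using interpolating_functions[OF D(1,2)] by metis
  have "cfun.span (ker ` set_mset ?X) = ?V"
    using kerV independent_ker[OF D(1,2) e] card_image[OF inj_on_ker[OF D(1,2) e]] D(3) dim n
    by (intro independent_card_eq_dim_span[OF subV]) auto
  then show ?thesis
    using Phi_projection[OF X n] PV Pext by (intro extensional_projection_eq) auto
qed

section \<open>Continuity\<close>

text \<open>The square of the distance of \<open>k\<^sub>z\<close> from the line \<open>\<complex> k\<^sub>w\<close> is \<open>k(z, z) - \<bar>k(z, w)\<bar>\<^sup>2 / k(w, w)\<close>, and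
  \<open>k(z, z) = 1 / (1 - \<parallel>z\<parallel>\<^sup>2)\<close>.\<close>

lemma pseudohyp_kernel_distance:
  fixes z w :: "complex ^ 'd"
  assumes z: "z \<in> ball 0 1" and w: "w \<in> ball 0 1"
  shows "hnorm ip (ker z - cscale (ker z w / da_kernel w w) (ker w))
    = sqrt (1 / (1 - (norm z)\<^sup>2)) * pseudohyp_dist z w"
proof -
  let ?Q = "\<lambda>f. cscale (f w / da_kernel w w) (ker w)"
  let ?r = "1 - (1 - (norm z)\<^sup>2) * (1 - (norm w)\<^sup>2) / (cmod (1 - cinner z w))\<^sup>2"
  have Q: "proj_onto (cfun.span {ker w}) ?Q" by (rule proj_onto_single_kernel[OF w])
  have zH: "ker z \<in> H" and wH: "ker w \<in> H" using z w by auto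
  have nz: "1 - (norm z)\<^sup>2 > 0" "1 - (norm w)\<^sup>2 > 0" using ball_sq z w by auto
  have "complex_of_real ((hnorm ip (ker z - ?Q (ker z)))\<^sup>2) = ip (ker z - ?Q (ker z)) (ker z)"
    using proj_self_ip[OF Q zH] by simp
  also have "\<dots> = da_kernel z z - da_kernel w z * da_kernel z w / da_kernel w w"
    using z w zH wH by (simp add: ker_apply cscale_apply)
  also have "da_kernel w z * da_kernel z w = complex_of_real (1 / (cmod (1 - cinner z w))\<^sup>2)"
    using complex_norm_square[of "1 - cinner z w"] cinner_commute[of w z]
    by (simp add: da_kernel_def mult.commute)
  also have "da_kernel z z - complex_of_real (1 / (cmod (1 - cinner z w))\<^sup>2) / da_kernel w w
      = complex_of_real (1 / (1 - (norm z)\<^sup>2) * ?r)"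
  proof -
    have "1 / a - 1 / N / (1 / b) = 1 / a * (1 - a * b / N)" if "a > 0" for a b N :: real
      using that by (simp add: right_diff_distrib)
    from this[OF nz(1), of "(cmod (1 - cinner z w))\<^sup>2" "1 - (norm w)\<^sup>2"]
    have "1 / (1 - (norm z)\<^sup>2) - 1 / (cmod (1 - cinner z w))\<^sup>2 / (1 / (1 - (norm w)\<^sup>2))
        = 1 / (1 - (norm z)\<^sup>2) * ?r" .
    then show ?thesis
      unfolding da_kernel_self by (simp only: of_real_diff[symmetric] of_real_divide[symmetric])
  qed
  finally have eq: "(hnorm ip (ker z - ?Q (ker z)))\<^sup>2 = 1 / (1 - (norm z)\<^sup>2) * ?r"
    by (simp only: of_real_eq_iff)
  have "hnorm ip (ker z - ?Q (ker z)) = sqrt ((hnorm ip (ker z - ?Q (ker z)))\<^sup>2)"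
    using zH wH by simp
  also have "\<dots> = sqrt (1 / (1 - (norm z)\<^sup>2)) * pseudohyp_dist z w"
    unfolding eq real_sqrt_mult pseudohyp_dist_def ..
  finally show ?thesis .
qed

text \<open>A permutation that attains the minimum in the metric, read as a map between the underlying
  sets; this removes the chosen orderings.\<close>

lemma multiset_dist_matching:
  fixes X Y :: "(complex ^ 'd) multiset"
  assumes X: "X \<in> distinct_point_multisets n" and Y: "Y \<in> distinct_point_multisets n"
    and dist: "multiset_dist X Y < \<delta>"
  obtains \<tau> where "bij_betw \<tau> (set_mset X) (set_mset Y)"
    "\<And>\<xi>. \<xi> \<in> set_mset X \<Longrightarrow> pseudohyp_dist \<xi> (\<tau> \<xi>) < \<delta>"
proof -
  define x where "x = ordering_of X"
  define y where "y = ordering_of Y"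
  have x: "mset x = X" and y: "mset y = Y"
    using someI_ex[OF ex_mset[of X]] someI_ex[OF ex_mset[of Y]] by (simp_all add: x_def y_def ordering_of_def)
  note Dx = distinct_point_multiset_list[OF X x] and Dy = distinct_point_multiset_list[OF Y y]
  let ?m = "\<lambda>\<sigma>. Max ((\<lambda>j. pseudohyp_dist (x ! j) (y ! \<sigma> j)) ` {..<n})"
  let ?S = "{\<sigma>. \<sigma> permutes {..<n}}"
  have size: "size X = n" using x Dx(2) by auto
  have "finite (?m ` ?S)" by (intro finite_imageI finite_permutations) simp
  moreover have "?m ` ?S \<noteq> {}" using permutes_id by blast
  ultimately have "Min (?m ` ?S) \<in> ?m ` ?S" by (rule Min_in)
  then obtain \<sigma> where \<sigma>: "\<sigma> permutes {..<n}" "Min (?m ` ?S) = ?m \<sigma>" by blast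
  have "multiset_dist X Y = Min (?m ` ?S)"
    by (simp add: multiset_dist_def Let_def size x_def y_def)
  then have m: "?m \<sigma> < \<delta>" using dist \<sigma>(2) by simp
  have close: "pseudohyp_dist (x ! j) (y ! \<sigma> j) < \<delta>" if "j < n" for j
  proof -
    have "pseudohyp_dist (x ! j) (y ! \<sigma> j) \<le> ?m \<sigma>" using that by (intro Max_ge) auto
    then show ?thesis using m by simp
  qed
  have bx: "bij_betw ((!) x) {..<n} (set_mset X)" and by': "bij_betw ((!) y) {..<n} (set_mset Y)"
    using bij_betw_nth[OF Dx(1)] bij_betw_nth[OF Dy(1)] Dx(2) Dy(2) x y by auto
  define \<iota> where "\<iota> = the_inv_into {..<n} ((!) x)"
  have \<iota>: "bij_betw \<iota> (set_mset X) {..<n}" unfolding \<iota>_def by (rule bij_betw_the_inv_into[OF bx])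
  have x\<iota>: "x ! \<iota> \<xi> = \<xi>" if "\<xi> \<in> set_mset X" for \<xi>
    unfolding \<iota>_def using f_the_inv_into_f_bij_betw[OF bx] that by blast
  have "bij_betw ((!) y \<circ> (\<sigma> \<circ> \<iota>)) (set_mset X) (set_mset Y)"
    by (intro bij_betw_trans[OF bij_betw_trans[OF \<iota> permutes_imp_bij[OF \<sigma>(1)]] by'])
  moreover have "pseudohyp_dist \<xi> (((!) y \<circ> (\<sigma> \<circ> \<iota>)) \<xi>) < \<delta>" if "\<xi> \<in> set_mset X" for \<xi>
    using close[of "\<iota> \<xi>"] bij_betwE[OF \<iota>] x\<iota>[OF that] that by auto
  ultimately show ?thesis using that by blast
qed

text \<open>The kernel functions of \<open>X\<close> are compared with their projections onto the lines spanned by the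
  kernel functions of the matching points of \<open>Y\<close>. The constant \<open>C\<close> bounds coefficients by means of
  interpolating functions, and \<open>K\<close> bounds the norms \<open>\<parallel>k\<^sub>\<xi>\<parallel>\<close>; both depend on \<open>X\<close> only.\<close>

lemma Phi_continuous:
  fixes X :: "(complex ^ 'd) multiset"
  assumes X: "X \<in> distinct_point_multisets n" and n: "n \<ge> 1" and \<epsilon>: "\<epsilon> > 0"
  shows "\<exists>\<delta>>0. \<forall>Y \<in> distinct_point_multisets n.
    multiset_dist X Y < \<delta> \<longrightarrow> op_dist H ip (Phi H ip n X) (Phi H ip n Y) < \<epsilon>"
proof -
  let ?M = "set_mset X"
  note D = distinct_point_multiset_set[OF X]
  obtain e where e: "\<And>x. x \<in> ?M \<Longrightarrow> e x \<in> H"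
    "\<And>x y. x \<in> ?M \<Longrightarrow> y \<in> ?M \<Longrightarrow> e x y = (if x = y then 1 else 0)"
    using interpolating_functions[OF D(1,2)] by metis
  define C where "C = (\<Sum>x\<in>?M. hnorm ip (e x))"
  define K where "K = (\<Sum>x\<in>?M. sqrt (1 / (1 - (norm x)\<^sup>2)))"
  have sq: "sqrt (1 / (1 - (norm x)\<^sup>2)) \<ge> 0" if "x \<in> ?M" for x
    using ball_sq[of x] D(2) that by (auto simp: subset_iff)
  have C: "C \<ge> 0" unfolding C_def using e(1) by (intro sum_nonneg) auto
  have K: "K \<ge> 0" unfolding K_def using sq by (intro sum_nonneg)
  define \<delta> where "\<delta> = min (1 / 2) (\<epsilon> / 4) / (1 + C * K)"
  have CK: "0 \<le> C * K" "0 < 1 + C * K" using C K by (simp_all add: add_pos_nonneg)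
  have \<delta>: "\<delta> > 0" unfolding \<delta>_def using \<epsilon> CK by simp
  have "C * K * \<delta> \<le> (1 + C * K) * \<delta>" using \<delta> by (intro mult_right_mono) auto
  also have "\<dots> = min (1 / 2) (\<epsilon> / 4)" using CK by (simp add: \<delta>_def)
  finally have small: "C * (K * \<delta>) \<le> 1 / 2" "C * (K * \<delta>) \<le> \<epsilon> / 4" by (simp_all add: mult.assoc)
  have "op_dist H ip (Phi H ip n X) (Phi H ip n Y) < \<epsilon>"
    if Y: "Y \<in> distinct_point_multisets n" and dist: "multiset_dist X Y < \<delta>" for Y
  proof -
    let ?P = "Phi H ip n X" and ?Q = "Phi H ip n Y"
    note DY = distinct_point_multiset_set[OF Y]
    note P = Phi_projection(1)[OF X n] and Q = Phi_projection(1)[OF Y n]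
    obtain \<tau> where \<tau>: "bij_betw \<tau> ?M (set_mset Y)" "\<And>\<xi>. \<xi> \<in> ?M \<Longrightarrow> pseudohyp_dist \<xi> (\<tau> \<xi>) < \<delta>"
      using multiset_dist_matching[OF X Y dist] by blast
    have \<tau>Y: "\<tau> \<xi> \<in> set_mset Y" if "\<xi> \<in> ?M" for \<xi> using bij_betwE[OF \<tau>(1)] that by blast
    have ball: "\<xi> \<in> ball 0 1" "\<tau> \<xi> \<in> ball 0 1" if "\<xi> \<in> ?M" for \<xi>
      using that \<tau>Y[OF that] D(2) DY(2) by auto
    define t where "t \<xi> = ker \<xi> (\<tau> \<xi>) / da_kernel (\<tau> \<xi>) (\<tau> \<xi>)" for \<xi>
    define u where "u \<xi> = cscale (t \<xi>) (ker (\<tau> \<xi>))" for \<xi>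
    have t0: "t \<xi> \<noteq> 0" if "\<xi> \<in> ?M" for \<xi>
      using one_minus_cinner_nonzero[OF ball(2)[OF that] ball(1)[OF that]]
        one_minus_cinner_nonzero[OF ball(2)[OF that] ball(2)[OF that]] ball(2)[OF that]
      by (simp add: t_def ker_apply da_kernel_def)
    have "hnorm ip (?P f - ?Q f) \<le> 3 * C * (K * \<delta>) * hnorm ip f" if f: "f \<in> H" for f
    proof (rule proj_perturbation[OF P Q, where J = ?M and a = ker and u = u])
      show "ker \<xi> \<in> cfun.span (ker ` ?M)" if "\<xi> \<in> ?M" for \<xi>
        using that by (intro cfun.span_base imageI)
      show "u \<xi> \<in> cfun.span (ker ` set_mset Y)" if "\<xi> \<in> ?M" for \<xi>
        unfolding u_def using \<tau>Y[OF that] by (intro cfun.span_scale cfun.span_base imageI)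
      show "\<exists>c. s = (\<Sum>j\<in>?M. cscale (c j) (ker j))" if "s \<in> cfun.span (ker ` ?M)" for s
        using span_ker_coefficients[OF D(1,2) e that] by blast
      show "\<exists>c. s = (\<Sum>j\<in>?M. cscale (c j) (u j))" if s: "s \<in> cfun.span (ker ` set_mset Y)" for s
      proof -
        obtain e' where e': "\<And>x. x \<in> set_mset Y \<Longrightarrow> e' x \<in> H"
          "\<And>x y. x \<in> set_mset Y \<Longrightarrow> y \<in> set_mset Y \<Longrightarrow> e' x y = (if x = y then 1 else 0)"
          using interpolating_functions[OF DY(1,2)] by metis
        obtain c where "s = (\<Sum>y\<in>set_mset Y. cscale (c y) (ker y))"
          using span_ker_coefficients[OF DY(1,2) e' s] by blast
        also have "\<dots> = (\<Sum>\<xi>\<in>?M. cscale (c (\<tau> \<xi>)) (ker (\<tau> \<xi>)))"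
          by (rule sum.reindex_bij_betw[OF \<tau>(1), symmetric])
        also have "\<dots> = (\<Sum>\<xi>\<in>?M. cscale (c (\<tau> \<xi>) / t \<xi>) (u \<xi>))"
          by (intro sum.cong refl) (simp add: u_def t0)
        finally show ?thesis by (rule exI[of _ "\<lambda>\<xi>. c (\<tau> \<xi>) / t \<xi>"])
      qed
      show "hnorm ip (ker \<xi> - u \<xi>) \<le> K * \<delta>" if \<xi>: "\<xi> \<in> ?M" for \<xi>
      proof -
        have "hnorm ip (ker \<xi> - u \<xi>) = sqrt (1 / (1 - (norm \<xi>)\<^sup>2)) * pseudohyp_dist \<xi> (\<tau> \<xi>)"
          unfolding u_def t_def by (rule pseudohyp_kernel_distance[OF ball[OF \<xi>]])
        also have "\<dots> \<le> sqrt (1 / (1 - (norm \<xi>)\<^sup>2)) * \<delta>"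
          using \<tau>(2)[OF \<xi>] sq[OF \<xi>] by (intro mult_left_mono) auto
        also have "\<dots> \<le> K * \<delta>"
          unfolding K_def using \<delta> \<xi> sq by (intro mult_right_mono member_le_sum) auto
        finally show ?thesis .
      qed
      show "(\<Sum>j\<in>?M. cmod (c j)) \<le> C * hnorm ip (\<Sum>j\<in>?M. cscale (c j) (ker j))" for c
        unfolding C_def by (rule coefficient_bound[OF D(1,2) e])
    qed (use small C K \<delta> f in auto)
    moreover have "3 * C * (K * \<delta>) * hnorm ip f \<le> 3 * C * (K * \<delta>)" if "f \<in> H" "hnorm ip f \<le> 1" for f
      using that C K \<delta> by (intro mult_left_le) auto
    ultimately have "hnorm ip (?P f - ?Q f) \<le> 3 * C * (K * \<delta>)" if "f \<in> H" "hnorm ip f \<le> 1" for f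
      using that order_trans by blast
    moreover have "{f \<in> H. hnorm ip f \<le> 1} \<noteq> {}" using zero_mem hnorm_zero by (metis (mono_tags) mem_Collect_eq empty_iff zero_le_one)
    ultimately have "op_dist H ip ?P ?Q \<le> 3 * C * (K * \<delta>)"
      unfolding op_dist_def by (intro cSUP_least) auto
    also have "\<dots> < \<epsilon>" using small(2) \<epsilon> by simp
    finally show ?thesis .
  qed
  then show ?thesis using \<delta> by blast
qed

end

section \<open>\<open>\<Phi>\<close> as the continuous inverse of \<open>\<Psi>\<close>\<close>

theorem theorem4p4:
  fixes H :: "(complex ^ 'd::finite \<Rightarrow> complex) set"
    and ip :: "(complex ^ 'd \<Rightarrow> complex) \<Rightarrow> (complex ^ 'd \<Rightarrow> complex) \<Rightarrow> complex"
    and n :: nat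
  assumes "drury_arveson H ip"
    and "n \<ge> 1"
  shows
    "(\<forall>X \<in> distinct_point_multisets n.
        b_rows_of X \<noteq> {} \<and>
        (\<forall>b \<in> b_rows_of X.
           (\<forall>j < (n - 1) * (CARD('d) - 1) + CARD('d). (\<lambda>z. b z $$ (0, j)) \<in> multipliers H) \<and>
           b_defect_op H ip n b = Phi H ip n X) \<and>
        Phi H ip n X \<in> coinvariant_projections0 H ip n) \<and>
     (\<forall>X \<in> distinct_point_multisets n. \<forall>\<epsilon>>0. \<exists>\<delta>>0. \<forall>Y \<in> distinct_point_multisets n.
        multiset_dist X Y < \<delta> \<longrightarrow> op_dist H ip (Phi H ip n X) (Phi H ip n Y) < \<epsilon>) \<and>
     (\<forall>X \<in> distinct_point_multisets n. Psi H (Phi H ip n X) = X) \<and>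
     (\<forall>P \<in> coinvariant_projections0 H ip n. Phi H ip n (Psi H P) = P)"
proof -
  interpret drury_arveson H ip by (rule assms(1))
  note n = assms(2)
  show ?thesis
    using b_rows_of_nonempty[OF _ n] b_defect_op_projection(3) b_defect_op_eq_Phi[OF _ n]
      Phi_mem[OF _ n] Phi_continuous[OF _ n] Psi_Phi[OF _ n] Phi_Psi[OF _ n]
    by (intro conjI ballI allI impI) simp_all
qed

end
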